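(* Consider the scalar Cauchy problem $\partial_t u(x,t)+\partial_x f(u(x,t))=0$, $u(x,0)=\psi(x)$, $x\in\mathbb R$, $t\ge 0$. Let $\Delta x_{\{l\}}>0$ be a sequence of step sizes with $\lim_{l\to\infty}\Delta x_{\{l\}}=0$, and let $(U^{\{l\}})_l$ be a sequence of piecewise constant functions constructed from numerical solutions obtained by a modified Patankar Euler (MPE) difference scheme consistent with this Cauchy problem, with mesh size $\Delta x_{\{l\}}$ and time step size $\Delta t_{\{l\}}=\lambda\,\Delta x_{\{l\}}$, where $\lambda$ is constant. Assume that for any domain $[a,b]\times[0,T]$: (i) the total variation in space $\mathrm{TV}(U^{\{l\}}([a,b],t))$ is bounded uniformly in $l$ and $t\in[0,T]$; (ii) the total time variation $\mathrm{TTV}(U^{\{l\}}(x,[0,T]))$ is bounded uniformly in $l$ and $x\in[a,b]$; (iii) $U^{\{l\}}\to u$ in $L^1_{\mathrm{loc}}(\mathbb R\times[0,T))$ as $l\to\infty$. Then $u$ is a weak solution of the Cauchy problem.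
   Context: Cauchy problem: $f,\psi:\mathbb R\to\mathbb R$. A weak solution is a function $u$ such that for all $\phi\in C_0^1(\mathbb R\times[0,\infty))$ (continuously differentiable with compact support) $$\int_0^\infty\int_{-\infty}^\infty[\phi_t u+\phi_x f(u)]\,dx\,dt=-\int_{-\infty}^\infty\phi(x,0)\,u(x,0)\,dx,\qquad u(\cdot,0)=\psi .$$ Grid: uniform, $x_{i+1}-x_i=\Delta x$, $t_{n+1}-t_n=\Delta t$, $t_0=0$, $i\in\mathbb Z$, $n\in\mathbb N_0$. $U_i^n$ approximates $u(x_i,t_n)$, with initial values $U_i^0=\psi_i$ (the grid values $\psi(x_i)$ of $\psi$). The piecewise constant function $U^{\{l\}}(x,t)$ equals $U_i^n$ on the space cell of length $\Delta x_{\{l\}}$ around $x_i$ times $[t_n,t_{n+1})$. MPE difference scheme: given a numerical flux $g_{i+\frac12}^n=g(U_{i-p}^n,\dots,U_{i+q}^n)$, with $g$ continuous in its $p+q+1$ arguments, the values $U_i^n>0$ satisfy $$U_i^{n+1}=U_i^n-\frac{\Delta t}{\Delta x}\bigl(F^\delta_{i+\frac12}(U^n)-F^\delta_{i-\frac12}(U^n)\bigr),\qquad F^\delta_{i+\frac12}(U^n)=\max\{g^n_{i+\frac12},0\}\,\delta_i+\min\{g^n_{i+\frac12},0\}\,\delta_{i+1},\qquad \delta_i=\frac{U_i^{n+1}}{U_i^n}.$$ (Equivalently, it is the MPE method for the production-destruction system with $p_{i,i+1}=d_{i+1,i}=-\min\{g_{i+\frac12}^n,0\}$ and $d_{i,i+1}=p_{i+1,i}=\max\{g_{i+\frac12}^n,0\}$.)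 The scheme preserves positivity. The scheme is consistent with the Cauchy problem if $g$ is consistent with $f$: $g(\bar u,\dots,\bar u)=f(\bar u)$ for every $\bar u$, and $g$ is locally Lipschitz in the sense that there is $K\in\mathbb R$ with $|g(U_{i-p},\dots,U_{i+q})-f(\bar u)|\le K\max_{-p\le j\le q}|U_{i+j}-\bar u|$ for all $U_{i+j}$ sufficiently close to $\bar u$. $\mathrm{TV}(U([a,b],t))$ is the usual total variation in $x$ over $[a,b]$ of $U(\cdot,t)$. Total time variation: for fixed $x$, $\mathrm{TTV}(U(x,[0,T]))=\sup\sum_{n=1}^{n_T}|U(x,t_n)-U(x,t_{n-1})|$, the supremum over all subdivisions $0=t_0<\dots<t_{n_T}=T$, $n_T\in\mathbb N$; for a piecewise constant reconstruction of grid values this is $\sum_n|U^n(x)-U^{n-1}(x)|$.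
   Formalization: The formal theorem additionally assumes that ψ is positive everywhere and continuous almost everywhere, and that the limit u is positive almost everywhere; without such conditions the statement fails (e.g. f = g = 1 with mass lost through a vacuum). *)

theory Defs
  imports "HOL-Analysis.Analysis"
begin

section \<open>The Cauchy problem\<close>

text \<open>
  Test functions: continuously differentiable with compact support in the closed half plane
  \<open>t \<ge> 0\<close>, with partial derivatives \<open>\<phi>x\<close> and \<open>\<phi>t\<close>.
  The support may meet the line \<open>t = 0\<close>; there \<open>\<phi>t\<close> is the one-sided derivative.
\<close>

definition test_function ::
  "(real \<Rightarrow> real \<Rightarrow> real) \<Rightarrow> (real \<Rightarrow> real \<Rightarrow> real) \<Rightarrow> (real \<Rightarrow> real \<Rightarrow> real) \<Rightarrow> bool" where
  "test_function \<phi> \<phi>x \<phi>t \<longleftrightarrow>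
     (\<forall>x. \<forall>t\<ge>0. ((\<lambda>y. \<phi> y t) has_real_derivative \<phi>x x t) (at x)) \<and>
     (\<forall>x. \<forall>t\<ge>0. ((\<lambda>s. \<phi> x s) has_real_derivative \<phi>t x t) (at t within {0..})) \<and>
     continuous_on (UNIV \<times> {0..}) (\<lambda>(x, t). \<phi>x x t) \<and>
     continuous_on (UNIV \<times> {0..}) (\<lambda>(x, t). \<phi>t x t) \<and>
     (\<exists>K. compact K \<and> (\<forall>x. \<forall>t\<ge>0. (x, t) \<notin> K \<longrightarrow> \<phi> x t = 0))"

text \<open>
  Weak solutions with initial values \<open>\<psi>\<close>. A function that is only given up to null sets of the half
  plane has no values on the line \<open>t = 0\<close>, so the condition \<open>u(x, 0) = \<psi>(x)\<close> is built in by writing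
  \<open>\<psi>\<close> in the initial term. Existence of the integrals is part of the notion, since the Isabelle
  integral of a non-integrable function is 0.
\<close>

definition weak_solution ::
  "(real \<Rightarrow> real) \<Rightarrow> (real \<Rightarrow> real) \<Rightarrow> (real \<Rightarrow> real \<Rightarrow> real) \<Rightarrow> bool" where
  "weak_solution f \<psi> u \<longleftrightarrow>
     (\<forall>\<phi> \<phi>x \<phi>t. test_function \<phi> \<phi>x \<phi>t \<longrightarrow>
        set_integrable lebesgue (UNIV \<times> {0..}) (\<lambda>(x, t). \<phi>t x t * u x t + \<phi>x x t * f (u x t)) \<and>
        integrable lebesgue (\<lambda>x. \<phi> x 0 * \<psi> x) \<and>
        set_lebesgue_integral lebesgue (UNIV \<times> {0..})
            (\<lambda>(x, t). \<phi>t x t * u x t + \<phi>x x t * f (u x t))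
          = - (\<integral>x. \<phi> x 0 * \<psi> x \<partial>lebesgue))"


section \<open>The modified Patankar Euler difference scheme\<close>

text \<open>
  A numerical flux with stencil \<open>{- p..q}\<close> is a function of a family indexed by the integers that
  depends only on the entries in the stencil. Continuity refers to the product topology, and for such
  a function it means continuity in its \<open>p + q + 1\<close> arguments.
\<close>

definition numerical_flux :: "nat \<Rightarrow> nat \<Rightarrow> ((int \<Rightarrow> real) \<Rightarrow> real) \<Rightarrow> bool" where
  "numerical_flux p q g \<longleftrightarrow>
     (\<forall>v w. (\<forall>j\<in>{- int p..int q}. v j = w j) \<longrightarrow> g v = g w) \<and> continuous_on UNIV g"

definition consistent_flux ::
  "nat \<Rightarrow> nat \<Rightarrow> ((int \<Rightarrow> real) \<Rightarrow> real) \<Rightarrow> (real \<Rightarrow> real) \<Rightarrow> bool" where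
  "consistent_flux p q g f \<longleftrightarrow>
     (\<forall>c. g (\<lambda>_. c) = f c) \<and>
     (\<forall>c. \<exists>K. \<exists>\<epsilon>>0. \<forall>v. (\<forall>j\<in>{- int p..int q}. \<bar>v j - c\<bar> < \<epsilon>) \<longrightarrow>
        \<bar>g v - f c\<bar> \<le> K * Max ((\<lambda>j. \<bar>v j - c\<bar>) ` {- int p..int q}))"

text \<open>
  Grid values are functions \<open>V\<close> with \<open>V n i\<close> the value at time level \<open>n\<close> and grid point \<open>i\<close>.
  The fluxes at the cell interface \<open>i + 1/2\<close> carry the index \<open>i\<close>.
\<close>

definition flux_at :: "((int \<Rightarrow> real) \<Rightarrow> real) \<Rightarrow> (nat \<Rightarrow> int \<Rightarrow> real) \<Rightarrow> nat \<Rightarrow> int \<Rightarrow> real" where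
  "flux_at g V n i = g (\<lambda>j. V n (i + j))"

definition patankar_weight :: "(nat \<Rightarrow> int \<Rightarrow> real) \<Rightarrow> nat \<Rightarrow> int \<Rightarrow> real" where
  "patankar_weight V n i = V (Suc n) i / V n i"

definition mpe_flux :: "((int \<Rightarrow> real) \<Rightarrow> real) \<Rightarrow> (nat \<Rightarrow> int \<Rightarrow> real) \<Rightarrow> nat \<Rightarrow> int \<Rightarrow> real" where
  "mpe_flux g V n i =
     max (flux_at g V n i) 0 * patankar_weight V n i +
     min (flux_at g V n i) 0 * patankar_weight V n (i + 1)"

definition mpe_scheme ::
  "((int \<Rightarrow> real) \<Rightarrow> real) \<Rightarrow> real \<Rightarrow> real \<Rightarrow> (nat \<Rightarrow> int \<Rightarrow> real) \<Rightarrow> bool" where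
  "mpe_scheme g \<Delta>x \<Delta>t V \<longleftrightarrow>
     (\<forall>n i. V n i > 0) \<and>
     (\<forall>n i. V (Suc n) i = V n i - \<Delta>t / \<Delta>x * (mpe_flux g V n i - mpe_flux g V n (i - 1)))"

definition grid_point :: "real \<Rightarrow> real \<Rightarrow> int \<Rightarrow> real" where
  "grid_point x\<^sub>0 \<Delta>x i = x\<^sub>0 + of_int i * \<Delta>x"

text \<open>
  The value is \<open>V n i\<close> when \<open>x\<close> lies in the cell from \<open>x\<^sub>i - \<Delta>x/2\<close> (included) to \<open>x\<^sub>i + \<Delta>x/2\<close> (excluded)
  and \<open>t\<close> lies in the step from \<open>t\<^sub>n\<close> (included) to \<open>t\<^sub>n\<^sub>+\<^sub>1\<close> (excluded), for \<open>t \<ge> 0\<close>.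
\<close>

definition piecewise_constant ::
  "real \<Rightarrow> real \<Rightarrow> real \<Rightarrow> (nat \<Rightarrow> int \<Rightarrow> real) \<Rightarrow> real \<Rightarrow> real \<Rightarrow> real" where
  "piecewise_constant x\<^sub>0 \<Delta>x \<Delta>t V x t = V (nat \<lfloor>t / \<Delta>t\<rfloor>) \<lfloor>(x - x\<^sub>0) / \<Delta>x + 1 / 2\<rfloor>"


section \<open>Variation and convergence\<close>

text \<open>
  Total variation over the closed interval from \<open>a\<close> to \<open>b\<close>: supremum over all subdivisions
  \<open>a = s 0 < \<dots> < s n = b\<close>.
\<close>

definition total_variation :: "(real \<Rightarrow> real) \<Rightarrow> real \<Rightarrow> real \<Rightarrow> ennreal" where
  "total_variation h a b =
     (SUP (n, s) \<in> {(n, s). s 0 = a \<and> s n = b \<and> strict_mono_on {..n} s}.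
        ennreal (\<Sum>k<n. \<bar>h (s (Suc k)) - h (s k)\<bar>))"

definition L1_loc_tendsto ::
  "(nat \<Rightarrow> real \<Rightarrow> real \<Rightarrow> real) \<Rightarrow> (real \<Rightarrow> real \<Rightarrow> real) \<Rightarrow> (real \<times> real) set \<Rightarrow> bool" where
  "L1_loc_tendsto U u S \<longleftrightarrow>
     (\<forall>K. compact K \<and> K \<subseteq> S \<longrightarrow>
        set_integrable lebesgue K (\<lambda>(x, t). u x t) \<and>
        (\<forall>l. set_integrable lebesgue K (\<lambda>(x, t). U l x t)) \<and>
        (\<lambda>l. set_lebesgue_integral lebesgue K (\<lambda>(x, t). \<bar>U l x t - u x t\<bar>)) \<longlonglongrightarrow> 0)"

end

(*
  Where it exceeds a bound G of the numerical flux in modulus, the Patankar flux F is monotone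
  in space: F > G at an interface forces the weight to exceed 1, so the cell gains mass and F is even
  larger at the upwind interface. Two consequences follow. First, cutting F off at G can only lower the
  new values, so the scheme satisfies a one-sided balance with bounded fluxes, and these converge to f(u)
  because the weights tend to 1 wherever u > 0. Second, a very large F on an interval forces the values
  to be tiny on the whole interval up to its upwind end.

  A vacuum of this kind cannot occur. Since |f(v) - f(0)| <= L v, the mass in an interval that widens
  with speed about L cannot decrease in the limit, and it was positive at an earlier time because u > 0
  almost everywhere (or psi > 0, near t = 0). Hence F is bounded on compact sets for large l, the
  cut-off is inactive, F converges to f(u) in L1, and the Lax-Wendroff summation by parts applies.
*)
theory Submission
  imports Defs
begin

text \<open>The obstacle is that a Patankar weight is a quotient of positive values without a
  positive lower bound uniform in \<open>l\<close>. Neither the variation bounds nor convergence in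
  the mean keeps such quotients bounded, which is why the fluxes have to be cut off first and
  bounded only after vacuum is excluded.

  The speed in the vacuum argument comes from the consistency condition at the single state 0. One
  cell per time step, that is \<open>1 / r\<close>, is added to it so that the edge of a discrete
  tent also grows fast enough. The value \<open>f 0\<close> may be subtracted because only
  differences of fluxes enter.

  Convergence in the mean says nothing about the mass at a fixed time. A ramp in time therefore
  feeds in the mass of a space-time window; in the first window, the pointwise limit of the initial
  values takes its place.

  Grid sums are replaced by integrals of step functions on the plane: the scheme becomes an identity
  between shifts, and summation by parts becomes translation invariance of the Lebesgue
  measure.\<close>

lemma tv_sum_le:
  fixes h y :: "_ \<Rightarrow> real"
  assumes tv: "total_variation h a b \<le> ennreal B" and B: "0 \<le> B"
    and y: "strict_mono_on {..m} y" "a < y 0" "y m < b"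
  shows "(\<Sum>k<m. \<bar>h (y (Suc k)) - h (y k)\<bar>) \<le> B"
proof -
  \<comment> \<open>\<open>total_variation\<close> only admits subdivisions that run exactly from
    \<open>a\<close> to \<open>b\<close>. Both endpoints are added to the points \<open>y\<close>,
    which moves the index by one; the two extra increments are nonnegative and are dropped.\<close>
  define s where "s k = (if k = 0 then a else if k \<le> Suc m then y (k - 1) else b)" for k
  have bnd: "a < y k \<and> y k < b" if "k \<le> m" for k
  proof -
    have "y 0 \<le> y k" "y k \<le> y m"
      using y(1) that by (auto simp: strict_mono_on_leD)
    then show ?thesis using y by linarith
  qed
  have mono: "strict_mono_on {..m + 2} s"
  proof (rule strict_mono_onI)
    fix i j assume ij: "i \<in> {..m + 2}" "j \<in> {..m + 2}" "i < j"
    consider "i = 0" "j \<le> Suc m" | "i = 0" "j = m + 2" | "0 < i" "j \<le> Suc m" | "0 < i" "j = m + 2"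
      using ij by force
    then show "s i < s j"
    proof cases
      case 3
      have "y (i - 1) < y (j - 1)"
        by (rule strict_mono_onD[OF y(1)]) (use 3 ij in auto)
      then show ?thesis using 3 ij by (auto simp: s_def)
    qed (use ij bnd[of "j-1"] bnd[of "i-1"] bnd[of 0] in \<open>auto simp: s_def\<close>)
  qed
  have s0: "s 0 = a" "s (m + 2) = b" by (auto simp: s_def)
  have "ennreal (\<Sum>k<m + 2. \<bar>h (s (Suc k)) - h (s k)\<bar>) \<le> total_variation h a b"
    unfolding total_variation_def
    by (rule SUP_upper2[where i = "(m + 2, s)"]) (use mono s0 in auto)
  then have "(\<Sum>k<m + 2. \<bar>h (s (Suc k)) - h (s k)\<bar>) \<le> B"
    using tv B by (meson ennreal_le_iff order_trans)
  moreover have "(\<Sum>k<m. \<bar>h (y (Suc k)) - h (y k)\<bar>) = (\<Sum>k\<in>{1..<Suc m}. \<bar>h (s (Suc k)) - h (s k)\<bar>)"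
    by (simp add: sum.atLeast_Suc_lessThan_Suc_shift s_def lessThan_atLeast0 del: sum.op_ivl_Suc)
  moreover have "(\<Sum>k\<in>{1..<Suc m}. \<bar>h (s (Suc k)) - h (s k)\<bar>) \<le> (\<Sum>k<m + 2. \<bar>h (s (Suc k)) - h (s k)\<bar>)"
    by (rule sum_mono2) auto
  ultimately show ?thesis by linarith
qed

section \<open>Monotonicity of large Patankar fluxes\<close>

definition clamp_to :: "real \<Rightarrow> real \<Rightarrow> real" where
  "clamp_to C x = max (- C) (min C x)"

context
  fixes g :: "(int \<Rightarrow> real) \<Rightarrow> real" and dx dt :: real and V :: "nat \<Rightarrow> int \<Rightarrow> real"
  assumes scheme: "mpe_scheme g dx dt V" and dx: "0 < dx" and dt: "0 < dt"
begin

lemma V_pos: "0 < V n i" using scheme by (auto simp: mpe_scheme_def)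

lemma V_Suc: "V (Suc n) i = V n i - dt / dx * (mpe_flux g V n i - mpe_flux g V n (i - 1))"
  using scheme by (auto simp: mpe_scheme_def)

lemma patankar_weight_pos: "0 < patankar_weight V n i"
  by (simp add: patankar_weight_def V_pos)

lemma V_Suc_less_iff: "V n i < V (Suc n) i \<longleftrightarrow> mpe_flux g V n i < mpe_flux g V n (i - 1)"
proof -
  have "V n i < V (Suc n) i \<longleftrightarrow> dt / dx * (mpe_flux g V n i - mpe_flux g V n (i - 1)) < 0"
    using V_Suc[of n i] by linarith
  also have "\<dots> \<longleftrightarrow> mpe_flux g V n i < mpe_flux g V n (i - 1)"
    using dx dt by (simp add: mult_less_0_iff zero_less_mult_iff divide_less_0_iff)
  finally show ?thesis .
qed

text \<open>The weights are positive, so the Patankar flux inherits its sign from the numerical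
  flux, and only the weight of the donor cell enters.\<close>

lemma mpe_flux_pos:
  assumes "0 < mpe_flux g V n i"
  shows "0 < flux_at g V n i" "mpe_flux g V n i = flux_at g V n i * patankar_weight V n i"
proof -
  show *: "0 < flux_at g V n i"
  proof (rule ccontr)
    assume "\<not> 0 < flux_at g V n i"
    then have "mpe_flux g V n i = flux_at g V n i * patankar_weight V n (i + 1)"
      by (auto simp: mpe_flux_def)
    also have "\<dots> \<le> 0"
      using patankar_weight_pos[of n "i + 1"] \<open>\<not> 0 < flux_at g V n i\<close> by (simp add: mult_nonpos_nonneg)
    finally show False using assms by simp
  qed
  then show "mpe_flux g V n i = flux_at g V n i * patankar_weight V n i"
    by (auto simp: mpe_flux_def)
qed

lemma mpe_flux_neg:
  assumes "mpe_flux g V n i < 0"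
  shows "flux_at g V n i < 0" "mpe_flux g V n i = flux_at g V n i * patankar_weight V n (i + 1)"
proof -
  show *: "flux_at g V n i < 0"
  proof (rule ccontr)
    assume "\<not> flux_at g V n i < 0"
    then have "mpe_flux g V n i = flux_at g V n i * patankar_weight V n i"
      by (auto simp: mpe_flux_def)
    also have "\<dots> \<ge> 0"
      using patankar_weight_pos[of n i] \<open>\<not> flux_at g V n i < 0\<close> by simp
    finally show False using assms by simp
  qed
  then show "mpe_flux g V n i = flux_at g V n i * patankar_weight V n (i + 1)"
    by (auto simp: mpe_flux_def)
qed

lemma mpe_flux_gt:
  assumes "G < mpe_flux g V n i" "\<bar>flux_at g V n i\<bar> \<le> G"
  shows "mpe_flux g V n i < mpe_flux g V n (i - 1)"
proof -
  have pos: "0 < mpe_flux g V n i" using assms by linarith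
  have "1 < patankar_weight V n i"
  proof (rule ccontr)
    assume "\<not> ?thesis"
    then have "flux_at g V n i * patankar_weight V n i \<le> flux_at g V n i"
      using mpe_flux_pos(1)[OF pos] by (simp add: mult_left_le)
    then show False using mpe_flux_pos(2)[OF pos] assms by linarith
  qed
  then have "V n i < V (Suc n) i" using V_pos[of n i] by (simp add: patankar_weight_def)
  then show ?thesis using V_Suc_less_iff by simp
qed

text \<open>Mirror image for transport to the left: the donor is the cell \<open>i + 1\<close>, and
  its gain forces a still more negative flux at its right interface.\<close>

lemma mpe_flux_less:
  assumes "mpe_flux g V n i < - G" "\<bar>flux_at g V n i\<bar> \<le> G"
  shows "mpe_flux g V n (i + 1) < mpe_flux g V n i"
proof -
  have neg: "mpe_flux g V n i < 0" using assms by linarith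
  have "1 < patankar_weight V n (i + 1)"
  proof (rule ccontr)
    assume "\<not> ?thesis"
    then have "flux_at g V n i \<le> flux_at g V n i * patankar_weight V n (i + 1)"
      using mpe_flux_neg(1)[OF neg] by (simp add: mult_le_cancel_left1 mult_le_cancel_left2)
    then show False using mpe_flux_neg(2)[OF neg] assms by linarith
  qed
  then have "V n (i + 1) < V (Suc n) (i + 1)" using V_pos[of n "i + 1"] by (simp add: patankar_weight_def)
  then show ?thesis using V_Suc_less_iff[of n "i + 1"] by simp
qed

text \<open>
  Beyond the bound \<open>G\<close> of the numerical flux the Patankar flux is monotone in space, and cutting it
  off can only remove inflow.
\<close>

lemma V_Suc_ge_clamp:
  assumes "\<bar>flux_at g V n i\<bar> \<le> G" "\<bar>flux_at g V n (i - 1)\<bar> \<le> G"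
  shows "V (Suc n) i - V n i
    \<ge> - (dt / dx) * (clamp_to G (mpe_flux g V n i) - clamp_to G (mpe_flux g V n (i - 1)))"
proof -
  let ?F = "mpe_flux g V n"
  \<comment> \<open>The excess over the cut-off does not increase from \<open>i - 1\<close> to
    \<open>i\<close>: a positive excess at \<open>i\<close> is larger at \<open>i - 1\<close>, and a
    negative one at \<open>i - 1\<close> is larger in modulus at \<open>i\<close>.\<close>
  have "?F i - clamp_to G (?F i) \<le> ?F (i - 1) - clamp_to G (?F (i - 1))"
  proof -
    have "G < ?F i \<longrightarrow> ?F i < ?F (i - 1)" "?F (i - 1) < - G \<longrightarrow> ?F i < ?F (i - 1)" "0 \<le> G"
      using mpe_flux_gt[of G n i] mpe_flux_less[of n "i - 1" G] assms by auto
    then show ?thesis unfolding clamp_to_def max_def min_def by argo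
  qed
  then have "?F i - ?F (i - 1) \<le> clamp_to G (?F i) - clamp_to G (?F (i - 1))" by linarith
  then have "dt / dx * (?F i - ?F (i - 1)) \<le> dt / dx * (clamp_to G (?F i) - clamp_to G (?F (i - 1)))"
    using dx dt by (intro mult_left_mono) auto
  then show ?thesis using V_Suc[of n i] by linarith
qed

text \<open>The large flux persists at every interface upwind to \<open>j\<close>, where it equals
  numerical flux times weight. So the weight at \<open>j\<close> is at least \<open>R / G\<close>,
  stated here without quotients. Once the new value is bounded by some \<open>M\<close>, the old one
  is at most \<open>G * M / R\<close>.\<close>

lemma mpe_flux_gt_imp_small:
  assumes R: "R < mpe_flux g V n i" "G \<le> R" and G: "\<And>k. j \<le> k \<Longrightarrow> k \<le> i \<Longrightarrow> \<bar>flux_at g V n k\<bar> \<le> G"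
    and "j \<le> i"
  shows "R * V n j \<le> G * V (Suc n) j"
proof -
  have ge: "R < mpe_flux g V n j"
    using \<open>j \<le> i\<close> G
  proof (induction rule: int_le_induct)
    case base
    show ?case using R by simp
  next
    case (step k)
    then have "R < mpe_flux g V n k" by auto
    moreover have "\<bar>flux_at g V n k\<bar> \<le> G" using step by auto
    ultimately show ?case using mpe_flux_gt[of G n k] R by linarith
  qed
  have "\<bar>flux_at g V n j\<bar> \<le> G" using G \<open>j \<le> i\<close> by auto
  then have pos: "0 < mpe_flux g V n j" using ge R by linarith
  have "R \<le> flux_at g V n j * patankar_weight V n j"
    using mpe_flux_pos(2)[OF pos] ge by linarith
  also have "\<dots> \<le> G * patankar_weight V n j"
    using \<open>\<bar>flux_at g V n j\<bar> \<le> G\<close> patankar_weight_pos[of n j] by (intro mult_right_mono) auto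
  finally have "R * V n j \<le> G * patankar_weight V n j * V n j"
    using V_pos[of n j] by (intro mult_right_mono) auto
  also have "\<dots> = G * V (Suc n) j" using V_pos[of n j] by (simp add: patankar_weight_def)
  finally show ?thesis .
qed

text \<open>For transport to the left the donor at the last interface \<open>j - 1\<close> is the
  cell \<open>j\<close>, hence the strict inequality \<open>i < j\<close> and a flux bound that
  stops before \<open>j\<close>.\<close>

lemma mpe_flux_less_imp_small:
  assumes R: "mpe_flux g V n i < - R" "G \<le> R" and G: "\<And>k. i \<le> k \<Longrightarrow> k < j \<Longrightarrow> \<bar>flux_at g V n k\<bar> \<le> G"
    and "i < j"
  shows "R * V n j \<le> G * V (Suc n) j"
proof -
  have "i \<le> j - 1" using \<open>i < j\<close> by simp
  have G': "\<And>k. i \<le> k \<Longrightarrow> k \<le> j - 1 \<Longrightarrow> \<bar>flux_at g V n k\<bar> \<le> G" using G by simp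
  have less: "mpe_flux g V n (j - 1) < - R"
    using \<open>i \<le> j - 1\<close> G'
  proof (induction rule: int_ge_induct)
    case base
    show ?case using R by simp
  next
    case (step k)
    then have "mpe_flux g V n k < - R" by auto
    moreover have "\<bar>flux_at g V n k\<bar> \<le> G" using step by auto
    ultimately show ?case using mpe_flux_less[of n k G] R by linarith
  qed
  have Gj: "\<bar>flux_at g V n (j - 1)\<bar> \<le> G" using G \<open>i < j\<close> by auto
  then have neg: "mpe_flux g V n (j - 1) < 0" using less R by linarith
  have "R \<le> - flux_at g V n (j - 1) * patankar_weight V n j"
    using mpe_flux_neg(2)[OF neg] less by simp
  also have "\<dots> \<le> G * patankar_weight V n j"
    using Gj patankar_weight_pos[of n j] by (intro mult_right_mono) auto
  finally have "R * V n j \<le> G * patankar_weight V n j * V n j"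
    using V_pos[of n j] by (intro mult_right_mono) auto
  also have "\<dots> = G * V (Suc n) j" using V_pos[of n j] by (simp add: patankar_weight_def)
  finally show ?thesis .
qed

end

section \<open>Convergence in the mean on slabs\<close>

text \<open>Compact rectangles that exhaust the closed half plane; all estimates are local on
  them.\<close>

definition slab :: "real \<Rightarrow> real \<Rightarrow> (real \<times> real) set" where
  "slab X T = {-X..X} \<times> {0..T}"

lemma slab_eq_cbox: "slab X T = cbox (- X, 0) (X, T)"
  by (auto simp: slab_def cbox_Pair_eq)

lemma mem_slab: "z \<in> slab X T \<longleftrightarrow> \<bar>fst z\<bar> \<le> X \<and> 0 \<le> snd z \<and> snd z \<le> T"
  by (cases z) (auto simp: slab_def)

lemma sets_slab [measurable, simp]: "slab X T \<in> sets borel"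
  by (simp add: slab_eq_cbox)

lemma strip_borel [measurable, simp]: "UNIV \<times> {a..<b} \<in> sets (borel :: (real \<times> real) measure)" for a b :: real
  by (simp add: borel_Times)

lemma fst_borel_measurable [measurable]: "(fst :: real \<times> real \<Rightarrow> real) \<in> borel_measurable borel"
  and snd_borel_measurable [measurable]: "(snd :: real \<times> real \<Rightarrow> real) \<in> borel_measurable borel"
  by (auto intro!: borel_measurable_continuous_onI continuous_intros)

lemma compact_slab: "compact (slab X T)"
  by (simp add: slab_eq_cbox)

lemma emeasure_slab: "emeasure lborel (slab X T) < \<infinity>"
  by (simp add: slab_eq_cbox emeasure_lborel_cbox_eq)

lemma nn_integral_lborel_shift:
  fixes f :: "'a::euclidean_space \<Rightarrow> ennreal"
  assumes [measurable]: "f \<in> borel_measurable borel"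
  shows "(\<integral>\<^sup>+z. f (z + a) \<partial>lborel) = (\<integral>\<^sup>+z. f z \<partial>lborel)"
proof -
  have "(\<integral>\<^sup>+z. f z \<partial>lborel) = (\<integral>\<^sup>+z. f z \<partial>(distr lborel borel ((+) a)))"
    by (simp add: lborel_distr_plus)
  also have "\<dots> = (\<integral>\<^sup>+z. f (z + a) \<partial>lborel)"
    by (subst nn_integral_distr) (auto simp: add.commute)
  finally show ?thesis by simp
qed

lemma integral_lborel_shift:
  fixes f :: "'a::euclidean_space \<Rightarrow> real"
  assumes [measurable]: "f \<in> borel_measurable borel"
  shows "(\<integral>z. f (z + a) \<partial>lborel) = (\<integral>z. f z \<partial>lborel)"
proof -
  have "(\<integral>z. f z \<partial>lborel) = (\<integral>z. f z \<partial>(distr lborel borel ((+) a)))"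
    by (simp add: lborel_distr_plus)
  also have "\<dots> = (\<integral>z. f (z + a) \<partial>lborel)"
    by (subst integral_distr) (auto simp: add.commute)
  finally show ?thesis by simp
qed

lemma integrable_bounded_support:
  fixes f :: "real \<times> real \<Rightarrow> real"
  assumes [measurable]: "f \<in> borel_measurable borel"
    and "\<And>z. \<bar>f z\<bar> \<le> B" "\<And>z. f z \<noteq> 0 \<Longrightarrow> z \<in> cbox a b"
  shows "integrable lborel f"
  by (rule integrableI_bounded_set[where A = "cbox a b" and B = B])
     (use assms(2,3) in \<open>auto simp: emeasure_lborel_cbox_eq intro!: AE_I2 simp del: split_paired_All\<close>)

lemma set_integrable_slab:
  fixes f :: "real \<times> real \<Rightarrow> real"
  assumes "f \<in> borel_measurable borel" "\<And>z. z \<in> slab X T \<Longrightarrow> \<bar>f z\<bar> \<le> B"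
  shows "set_integrable lborel (slab X T) f"
  unfolding set_integrable_def
  by (rule integrableI_bounded_set_indicator[where B = B]) (use assms emeasure_slab in auto)

text \<open>A replacement for Fubini: a bound on the sums of \<open>D\<close> along the chains \<open>z + k e\<close>.\<close>

lemma nn_integral_chain_le:
  fixes D :: "'a::euclidean_space \<Rightarrow> ennreal"
  assumes [measurable]: "D \<in> borel_measurable borel" "K \<in> sets borel" "A \<in> sets borel"
    and cover: "\<And>z. z \<in> K \<Longrightarrow> \<exists>k<N. z - real k *\<^sub>R e \<in> A"
    and chain: "\<And>z. z \<in> A \<Longrightarrow> (\<Sum>k<N. D (z + real k *\<^sub>R e)) \<le> B"
  shows "(\<integral>\<^sup>+z\<in>K. D z \<partial>lborel) \<le> B * emeasure lborel A"
proof -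
  have "(\<integral>\<^sup>+z\<in>K. D z \<partial>lborel) \<le> (\<integral>\<^sup>+z. (\<Sum>k<N. D z * indicator A (z - real k *\<^sub>R e)) \<partial>lborel)"
  proof (rule nn_integral_mono)
    fix z
    show "D z * indicator K z \<le> (\<Sum>k<N. D z * indicator A (z - real k *\<^sub>R e))"
    proof (cases "z \<in> K")
      case True
      then obtain k where k: "k < N" "z - real k *\<^sub>R e \<in> A" using cover by blast
      have "D z * indicator A (z - real k *\<^sub>R e) \<le> (\<Sum>k<N. D z * indicator A (z - real k *\<^sub>R e))"
        using k by (intro member_le_sum) auto
      then show ?thesis using k True by simp
    qed simp
  qed
  also have "\<dots> = (\<Sum>k<N. \<integral>\<^sup>+z. D z * indicator A (z - real k *\<^sub>R e) \<partial>lborel)"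
    by (rule nn_integral_sum) measurable
  also have "\<dots> = (\<Sum>k<N. \<integral>\<^sup>+z. D (z + real k *\<^sub>R e) * indicator A z \<partial>lborel)"
  proof (rule sum.cong[OF refl])
    fix k
    show "(\<integral>\<^sup>+z. D z * indicator A (z - real k *\<^sub>R e) \<partial>lborel)
        = (\<integral>\<^sup>+z. D (z + real k *\<^sub>R e) * indicator A z \<partial>lborel)"
      using nn_integral_lborel_shift[of "\<lambda>z. D z * indicator A (z - real k *\<^sub>R e)" "real k *\<^sub>R e"] by simp
  qed
  also have "\<dots> = (\<integral>\<^sup>+z. (\<Sum>k<N. D (z + real k *\<^sub>R e) * indicator A z) \<partial>lborel)"
    by (rule nn_integral_sum[symmetric]) measurable
  also have "\<dots> \<le> (\<integral>\<^sup>+z. B * indicator A z \<partial>lborel)"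
    using chain by (intro nn_integral_mono) (auto simp: indicator_def)
  also have "\<dots> = B * emeasure lborel A" by (simp add: nn_integral_cmult_indicator)
  finally show ?thesis .
qed

abbreviation slab_norm :: "real \<Rightarrow> real \<Rightarrow> (real \<times> real \<Rightarrow> real) \<Rightarrow> ennreal" where
  "slab_norm X T h \<equiv> \<integral>\<^sup>+z\<in>slab X T. ennreal \<bar>h z\<bar> \<partial>lborel"

text \<open>Stated with the nonnegative integral: a Bochner integral would be 0 for a non-integrable
  error, whereas this form forces the mean to be finite for large \<open>l\<close>.\<close>

definition L1_null :: "real \<Rightarrow> real \<Rightarrow> (nat \<Rightarrow> real \<times> real \<Rightarrow> real) \<Rightarrow> bool" where
  "L1_null X T e \<longleftrightarrow> (\<lambda>l. \<integral>\<^sup>+z\<in>slab X T. ennreal \<bar>e l z\<bar> \<partial>lborel) \<longlonglongrightarrow> 0"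

lemma ennreal_tendsto_0_iff:
  fixes x :: "nat \<Rightarrow> ennreal"
  shows "x \<longlonglongrightarrow> 0 \<longleftrightarrow> (\<forall>\<epsilon>>0. \<forall>\<^sub>F l in sequentially. x l \<le> ennreal \<epsilon>)"
proof
  assume *: "x \<longlonglongrightarrow> 0"
  show "\<forall>\<epsilon>>0. \<forall>\<^sub>F l in sequentially. x l \<le> ennreal \<epsilon>"
  proof (intro allI impI)
    fix \<epsilon> :: real assume "\<epsilon> > 0"
    then have "\<forall>\<^sub>F l in sequentially. x l < ennreal \<epsilon>"
      by (intro order_tendstoD(2)[OF *]) auto
    then show "\<forall>\<^sub>F l in sequentially. x l \<le> ennreal \<epsilon>" by eventually_elim auto
  qed
next
  assume *: "\<forall>\<epsilon>>0. \<forall>\<^sub>F l in sequentially. x l \<le> ennreal \<epsilon>"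
  show "x \<longlonglongrightarrow> 0"
  proof (rule order_tendstoI)
    fix a :: ennreal assume "0 < a"
    then obtain b where b: "0 < b" "b < a" using dense by blast
    then obtain \<epsilon> where e: "b = ennreal \<epsilon>" "\<epsilon> > 0"
      by (metis ennreal_cases ennreal_less_zero_iff less_top order_less_le_trans top_greatest)
    then have "\<forall>\<^sub>F l in sequentially. x l \<le> ennreal \<epsilon>" using * by auto
    then show "\<forall>\<^sub>F l in sequentially. x l < a" by eventually_elim (use b e in auto)
  qed auto
qed

lemma L1_null_iff:
  "L1_null X T e \<longleftrightarrow>
     (\<forall>\<epsilon>>0. \<forall>\<^sub>F l in sequentially. slab_norm X T (e l) \<le> ennreal \<epsilon>)"
  unfolding L1_null_def ennreal_tendsto_0_iff ..

lemma L1_null_mono: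
  assumes "L1_null X T e'"
    and "\<forall>\<^sub>F l in sequentially. AE z in lborel. z \<in> slab X T \<longrightarrow> \<bar>e l z\<bar> \<le> \<bar>e' l z\<bar>"
  shows "L1_null X T e"
  unfolding L1_null_def
proof (rule tendsto_sandwich[OF _ _ tendsto_const assms(1)[unfolded L1_null_def]])
  show "\<forall>\<^sub>F l in sequentially. slab_norm X T (e l) \<le> slab_norm X T (e' l)"
    using assms(2)
  proof eventually_elim
    case (elim l)
    then show ?case
      by (intro nn_integral_mono_AE) (auto elim!: eventually_mono split: split_indicator)
  qed
qed auto

lemma L1_null_add:
  assumes "L1_null X T e" "L1_null X T e'"
    and [measurable]: "\<And>l. e l \<in> borel_measurable borel" "\<And>l. e' l \<in> borel_measurable borel"
  shows "L1_null X T (\<lambda>l z. \<bar>e l z\<bar> + \<bar>e' l z\<bar>)"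
proof -
  have "slab_norm X T (\<lambda>z. \<bar>e l z\<bar> + \<bar>e' l z\<bar>) =
     slab_norm X T (e l) + slab_norm X T (e' l)" for l
    by (subst nn_integral_add[symmetric]) (auto simp: distrib_right intro!: nn_integral_cong)
  then show ?thesis
    using tendsto_add[OF assms(1,2)[unfolded L1_null_def]] by (simp add: L1_null_def)
qed

lemma L1_null_cmult:
  assumes "L1_null X T e" and [measurable]: "\<And>l. e l \<in> borel_measurable borel"
  shows "L1_null X T (\<lambda>l z. c * e l z)"
proof -
  have "slab_norm X T (\<lambda>z. c * e l z) =
     ennreal \<bar>c\<bar> * slab_norm X T (e l)" for l
    by (subst nn_integral_cmult[symmetric]) (auto simp: abs_mult ennreal_mult mult.assoc intro!: nn_integral_cong)
  then show ?thesis
    using ennreal_tendsto_cmult[OF _ assms(1)[unfolded L1_null_def], of "ennreal \<bar>c\<bar>"]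
    by (simp add: L1_null_def)
qed

lemma L1_null_sum:
  assumes "finite J" "\<And>j. j \<in> J \<Longrightarrow> L1_null X T (e j)"
    and "\<And>j l. e j l \<in> borel_measurable borel"
  shows "L1_null X T (\<lambda>l z. \<Sum>j\<in>J. \<bar>e j l z\<bar>)"
  using assms(1,2)
proof (induction rule: finite_induct)
  case empty
  show ?case by (simp add: L1_null_def)
next
  case (insert i J)
  have "L1_null X T (\<lambda>l z. \<bar>e i l z\<bar> + \<bar>\<Sum>j\<in>J. \<bar>e j l z\<bar>\<bar>)"
    using insert assms(3) by (intro L1_null_add) auto
  then show ?case using insert by simp
qed

lemma L1_null_shift:
  assumes "L1_null X' T' e" and [measurable]: "\<And>l. e l \<in> borel_measurable borel"
    and "\<forall>\<^sub>F l in sequentially. \<forall>z\<in>slab X T. z + a l \<in> slab X' T'"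
  shows "L1_null X T (\<lambda>l z. e l (z + a l))"
  unfolding L1_null_def
proof (rule tendsto_sandwich[OF _ _ tendsto_const assms(1)[unfolded L1_null_def]])
  show "\<forall>\<^sub>F l in sequentially. slab_norm X T (\<lambda>z. e l (z + a l))
      \<le> slab_norm X' T' (e l)"
    using assms(3)
  proof eventually_elim
    case (elim l)
    have "slab_norm X T (\<lambda>z. e l (z + a l))
       \<le> (\<integral>\<^sup>+z. ennreal \<bar>e l (z + a l)\<bar> * indicator (slab X' T') (z + a l) \<partial>lborel)"
      using elim by (intro nn_integral_mono) (auto split: split_indicator)
    also have "\<dots> = slab_norm X' T' (e l)"
      by (rule nn_integral_lborel_shift[of "\<lambda>z. ennreal \<bar>e l z\<bar> * indicator (slab X' T') z"]) measurable
    finally show ?case .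
  qed
qed auto

text \<open>For errors that split into a part fixed in \<open>l\<close> and small in the mean, and a
  part that tends to 0. The moduli of continuity and the set where the limit is small both leave
  such a fixed part.\<close>

lemma L1_null_approx:
  assumes approx: "\<And>\<epsilon>. \<epsilon> > 0 \<Longrightarrow> \<exists>h e'. h \<in> borel_measurable borel \<and> (\<forall>l. e' l \<in> borel_measurable borel) \<and>
      slab_norm X T h \<le> ennreal \<epsilon> \<and> L1_null X T e' \<and>
      (\<forall>\<^sub>F l in sequentially. AE z in lborel. z \<in> slab X T \<longrightarrow> \<bar>e l z\<bar> \<le> \<bar>h z\<bar> + \<bar>e' l z\<bar>)"
  shows "L1_null X T e"
  unfolding L1_null_iff
proof (intro allI impI)
  fix \<epsilon> :: real assume "\<epsilon> > 0"
  then obtain h e' where [measurable]: "h \<in> borel_measurable borel" "\<And>l. e' l \<in> borel_measurable borel"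
    and h: "slab_norm X T h \<le> ennreal (\<epsilon>/2)" and e': "L1_null X T e'"
    and le: "\<forall>\<^sub>F l in sequentially. AE z in lborel. z \<in> slab X T \<longrightarrow> \<bar>e l z\<bar> \<le> \<bar>h z\<bar> + \<bar>e' l z\<bar>"
    using approx[of "\<epsilon>/2"] by auto
  have "\<forall>\<^sub>F l in sequentially. slab_norm X T (e' l) \<le> ennreal (\<epsilon>/2)"
    using e' \<open>\<epsilon> > 0\<close> unfolding L1_null_iff by auto
  with le show "\<forall>\<^sub>F l in sequentially. slab_norm X T (e l) \<le> ennreal \<epsilon>"
  proof eventually_elim
    case (elim l)
    have "slab_norm X T (e l) \<le>
        (\<integral>\<^sup>+z. ennreal \<bar>h z\<bar> * indicator (slab X T) z + ennreal \<bar>e' l z\<bar> * indicator (slab X T) z \<partial>lborel)"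
      using elim(1)
      by (intro nn_integral_mono_AE)
         (auto elim!: eventually_mono split: split_indicator simp flip: ennreal_plus intro!: ennreal_leI)
    also have "\<dots> = slab_norm X T h + slab_norm X T (e' l)"
      by (rule nn_integral_add) measurable
    also have "\<dots> \<le> ennreal (\<epsilon>/2) + ennreal (\<epsilon>/2)" using h elim(2) by (rule add_mono)
    also have "\<dots> = ennreal \<epsilon>" using \<open>\<epsilon> > 0\<close> by (simp flip: ennreal_plus)
    finally show ?case .
  qed
qed

lemma nn_integral_slab_const_le:
  assumes "\<epsilon> > 0"
  obtains c where "c > 0" "slab_norm X T (\<lambda>z. c) \<le> ennreal \<epsilon>"
proof
  let ?m = "measure lborel (slab X T)"
  let ?c = "\<epsilon> / (?m + 1)"
  have m: "0 \<le> ?m" by simp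
  show "?c > 0" using assms m by (intro divide_pos_pos) linarith+
  have "slab_norm X T (\<lambda>z. ?c) = ennreal \<bar>?c\<bar> * emeasure lborel (slab X T)"
    by (simp add: nn_integral_cmult_indicator)
  also have "\<dots> = ennreal (\<bar>?c\<bar> * ?m)"
    unfolding ennreal_mult[OF abs_ge_zero m]
    using emeasure_slab[of X T] by (subst emeasure_eq_ennreal_measure) auto
  also have "\<dots> \<le> ennreal \<epsilon>"
  proof (rule ennreal_leI)
    have "\<bar>\<epsilon> / (m + 1)\<bar> * m \<le> \<epsilon>" if "0 \<le> m" for m :: real
      using that assms by (simp add: field_simps)
    then show "\<bar>?c\<bar> * ?m \<le> \<epsilon>" using m by blast
  qed
  finally show "slab_norm X T (\<lambda>z. ?c) \<le> ennreal \<epsilon>" .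
qed

lemma L1_null_integral_tendsto:
  assumes null: "L1_null X T e" and meas: "\<And>l. e l \<in> borel_measurable borel"
  shows "(\<lambda>l. LINT z:slab X T|lborel. \<bar>e l z\<bar>) \<longlonglongrightarrow> 0"
proof -
  have "(LINT z:slab X T|lborel. \<bar>e l z\<bar>) = enn2real (slab_norm X T (e l))" for l
    unfolding set_lebesgue_integral_def
    by (subst integral_eq_nn_integral)
       (use meas in \<open>auto intro!: arg_cong[where f=enn2real] nn_integral_cong split: split_indicator\<close>)
  moreover have "(\<lambda>l. enn2real (slab_norm X T (e l))) \<longlonglongrightarrow> enn2real 0"
    using null unfolding L1_null_def by (intro tendsto_enn2real) auto
  ultimately show ?thesis by simp
qed

text \<open>The error splits into \<open>(A l - a) * q l\<close>, small because \<open>q l\<close>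
  is bounded, and \<open>a * (q l - q')\<close>, which dominated convergence handles. In the final
  limit the \<open>q l\<close> are difference quotients of a test function, for which only pointwise
  convergence is at hand.\<close>

lemma integral_mult_tendsto:
  fixes A q :: "nat \<Rightarrow> real \<times> real \<Rightarrow> real"
  assumes null: "L1_null X T (\<lambda>l z. A l z - a z)"
    and [measurable]: "\<And>l. q l \<in> borel_measurable borel" "\<And>l. A l \<in> borel_measurable borel"
      "a \<in> borel_measurable borel"
    and a: "set_integrable lborel (slab X T) a"
    and A: "\<forall>\<^sub>F l in sequentially. set_integrable lborel (slab X T) (A l)"
    and q: "\<And>l z. z \<in> slab X T \<Longrightarrow> \<bar>q l z\<bar> \<le> C"
    and lim: "\<And>z. z \<in> slab X T \<Longrightarrow> (\<lambda>l. q l z) \<longlonglongrightarrow> q' z"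
  shows "(\<lambda>l. LINT z:slab X T|lborel. A l z * q l z) \<longlonglongrightarrow> (LINT z:slab X T|lborel. a z * q' z)"
    and "set_integrable lborel (slab X T) (\<lambda>z. a z * q' z)"
proof -
  have int_a: "integrable lborel (\<lambda>z. indicator (slab X T) z * a z)"
    using a by (simp add: set_integrable_def)
  \<comment> \<open>\<open>q'\<close> is known only as a limit on the slab, so measurability is
    shown for its restriction.\<close>
  have [measurable]: "(\<lambda>z. indicator (slab X T) z * q' z) \<in> borel_measurable borel"
    by (rule borel_measurable_LIMSEQ_real[where u = "\<lambda>l z. indicator (slab X T) z * q l z"])
       (use lim in \<open>auto split: split_indicator\<close>)
  have eq: "indicator (slab X T) z *\<^sub>R (a z * q' z) = a z * (indicator (slab X T) z * q' z)" for z
    by simp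
  have C: "\<bar>indicator (slab X T) z * (a z * q l z)\<bar> \<le> C * \<bar>indicator (slab X T) z * a z\<bar>" for l z
    using mult_right_mono[OF q[of z l], of "\<bar>a z\<bar>"] by (auto split: split_indicator simp: abs_mult mult.commute)
  have lim': "(\<lambda>l. indicator (slab X T) z *\<^sub>R (a z * q l z)) \<longlonglongrightarrow> indicator (slab X T) z *\<^sub>R (a z * q' z)" for z
    by (cases "z \<in> slab X T") (auto intro!: tendsto_intros lim)
  have dom: "integrable lborel (\<lambda>z. C * \<bar>indicator (slab X T) z * a z\<bar>)"
    using int_a by auto
  have meas1: "(\<lambda>z. indicator (slab X T) z *\<^sub>R (a z * q' z)) \<in> borel_measurable lborel"
    unfolding eq by measurable
  have meas2: "(\<lambda>z. indicator (slab X T) z *\<^sub>R (a z * q l z)) \<in> borel_measurable lborel" for l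
    by measurable
  show int: "set_integrable lborel (slab X T) (\<lambda>z. a z * q' z)"
    unfolding set_integrable_def
    by (rule integrable_dominated_convergence[OF meas1 meas2 dom]) (use lim' C in \<open>auto intro!: AE_I2\<close>)
  have lim1: "(\<lambda>l. LINT z:slab X T|lborel. a z * q l z) \<longlonglongrightarrow> (LINT z:slab X T|lborel. a z * q' z)"
    unfolding set_lebesgue_integral_def
    by (rule integral_dominated_convergence[OF meas1 meas2 dom]) (use lim' C in \<open>auto intro!: AE_I2\<close>)
  have "(\<lambda>l. C * (LINT z:slab X T|lborel. \<bar>A l z - a z\<bar>)) \<longlonglongrightarrow> C * 0"
    by (intro tendsto_intros L1_null_integral_tendsto null) measurable
  then have null0: "(\<lambda>l. C * (LINT z:slab X T|lborel. \<bar>A l z - a z\<bar>)) \<longlonglongrightarrow> 0"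
    by simp
  have bound: "\<forall>\<^sub>F l in sequentially. norm ((LINT z:slab X T|lborel. A l z * q l z) - (LINT z:slab X T|lborel. a z * q l z))
      \<le> C * (LINT z:slab X T|lborel. \<bar>A l z - a z\<bar>)"
    using A
  proof eventually_elim
    case (elim l)
    have qb: "\<bar>b z * q l z\<bar> \<le> \<bar>C * b z\<bar>" if "z \<in> slab X T" for b :: "real \<times> real \<Rightarrow> real" and z
      using mult_right_mono[OF order_trans[OF q[OF that, of l] abs_ge_self], of "\<bar>b z\<bar>"]
      by (simp add: abs_mult mult.commute)
    have prod: "set_integrable lborel (slab X T) (\<lambda>z. b z * q l z)"
      if "set_integrable lborel (slab X T) b" and [measurable]: "b \<in> borel_measurable borel" for b
      by (rule set_integrable_bound[where f = "\<lambda>z. C * b z"])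
         (use that qb in \<open>auto intro!: AE_I2 set_integrable_mult_right simp: set_borel_measurable_def
            simp del: split_paired_All\<close>)
    have "(LINT z:slab X T|lborel. A l z * q l z) - (LINT z:slab X T|lborel. a z * q l z)
        = (LINT z:slab X T|lborel. (A l z - a z) * q l z)"
      by (subst set_integral_diff(2)[symmetric]) (use prod elim a in \<open>auto simp: algebra_simps\<close>)
    also have "\<bar>\<dots>\<bar> \<le> (LINT z:slab X T|lborel. \<bar>(A l z - a z) * q l z\<bar>)"
      unfolding set_lebesgue_integral_def
      by (rule order_trans[OF integral_abs_bound]) (simp add: abs_mult)
    also have "\<dots> \<le> (LINT z:slab X T|lborel. C * \<bar>A l z - a z\<bar>)"
    proof (rule set_integral_mono)
      show "set_integrable lborel (slab X T) (\<lambda>z. \<bar>(A l z - a z) * q l z\<bar>)"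
        using elim a by (intro set_integrable_abs prod set_integral_diff(1)) auto
      show "set_integrable lborel (slab X T) (\<lambda>z. C * \<bar>A l z - a z\<bar>)"
        using elim a by (intro set_integrable_mult_right set_integrable_abs set_integral_diff(1)) auto
      show "\<bar>(A l z - a z) * q l z\<bar> \<le> C * \<bar>A l z - a z\<bar>" if "z \<in> slab X T" for z
        using mult_right_mono[OF q[OF that, of l], of "\<bar>A l z - a z\<bar>"] by (simp add: abs_mult mult.commute)
    qed
    finally show ?case by simp
  qed
  have "(\<lambda>l. (LINT z:slab X T|lborel. A l z * q l z) - (LINT z:slab X T|lborel. a z * q l z)) \<longlonglongrightarrow> 0"
    by (rule Lim_null_comparison[OF bound null0])
  from tendsto_add[OF this lim1]
  show "(\<lambda>l. LINT z:slab X T|lborel. A l z * q l z) \<longlonglongrightarrow> (LINT z:slab X T|lborel. a z * q' z)"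
    by (simp only: diff_add_cancel add_0_left)
qed

text \<open>Translation invariance moves both differences onto \<Phi>. In space nothing remains,
  because \<Phi> has bounded support there; in time the strips of height \<open>dt\<close> at the
  top and at the bottom remain as boundary terms.\<close>

lemma integral_by_parts_shift:
  fixes \<Phi> U H :: "real \<times> real \<Rightarrow> real" and dx dt r N X :: real
  assumes [measurable]: "\<Phi> \<in> borel_measurable borel" "U \<in> borel_measurable borel" "H \<in> borel_measurable borel"
    and bnd: "\<And>z. \<bar>\<Phi> z\<bar> \<le> B\<^sub>1" "\<And>z. \<bar>U z\<bar> \<le> B\<^sub>2" "\<And>z. \<bar>H z\<bar> \<le> B\<^sub>3"
    and supp: "\<forall>z. \<Phi> z \<noteq> 0 \<longrightarrow> \<bar>fst z\<bar> \<le> X"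
    and dt: "0 \<le> dt" and N: "0 \<le> N"
  defines "ex \<equiv> (dx, 0::real)" and "et \<equiv> (0::real, dt)"
  shows "(LINT z:UNIV \<times> {0..<N}|lborel. \<Phi> z * (U (z + et) - U z + r * (H z - H (z - ex)))) =
      (LINT z:UNIV \<times> {N..<N+dt}|lborel. \<Phi> z * U z) - (LINT z:UNIV \<times> {0..<dt}|lborel. \<Phi> z * U z)
      - (LINT z:UNIV \<times> {0..<N}|lborel. U (z + et) * (\<Phi> (z + et) - \<Phi> z) + r * (H z * (\<Phi> (z + ex) - \<Phi> z)))"
    (is "?lhs = ?rhs")
    and "set_integrable lborel (UNIV \<times> {0..<N}) (\<lambda>z. U (z + et) * (\<Phi> (z + et) - \<Phi> z) + r * (H z * (\<Phi> (z + ex) - \<Phi> z)))"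
    and "set_integrable lborel (UNIV \<times> {0..<N}) (\<lambda>z. \<Phi> z * (U (z + et) - U z + r * (H z - H (z - ex))))"
proof -
  let ?i = "\<lambda>a b z. indicator (UNIV \<times> {a..<b}) z :: real"
  have B: "0 \<le> B\<^sub>1" "0 \<le> B\<^sub>2" "0 \<le> B\<^sub>3"
    using bnd(1)[of 0] bnd(2)[of 0] bnd(3)[of 0] by linarith+
  have int: "integrable lborel (\<lambda>z. ?i a b z * (\<Phi> (z + e) * W z))"
    if [measurable]: "W \<in> borel_measurable borel" and W: "\<And>z. \<bar>W z\<bar> \<le> B" for a b W B e
  proof (rule integrable_bounded_support)
    have "0 \<le> B" using W[of 0] by linarith
    then show "\<bar>?i a b z * (\<Phi> (z + e) * W z)\<bar> \<le> B\<^sub>1 * B" for z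
      using bnd(1)[of "z + e"] W[of z] B by (auto simp: abs_mult indicator_def intro!: mult_mono)
    show "z \<in> cbox (- X - fst e, a) (X - fst e, b)" if "?i a b z * (\<Phi> (z + e) * W z) \<noteq> 0" for z
      using that supp[rule_format, of "z + e"] by (cases z; cases e) (auto simp: cbox_Pair_eq indicator_def split: if_splits)
  qed measurable
  have int0: "integrable lborel (\<lambda>z. ?i a b z * (\<Phi> z * W z))"
    if "W \<in> borel_measurable borel" "\<And>z. \<bar>W z\<bar> \<le> B" for a b W B
    using int[OF that, of a b "0"] by simp
  have mU: "(\<lambda>z. U (z + et)) \<in> borel_measurable borel" and mH: "(\<lambda>z. H (z - ex)) \<in> borel_measurable borel"
    by measurable
  note I1 = int0[OF mU bnd(2), of 0 N] and I2 = int0[OF assms(2) bnd(2)] and I3 = int0[OF assms(3) bnd(3), of 0 N]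
    and I4 = int0[OF mH bnd(3), of 0 N] and I5 = int[OF mU bnd(2), of 0 N et] and I6 = int[OF assms(3) bnd(3), of 0 N ex]
  have s1: "(\<integral>z. ?i 0 N z * (\<Phi> (z + et) * U (z + et)) \<partial>lborel) = (\<integral>z. ?i dt (N+dt) z * (\<Phi> z * U z) \<partial>lborel)"
    by (subst integral_lborel_shift[of _ et, symmetric])
       (auto intro!: Bochner_Integration.integral_cong simp: et_def indicator_def)
  \<comment> \<open>Both sides integrate over the strip from 0 to \<open>N + dt\<close>, cut once at
    \<open>dt\<close> and once at \<open>N\<close>.\<close>
  have s2: "(\<integral>z. ?i dt (N+dt) z * (\<Phi> z * U z) \<partial>lborel) + (\<integral>z. ?i 0 dt z * (\<Phi> z * U z) \<partial>lborel)
     = (\<integral>z. ?i N (N+dt) z * (\<Phi> z * U z) \<partial>lborel) + (\<integral>z. ?i 0 N z * (\<Phi> z * U z) \<partial>lborel)"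
    unfolding Bochner_Integration.integral_add[OF I2 I2, symmetric]
    using dt N by (intro Bochner_Integration.integral_cong) (auto simp: indicator_def)
  have s3: "(\<integral>z. ?i 0 N z * (\<Phi> (z + ex) * H z) \<partial>lborel) = (\<integral>z. ?i 0 N z * (\<Phi> z * H (z - ex)) \<partial>lborel)"
    by (subst (2) integral_lborel_shift[of _ ex, symmetric])
       (auto intro!: Bochner_Integration.integral_cong simp: ex_def indicator_def)
  let ?A = "\<lambda>z. ?i 0 N z * (\<Phi> z * U (z + et)) - ?i 0 N z * (\<Phi> z * U z)
     + r * (?i 0 N z * (\<Phi> z * H z) - ?i 0 N z * (\<Phi> z * H (z - ex)))"
  let ?B = "\<lambda>z. ?i 0 N z * (\<Phi> (z + et) * U (z + et)) - ?i 0 N z * (\<Phi> z * U (z + et))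
     + r * (?i 0 N z * (\<Phi> (z + ex) * H z) - ?i 0 N z * (\<Phi> z * H z))"
  have A: "(\<lambda>z. ?i 0 N z *\<^sub>R (\<Phi> z * (U (z + et) - U z + r * (H z - H (z - ex))))) = ?A"
    by (auto simp: fun_eq_iff algebra_simps)
  have Bd: "(\<lambda>z. ?i 0 N z *\<^sub>R (U (z + et) * (\<Phi> (z + et) - \<Phi> z) + r * (H z * (\<Phi> (z + ex) - \<Phi> z)))) = ?B"
    by (auto simp: fun_eq_iff algebra_simps)
  note [simp] = I1 I2 I3 I4 I5 I6
  have iA: "integrable lborel ?A" and iB: "integrable lborel ?B"
    by (intro Bochner_Integration.integrable_add Bochner_Integration.integrable_diff
       integrable_mult_right; simp)+
  show "set_integrable lborel (UNIV \<times> {0..<N}) (\<lambda>z. U (z + et) * (\<Phi> (z + et) - \<Phi> z) + r * (H z * (\<Phi> (z + ex) - \<Phi> z)))"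
    unfolding set_integrable_def Bd by (rule iB)
  show "set_integrable lborel (UNIV \<times> {0..<N}) (\<lambda>z. \<Phi> z * (U (z + et) - U z + r * (H z - H (z - ex))))"
    unfolding set_integrable_def A by (rule iA)
  show "?lhs = ?rhs"
  proof -
    note int_simps = Bochner_Integration.integral_add Bochner_Integration.integral_diff
      integral_mult_right_zero Bochner_Integration.integrable_diff integrable_mult_right I1 I2 I3 I4 I5 I6
    have X: "integral\<^sup>L lborel ?A = (\<integral>z. ?i 0 N z * (\<Phi> z * U (z + et)) \<partial>lborel) - (\<integral>z. ?i 0 N z * (\<Phi> z * U z) \<partial>lborel)
      + r * ((\<integral>z. ?i 0 N z * (\<Phi> z * H z) \<partial>lborel) - (\<integral>z. ?i 0 N z * (\<Phi> z * H (z - ex)) \<partial>lborel))"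
      by (simp only: int_simps)
    have Y: "integral\<^sup>L lborel ?B = (\<integral>z. ?i 0 N z * (\<Phi> (z + et) * U (z + et)) \<partial>lborel) - (\<integral>z. ?i 0 N z * (\<Phi> z * U (z + et)) \<partial>lborel)
      + r * ((\<integral>z. ?i 0 N z * (\<Phi> (z + ex) * H z) \<partial>lborel) - (\<integral>z. ?i 0 N z * (\<Phi> z * H z) \<partial>lborel))"
      by (simp only: int_simps)
    show ?thesis
      unfolding set_lebesgue_integral_def A Bd X Y unfolding real_scaleR_def s1 s3
      using s2 by (simp only: right_diff_distrib)
  qed
qed

section \<open>Numerical fluxes\<close>

text \<open>Tychonoff's theorem, in the product topology to which the continuity in
  \<open>numerical_flux\<close> refers.\<close>

lemma compact_box_functions: "compact {v :: int \<Rightarrow> real. \<forall>j. v j \<in> {0..M}}"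
proof -
  have "compactin (product_topology (\<lambda>_::int. euclidean :: real topology) UNIV) (PiE UNIV (\<lambda>_. {0..M}))"
    by (simp add: compactin_PiE)
  then have "compact (PiE (UNIV :: int set) (\<lambda>_. {0..M}))"
    by (simp add: euclidean_product_topology)
  also have "PiE (UNIV :: int set) (\<lambda>_. {0..M}) = {v. \<forall>j. v j \<in> {0..M}}"
    by auto
  finally show ?thesis .
qed

lemma numerical_flux_cong:
  assumes "numerical_flux p q g" "\<And>j. j \<in> {- int p..int q} \<Longrightarrow> v j = w j"
  shows "g v = g w"
  by (rule conjunct1[OF assms(1)[unfolded numerical_flux_def], rule_format]) (rule assms(2))

text \<open>Setting the entries outside the stencil to 0 turns a bound on the stencil into
  membership in the compact box.\<close>

lemma numerical_flux_restrict:
  assumes "numerical_flux p q g"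
  shows "g v = g (\<lambda>j. if j \<in> {- int p..int q} then v j else 0)"
  by (rule numerical_flux_cong[OF assms]) simp

lemma numerical_flux_bounded:
  assumes g: "numerical_flux p q g" and M: "0 \<le> M"
  shows "\<exists>G. \<forall>v. (\<forall>j\<in>{- int p..int q}. v j \<in> {0..M}) \<longrightarrow> \<bar>g v\<bar> \<le> G"
proof -
  have "compact (g ` {v. \<forall>j. v j \<in> {0..M}})"
    using g by (intro compact_continuous_image compact_box_functions)
      (auto simp: numerical_flux_def intro: continuous_on_subset)
  then have "bounded (g ` {v. \<forall>j. v j \<in> {0..M}})" by (rule compact_imp_bounded)
  then obtain G where G: "\<And>v. (\<forall>j. v j \<in> {0..M}) \<Longrightarrow> \<bar>g v\<bar> \<le> G"
    unfolding bounded_iff by auto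
  have "\<bar>g v\<bar> \<le> G" if "\<forall>j\<in>{- int p..int q}. v j \<in> {0..M}" for v
    unfolding numerical_flux_restrict[OF g, of v] using that M by (intro G) auto
  then show ?thesis by blast
qed

text \<open>Uniform continuity near the constant families in a form that integrates: small
  increments in the mean give a small flux error in the mean. The constant in
  \<open>consistent_flux\<close> depends on the state, so compactness is used instead: where the
  deviation \<open>D\<close> is at least \<epsilon>, the increments \<open>S\<close> cannot vanish,
  and the continuous quotient \<open>D / S\<close> is bounded there.\<close>

lemma numerical_flux_modulus:
  assumes g: "numerical_flux p q g" and M: "0 \<le> M" and \<epsilon>: "0 < \<epsilon>"
  shows "\<exists>C\<ge>0. \<forall>v. (\<forall>j\<in>{- int p..int q}. v j \<in> {0..M}) \<longrightarrow>
     \<bar>g v - g (\<lambda>_. v 0)\<bar> \<le> \<epsilon> + C * (\<Sum>j\<in>{- int p..int q}. \<bar>v j - v 0\<bar>)"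
proof -
  define S where "S v = (\<Sum>j\<in>{- int p..int q}. \<bar>v j - v 0\<bar>)" for v :: "int \<Rightarrow> real"
  define D where "D v = \<bar>g v - g (\<lambda>_. v 0)\<bar>" for v
  define Q where "Q = {v :: int \<Rightarrow> real. \<forall>j. v j \<in> {0..M}}"
  have cg: "continuous_on A g" for A
    using g by (auto simp: numerical_flux_def intro: continuous_on_subset)
  have proj: "continuous_on UNIV (\<lambda>v::int \<Rightarrow> real. v j)" for j
    using continuous_on_product_then_coordinatewise[OF continuous_on_id] by auto
  have cS: "continuous_on UNIV S"
    unfolding S_def by (intro continuous_intros proj)
  have "continuous_on UNIV (\<lambda>v::int \<Rightarrow> real. g ((\<lambda>a _. a) (v 0)))"
    by (rule continuous_on_compose2[OF cg[of UNIV]])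
       (auto intro!: continuous_on_coordinatewise_then_product proj)
  then have cD: "continuous_on UNIV D"
    unfolding D_def by (intro continuous_intros cg) auto
  define A where "A = Q \<inter> {v. \<epsilon> \<le> D v}"
  have cA: "compact A"
    unfolding A_def Q_def
    by (intro compact_Int_closed compact_box_functions closed_Collect_le continuous_intros cD)
  have Spos: "0 < S v" if "\<epsilon> \<le> D v" for v
  proof (rule ccontr)
    assume "\<not> 0 < S v"
    moreover have "0 \<le> S v" unfolding S_def by (intro sum_nonneg) auto
    ultimately have "S v = 0" by simp
    then have "\<bar>v j - v 0\<bar> = 0" if "j \<in> {- int p..int q}" for j
      unfolding S_def by (rule sum_nonneg_0[OF finite_atLeastAtMost_int abs_ge_zero _ that])
    then have "v j = v 0" if "j \<in> {- int p..int q}" for j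
      using that by (simp only: abs_eq_0 right_minus_eq)
    then have "g v = g (\<lambda>_. v 0)"
      by (rule numerical_flux_cong[OF g, of v "\<lambda>_. v 0"])
    then show False using that \<epsilon> by (simp add: D_def)
  qed
  have "compact ((\<lambda>v. D v / S v) ` A)"
    by (rule compact_continuous_image[OF _ cA], intro continuous_intros continuous_on_subset[OF cD] continuous_on_subset[OF cS])
       (use Spos in \<open>force simp: A_def\<close>)+
  then have "bounded ((\<lambda>v. D v / S v) ` A)" by (rule compact_imp_bounded)
  then obtain C where C: "\<And>v. v \<in> A \<Longrightarrow> \<bar>D v / S v\<bar> \<le> C"
    unfolding bounded_iff by auto
  define C' where "C' = max C 0"
  have key: "D v \<le> \<epsilon> + C' * S v" if "v \<in> Q" for v
  proof (cases "\<epsilon> \<le> D v")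
    case True
    then have "v \<in> A" using that by (simp add: A_def)
    then have "D v / S v \<le> C'" using C[of v] unfolding C'_def by (meson abs_ge_self max.cobounded1 order_trans)
    then show ?thesis using Spos[OF True] \<epsilon> by (simp add: field_simps)
  next
    case False
    have "0 \<le> C' * S v" unfolding S_def C'_def by (intro mult_nonneg_nonneg sum_nonneg) auto
    then show ?thesis using False by simp
  qed
  show ?thesis
  proof (intro exI[of _ C'] conjI allI impI)
    show "0 \<le> C'" by (simp add: C'_def)
    fix v :: "int \<Rightarrow> real" assume v: "\<forall>j\<in>{- int p..int q}. v j \<in> {0..M}"
    define w where "w j = (if j \<in> {- int p..int q} then v j else 0)" for j
    have "g w = g v" unfolding w_def by (rule numerical_flux_restrict[OF g, symmetric])
    moreover have "w 0 = v 0" by (simp add: w_def)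
    moreover have "S w = S v" unfolding S_def by (intro sum.cong) (auto simp: w_def)
    moreover have "w \<in> Q" using v M by (auto simp: Q_def w_def)
    ultimately show "\<bar>g v - g (\<lambda>_. v 0)\<bar> \<le> \<epsilon> + C' * (\<Sum>j\<in>{- int p..int q}. \<bar>v j - v 0\<bar>)"
      using key[of w] by (simp add: D_def S_def)
  qed
qed

lemma continuous_modulus:
  fixes f :: "real \<Rightarrow> real"
  assumes f: "continuous_on UNIV f" and \<epsilon>: "0 < \<epsilon>"
  shows "\<exists>C\<ge>0. \<forall>a\<in>{0..M}. \<forall>b\<in>{0..M}. \<bar>f a - f b\<bar> \<le> \<epsilon> + C * \<bar>a - b\<bar>"
proof -
  have "uniformly_continuous_on {0..M} f"
    using f by (intro compact_uniformly_continuous) (auto intro: continuous_on_subset)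
  then obtain d where d: "d > 0" "\<And>a b. a \<in> {0..M} \<Longrightarrow> b \<in> {0..M} \<Longrightarrow> \<bar>a - b\<bar> < d \<Longrightarrow> \<bar>f a - f b\<bar> < \<epsilon>"
    unfolding uniformly_continuous_on_def dist_real_def using \<epsilon> by metis
  have "compact (f ` {0..M})" using f by (intro compact_continuous_image) (auto intro: continuous_on_subset)
  then have "bounded (f ` {0..M})" by (rule compact_imp_bounded)
  then obtain G where G: "\<And>a. a \<in> {0..M} \<Longrightarrow> \<bar>f a\<bar> \<le> G"
    unfolding bounded_iff by (metis image_eqI real_norm_def)
  \<comment> \<open>Makes \<open>C * d\<close> equal to \<open>2 * \<bar>G\<bar>\<close>, which
    dominates every difference of values; arguments closer than \<open>d\<close> are covered by
    \<epsilon>.\<close>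
  define C where "C = 2 * \<bar>G\<bar> / d"
  have "\<bar>f a - f b\<bar> \<le> \<epsilon> + C * \<bar>a - b\<bar>" if ab: "a \<in> {0..M}" "b \<in> {0..M}" for a b
  proof (cases "\<bar>a - b\<bar> < d")
    case True
    have "0 \<le> C * \<bar>a - b\<bar>" using d by (simp add: C_def)
    then show ?thesis using d(2)[OF ab True] by linarith
  next
    case False
    have "\<bar>f a - f b\<bar> \<le> 2 * \<bar>G\<bar>" using G[OF ab(1)] G[OF ab(2)] by linarith
    also have "\<dots> = C * d" using d by (simp add: C_def)
    also have "\<dots> \<le> C * \<bar>a - b\<bar>" using False d by (intro mult_left_mono) (auto simp: C_def)
    finally show ?thesis using \<epsilon> by simp
  qed
  moreover have "C \<ge> 0" using d by (simp add: C_def)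
  ultimately show ?thesis by blast
qed

lemma consistent_flux_continuous:
  assumes "numerical_flux p q g" "consistent_flux p q g f"
  shows "continuous_on UNIV f"
proof -
  have "continuous_on UNIV (\<lambda>c. g ((\<lambda>a _. a) c))"
    by (rule continuous_on_compose2[OF conjunct2[OF assms(1)[unfolded numerical_flux_def]]])
       (auto intro: continuous_on_coordinatewise_then_product continuous_on_id)
  then show ?thesis using assms(2) by (simp add: consistent_flux_def)
qed

text \<open>Near 0 this is the consistency condition at the state 0, applied to constant families.
  Away from 0 the function is bounded, and \<open>1 \<le> a / \<epsilon>\<close> makes the bound
  linear. The constant becomes the speed of the widening tent, up to one cell per time step.\<close>

lemma consistent_flux_lipschitz_at_0:
  assumes "numerical_flux p q g" and cons: "consistent_flux p q g f"
  shows "\<exists>L\<ge>0. \<forall>a\<in>{0..M}. \<bar>f a - f 0\<bar> \<le> L * a"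
proof -
  have gf: "g (\<lambda>_. c) = f c" for c using cons by (simp add: consistent_flux_def)
  obtain K \<epsilon> where \<epsilon>: "\<epsilon> > 0" and K: "\<And>v. (\<forall>j\<in>{- int p..int q}. \<bar>v j - 0\<bar> < \<epsilon>) \<Longrightarrow>
      \<bar>g v - f 0\<bar> \<le> K * Max ((\<lambda>j. \<bar>v j - 0\<bar>) ` {- int p..int q})"
    using conjunct2[OF cons[unfolded consistent_flux_def], THEN spec, of 0] by blast
  have near: "\<bar>f a - f 0\<bar> \<le> K * a" if "0 \<le> a" "a < \<epsilon>" for a
  proof -
    have "(\<lambda>j. \<bar>a - 0\<bar>) ` {- int p..int q} = {a}" using that by auto
    then show ?thesis using K[of "\<lambda>_. a"] that by (simp add: gf)
  qed
  obtain C where C: "C \<ge> 0" "\<forall>a\<in>{0..M}. \<forall>b\<in>{0..M}. \<bar>f a - f b\<bar> \<le> 1 + C * \<bar>a - b\<bar>"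
    using continuous_modulus[OF consistent_flux_continuous[OF assms], of 1 M] by auto
  show ?thesis
  proof (intro exI[of _ "\<bar>K\<bar> + 1 / \<epsilon> + C"] conjI ballI)
    show "0 \<le> \<bar>K\<bar> + 1 / \<epsilon> + C" using \<epsilon> C by simp
    fix a assume a: "a \<in> {0..M}"
    show "\<bar>f a - f 0\<bar> \<le> (\<bar>K\<bar> + 1 / \<epsilon> + C) * a"
    proof (cases "a < \<epsilon>")
      case True
      then have "\<bar>f a - f 0\<bar> \<le> K * a" using near a by auto
      also have "\<dots> \<le> (\<bar>K\<bar> + 1 / \<epsilon> + C) * a"
        using a \<epsilon> C by (intro mult_right_mono) (auto simp: abs_ge_self add_increasing2)
      finally show ?thesis .
    next
      case False
      have "\<bar>f a - f 0\<bar> \<le> 1 + C * a" using C(2)[rule_format, of a 0] a by simp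
      also have "\<dots> \<le> a / \<epsilon> + C * a" using False \<epsilon> by (simp add: field_simps)
      also have "\<dots> \<le> (\<bar>K\<bar> + 1 / \<epsilon> + C) * a" using a by (simp add: algebra_simps)
      finally show ?thesis .
    qed
  qed
qed

section \<open>Step functions on the grid\<close>

definition cell_index :: "real \<Rightarrow> real \<Rightarrow> real \<Rightarrow> int" where
  "cell_index x\<^sub>0 dx x = \<lfloor>(x - x\<^sub>0) / dx + 1 / 2\<rfloor>"

lemma piecewise_constant_eq:
  "piecewise_constant x\<^sub>0 dx dt V x t = V (nat \<lfloor>t / dt\<rfloor>) (cell_index x\<^sub>0 dx x)"
  by (simp add: piecewise_constant_def cell_index_def)

lemma cell_index_shift:
  assumes "0 < dx"
  shows "cell_index x\<^sub>0 dx (x + of_int j * dx) = cell_index x\<^sub>0 dx x + j"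
proof -
  have "(x + of_int j * dx - x\<^sub>0) / dx + 1 / 2 = ((x - x\<^sub>0) / dx + 1 / 2) + of_int j"
    using assms by (simp add: field_simps)
  then show ?thesis unfolding cell_index_def by (metis floor_add_int)
qed

lemma cell_index_mono: "0 < dx \<Longrightarrow> x \<le> y \<Longrightarrow> cell_index x\<^sub>0 dx x \<le> cell_index x\<^sub>0 dx y"
  unfolding cell_index_def by (intro floor_mono add_right_mono divide_right_mono) auto

lemma cell_index_grid_point: "0 < dx \<Longrightarrow> cell_index x\<^sub>0 dx (grid_point x\<^sub>0 dx i) = i"
  by (simp add: cell_index_def grid_point_def floor_eq_iff)

lemma grid_point_cell_index:
  assumes "0 < dx"
  shows "\<bar>grid_point x\<^sub>0 dx (cell_index x\<^sub>0 dx x) - x\<bar> \<le> dx"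
proof -
  let ?k = "cell_index x\<^sub>0 dx x"
  have "of_int ?k \<le> (x - x\<^sub>0) / dx + 1 / 2" "(x - x\<^sub>0) / dx + 1 / 2 < of_int ?k + 1"
    by (auto simp: cell_index_def)
  then have "(of_int ?k - 1/2) * dx \<le> x - x\<^sub>0" "x - x\<^sub>0 \<le> (of_int ?k + 1/2) * dx"
    using assms by (simp_all add: field_simps)
  then show ?thesis using assms by (simp add: grid_point_def algebra_simps abs_le_iff)
qed

text \<open>An intermediate index is attained at its own grid point. This lets a bound for the step
  function of fluxes on an interval control all the interfaces that a large flux has to
  cross.\<close>

lemma cell_index_between:
  assumes "0 < dx" "x \<le> y" "cell_index x\<^sub>0 dx x \<le> k" "k \<le> cell_index x\<^sub>0 dx y"
  shows "\<exists>z\<in>{x..y}. cell_index x\<^sub>0 dx z = k"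
proof (cases "k = cell_index x\<^sub>0 dx x \<or> k = cell_index x\<^sub>0 dx y")
  case True
  then show ?thesis using assms by auto
next
  case False
  let ?z = "grid_point x\<^sub>0 dx k"
  have k: "cell_index x\<^sub>0 dx ?z = k" using assms by (simp add: cell_index_grid_point)
  have "x \<le> ?z"
    using False assms k cell_index_mono[of dx ?z x x\<^sub>0] by (cases "x \<le> ?z") auto
  moreover have "?z \<le> y"
    using False assms k cell_index_mono[of dx y ?z x\<^sub>0] by (cases "?z \<le> y") auto
  ultimately show ?thesis using k by auto
qed

lemma piecewise_constant_measurable [measurable]:
  "(\<lambda>z. piecewise_constant x\<^sub>0 dx dt V (fst z) (snd z)) \<in> borel_measurable borel"
proof -
  have *: "(\<lambda>z::real \<times> real. V (nat a) \<lfloor>(fst z - x\<^sub>0) / dx + 1 / 2\<rfloor>) \<in> borel_measurable borel" for a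
    by (rule measurable_compose_countable[where f = "\<lambda>b _. V (nat a) b"]) measurable
  show ?thesis
    unfolding piecewise_constant_def
    by (rule measurable_compose_countable[where f = "\<lambda>a z. V (nat a) \<lfloor>(fst z - x\<^sub>0) / dx + 1 / 2\<rfloor>", OF *]) measurable
qed

lemma time_index_shift:
  assumes "0 < dt" "0 \<le> t"
  shows "nat \<lfloor>(t + dt) / dt\<rfloor> = Suc (nat \<lfloor>t / dt\<rfloor>)"
proof -
  have "(t + dt) / dt = t / dt + 1" using assms by (simp add: field_simps)
  moreover have "0 \<le> \<lfloor>t / dt\<rfloor>" using assms by simp
  ultimately show ?thesis by (simp add: nat_add_distrib)
qed

lemma tv_pair_le:
  assumes "total_variation h a b \<le> ennreal B" "0 \<le> B" "a < x" "x < b" "a < y" "y < b"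
  shows "\<bar>h x - h y\<bar> \<le> B"
proof -
  have *: "\<bar>h v - h u\<bar> \<le> B" if "u < v" "a < u" "v < b" for u v
    using tv_sum_le[OF assms(1,2), of 1 "\<lambda>k::nat. if k = 0 then u else v"] that
    by (auto simp: strict_mono_on_def)
  show ?thesis
    using *[of x y] *[of y x] assms by (cases x y rule: linorder_cases) (auto simp: abs_minus_commute)
qed

lemma AE_lborel_ex_point:
  assumes "AE x in lborel. P x" "a < (b::real)"
  shows "\<exists>x. a < x \<and> x < b \<and> P x"
proof (rule ccontr)
  assume no: "\<not> ?thesis"
  obtain N where N: "{x. \<not> P x} \<subseteq> N" "emeasure lborel N = 0" "N \<in> sets lborel"
    using AE_E[OF assms(1)] by auto
  have "emeasure lborel {a<..<b} \<le> emeasure lborel N"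
    using no N by (intro emeasure_mono) auto
  then show False using N assms(2) by simp
qed

text \<open>The hypotheses in Borel form: the limit is a Borel function \<open>w\<close> on the
  plane and null sets refer to \<open>lborel\<close>, so that shifts and compositions stay
  measurable. The passage from the Lebesgue measurable limit to \<open>w\<close> is left to the
  final theorem. The grid offset \<open>x\<^sub>0 l\<close> may vary with \<open>l\<close>.\<close>

locale mpe_limit =
  fixes f \<psi> :: "real \<Rightarrow> real"
    and w :: "real \<times> real \<Rightarrow> real"
    and g :: "(int \<Rightarrow> real) \<Rightarrow> real" and p q :: nat
    and r :: real and \<Delta>x \<Delta>t x\<^sub>0 :: "nat \<Rightarrow> real"
    and V :: "nat \<Rightarrow> nat \<Rightarrow> int \<Rightarrow> real"
    and U :: "nat \<Rightarrow> real \<times> real \<Rightarrow> real"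
  defines "U \<equiv> \<lambda>l z. piecewise_constant (x\<^sub>0 l) (\<Delta>x l) (\<Delta>t l) (V l) (fst z) (snd z)"
  assumes \<psi>_pos: "\<And>x. \<psi> x > 0"
    and \<psi>_cont: "AE x in lborel. isCont \<psi> x"
    and w_measurable [measurable]: "w \<in> borel_measurable borel"
    and w_pos: "AE z in lborel. 0 \<le> snd z \<longrightarrow> 0 < w z"
    and flux: "numerical_flux p q g" "consistent_flux p q g f"
    and steps: "\<And>l. \<Delta>x l > 0" "\<Delta>x \<longlonglongrightarrow> 0" "r > 0" "\<And>l. \<Delta>t l = r * \<Delta>x l"
    and init: "\<And>l i. V l 0 i = \<psi> (grid_point (x\<^sub>0 l) (\<Delta>x l) i)"
    and scheme: "\<And>l. mpe_scheme g (\<Delta>x l) (\<Delta>t l) (V l)"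
    and TV: "\<And>a b T. a < b \<Longrightarrow> 0 < T \<Longrightarrow>
      \<exists>B. \<forall>l. \<forall>t\<in>{0..T}. total_variation (\<lambda>x. U l (x, t)) a b \<le> ennreal B"
    and TTV: "\<And>a b T. a < b \<Longrightarrow> 0 < T \<Longrightarrow>
      \<exists>B. \<forall>l. \<forall>x\<in>{a..b}. total_variation (\<lambda>t. U l (x, t)) 0 T \<le> ennreal B"
    and w_integrable: "\<And>X T. set_integrable lborel (slab X T) w"
    and conv: "\<And>X T. L1_null X T (\<lambda>l z. U l z - w z)"
begin

section \<open>The scheme as an identity between shifted step functions\<close>

definition ex :: "nat \<Rightarrow> real \<times> real" where "ex l = (\<Delta>x l, 0)"
definition et :: "nat \<Rightarrow> real \<times> real" where "et l = (0, \<Delta>t l)"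

text \<open>Turns any family on the grid into a function on the plane. A flux at the interface
  \<open>i + 1/2\<close> is placed on cell \<open>i\<close>, so the left interface of a cell is
  reached by the shift \<open>- ex l\<close>.\<close>

definition step :: "nat \<Rightarrow> (nat \<Rightarrow> int \<Rightarrow> real) \<Rightarrow> real \<times> real \<Rightarrow> real" where
  "step l W z = piecewise_constant (x\<^sub>0 l) (\<Delta>x l) (\<Delta>t l) W (fst z) (snd z)"

abbreviation "F l \<equiv> step l (mpe_flux g (V l))"
abbreviation "flx l \<equiv> step l (flux_at g (V l))"
abbreviation "idx l z \<equiv> cell_index (x\<^sub>0 l) (\<Delta>x l) (fst z)"
abbreviation "lev l z \<equiv> nat \<lfloor>snd z / \<Delta>t l\<rfloor>"

lemma dt_pos: "0 < \<Delta>t l" using steps by simp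

lemma dt_tendsto: "\<Delta>t \<longlonglongrightarrow> 0"
proof -
  have "\<Delta>t = (\<lambda>l. r * \<Delta>x l)" using steps by auto
  then show ?thesis using tendsto_mult[OF tendsto_const steps(2), of r] by simp
qed

lemma eventually_dx_less: "0 < \<epsilon> \<Longrightarrow> \<forall>\<^sub>F l in sequentially. \<Delta>x l < \<epsilon>"
  using order_tendstoD(2)[OF steps(2)] .

lemma eventually_dt_less: "0 < \<epsilon> \<Longrightarrow> \<forall>\<^sub>F l in sequentially. \<Delta>t l < \<epsilon>"
  using order_tendstoD(2)[OF dt_tendsto] .

lemma step_measurable [measurable]: "step l W \<in> borel_measurable borel"
  unfolding step_def by measurable

lemma U_step: "U l = step l (V l)"
  by (auto simp: U_def step_def)

lemma U_measurable [measurable]: "U l \<in> borel_measurable borel"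
  unfolding U_step by measurable

lemma step_eq: "step l W z = W (lev l z) (idx l z)"
  by (simp add: step_def piecewise_constant_eq)

lemma U_eq: "U l z = V l (lev l z) (idx l z)"
  by (simp add: U_step step_eq)

lemma U_pos: "0 < U l z"
  using V_pos[OF scheme steps(1) dt_pos] by (simp add: U_eq)

lemma idx_shift: "idx l (z + (of_int j * \<Delta>x l, c)) = idx l z + j"
  using steps(1) by (cases z) (simp add: cell_index_shift)

lemma idx_ex: "idx l (z + ex l) = idx l z + 1" "idx l (z - ex l) = idx l z - 1"
  using idx_shift[of l z 1 0] idx_shift[of l z "-1" 0]
  by (cases z, simp add: ex_def)+

lemma idx_et: "idx l (z + et l) = idx l z"
  by (simp add: et_def)

lemma lev_ex: "lev l (z + ex l) = lev l z" "lev l (z - ex l) = lev l z"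
  by (simp_all add: ex_def)

text \<open>At negative times \<open>nat\<close> freezes the level at 0, hence the condition on
  \<open>snd z\<close> here and in the identities that follow.\<close>

lemma lev_et: "0 \<le> snd z \<Longrightarrow> lev l (z + et l) = Suc (lev l z)"
  using time_index_shift[OF dt_pos] by (simp add: et_def)

lemma flx_eq: "flx l z = g (\<lambda>j. U l (z + (of_int j * \<Delta>x l, 0)))"
  unfolding step_eq flux_at_def U_eq idx_shift by simp

lemma F_eq:
  assumes "0 \<le> snd z"
  shows "F l z = max (flx l z) 0 * (U l (z + et l) / U l z)
     + min (flx l z) 0 * (U l (z + ex l + et l) / U l (z + ex l))"
proof -
  have "0 \<le> snd (z + ex l)" using assms by (simp add: ex_def)
  then have "U l (z + ex l + et l) = V l (Suc (lev l z)) (idx l z + 1)" "U l (z + ex l) = V l (lev l z) (idx l z + 1)"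
    unfolding U_eq lev_et[OF \<open>0 \<le> snd (z + ex l)\<close>] lev_ex idx_et idx_ex by simp_all
  moreover have "U l (z + et l) = V l (Suc (lev l z)) (idx l z)"
    unfolding U_eq lev_et[OF assms] idx_et ..
  ultimately show ?thesis
    by (simp only: step_eq mpe_flux_def patankar_weight_def U_eq[of l z])
qed

lemma U_et:
  assumes "0 \<le> snd z"
  shows "U l (z + et l) - U l z + r * (F l z - F l (z - ex l)) = 0"
proof -
  have "\<Delta>t l / \<Delta>x l = r" using steps(1)[of l] steps(4)[of l] by simp
  then show ?thesis
    using V_Suc[OF scheme steps(1) dt_pos, of l "lev l z" "idx l z"]
    unfolding U_eq step_eq lev_et[OF assms(1)] lev_ex idx_et idx_ex by simp
qed

lemma U_et_clamp:
  assumes "0 \<le> snd z" "\<bar>flx l z\<bar> \<le> G" "\<bar>flx l (z - ex l)\<bar> \<le> G"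
  shows "0 \<le> U l (z + et l) - U l z + r * (clamp_to G (F l z) - clamp_to G (F l (z - ex l)))"
proof -
  have "\<Delta>t l / \<Delta>x l = r" using steps(1)[of l] steps(4)[of l] by simp
  then show ?thesis
    using V_Suc_ge_clamp[OF scheme steps(1) dt_pos, of l "lev l z" "idx l z" G] assms(2,3)
    unfolding U_eq step_eq lev_et[OF assms(1)] lev_ex idx_et idx_ex by simp
qed

lemma initial_tendsto:
  assumes "isCont \<psi> x"
  shows "(\<lambda>l. U l (x, 0)) \<longlonglongrightarrow> \<psi> x"
proof -
  have "(\<lambda>l. grid_point (x\<^sub>0 l) (\<Delta>x l) (idx l (x, 0)) - x) \<longlonglongrightarrow> 0"
    by (rule Lim_null_comparison[OF _ steps(2)])
       (use grid_point_cell_index[OF steps(1)] in simp)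
  then have "(\<lambda>l. grid_point (x\<^sub>0 l) (\<Delta>x l) (idx l (x, 0))) \<longlonglongrightarrow> x"
    by (rule LIM_zero_cancel)
  then have "(\<lambda>l. \<psi> (grid_point (x\<^sub>0 l) (\<Delta>x l) (idx l (x, 0)))) \<longlonglongrightarrow> \<psi> x"
    by (rule isCont_tendsto_compose[OF assms])
  then show ?thesis by (simp add: U_eq init)
qed

section \<open>Uniform bounds and vanishing increments from the variation hypotheses\<close>

lemma TV_bound:
  assumes "a < b" "0 < T"
  obtains B where "0 \<le> B" "\<And>l t. 0 \<le> t \<Longrightarrow> t \<le> T \<Longrightarrow> total_variation (\<lambda>x. U l (x, t)) a b \<le> ennreal B"
proof -
  obtain B where "\<forall>l. \<forall>t\<in>{0..T}. total_variation (\<lambda>x. U l (x, t)) a b \<le> ennreal B"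
    using TV[OF assms] by auto
  \<comment> \<open>\<open>ennreal\<close> sends negative bounds to 0, so \<open>B\<close> may be
    replaced by its positive part.\<close>
  then show ?thesis
    by (intro that[of "max 0 B"]) (auto intro!: order_trans[OF _ ennreal_leI[of B "max 0 B"]])
qed

lemma TTV_bound:
  assumes "a < b" "0 < T"
  obtains B where "0 \<le> B" "\<And>l x. a \<le> x \<Longrightarrow> x \<le> b \<Longrightarrow> total_variation (\<lambda>t. U l (x, t)) 0 T \<le> ennreal B"
proof -
  obtain B where "\<forall>l. \<forall>x\<in>{a..b}. total_variation (\<lambda>t. U l (x, t)) 0 T \<le> ennreal B"
    using TTV[OF assms] by auto
  then show ?thesis
    by (intro that[of "max 0 B"]) (auto intro!: order_trans[OF _ ennreal_leI[of B "max 0 B"]])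
qed

lemma U_initial_step: "t < \<Delta>t l \<Longrightarrow> U l (x, t) = U l (x, 0)"
  using dt_pos[of l] by (simp add: U_eq floor_eq_iff nat_eq_iff not_le)

text \<open>The bound is anchored at a continuity point \<open>y\<close> of \<psi>, where the
  initial values converge and are thus bounded in \<open>l\<close>. The space variation at time 0
  and then the time variation carry it to the whole slab.\<close>

lemma U_bounded:
  assumes "0 < X" "0 < T"
  shows "\<exists>M>0. \<forall>l. \<forall>z\<in>slab X T. U l z \<le> M"
proof -
  obtain B\<^sub>1 where B1: "0 \<le> B\<^sub>1" "\<And>l t. 0 \<le> t \<Longrightarrow> t \<le> T + 1 \<Longrightarrow> total_variation (\<lambda>x. U l (x, t)) (- X - 1) (X + 1) \<le> ennreal B\<^sub>1"
    using TV_bound[of "- X - 1" "X + 1" "T + 1"] assms by auto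
  obtain B\<^sub>2 where B2: "0 \<le> B\<^sub>2" "\<And>l x. - X \<le> x \<Longrightarrow> x \<le> X \<Longrightarrow> total_variation (\<lambda>t. U l (x, t)) 0 (T + 1) \<le> ennreal B\<^sub>2"
    using TTV_bound[of "- X" "X" "T + 1"] assms by auto
  obtain y where y: "- X < y" "y < X" "isCont \<psi> y"
    using AE_lborel_ex_point[OF \<psi>_cont, of "- X" X] assms by auto
  have "Bseq (\<lambda>l. U l (y, 0))"
    using initial_tendsto[OF y(3)] by (intro convergent_imp_Bseq) (auto simp: convergent_def)
  then obtain B\<^sub>3 where B3: "\<And>l. \<bar>U l (y, 0)\<bar> \<le> B\<^sub>3" by (auto simp: Bseq_def)
  have le: "U l (x, t) \<le> B\<^sub>1 + B\<^sub>2 + B\<^sub>3" if "- X \<le> x" "x \<le> X" "0 \<le> t" "t \<le> T" for l x t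
  proof -
    have "\<bar>U l (x, 0) - U l (y, 0)\<bar> \<le> B\<^sub>1"
      by (rule tv_pair_le[OF B1(2) B1(1)]) (use that y assms in auto)
    moreover have "\<bar>U l (x, t) - U l (x, 0)\<bar> \<le> B\<^sub>2"
    proof (cases "t < \<Delta>t l")
      case True
      then show ?thesis using B2 by (simp add: U_initial_step)
    next
      case False
      \<comment> \<open>Time 0 is an endpoint, while \<open>tv_pair_le\<close> compares interior
        points; half a time step gives the same value.\<close>
      have "\<bar>U l (x, t) - U l (x, \<Delta>t l / 2)\<bar> \<le> B\<^sub>2"
        by (rule tv_pair_le[OF B2(2) B2(1)]) (use that False dt_pos[of l] in auto)
      then show ?thesis using U_initial_step[of "\<Delta>t l / 2" l x] dt_pos[of l] by simp
    qed
    ultimately show ?thesis using B3[of l] by linarith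
  qed
  show ?thesis
  proof (intro exI[of _ "B\<^sub>1 + B\<^sub>2 + B\<^sub>3"] conjI)
    show "0 < B\<^sub>1 + B\<^sub>2 + B\<^sub>3" using le[of 0 0 0] U_pos[of 0 "(0, 0)"] assms by auto
  qed (use le in \<open>auto simp: mem_slab\<close>)
qed

lemma nat_floor_divide_less:
  assumes "0 < d" "0 \<le> x" "x \<le> a"
  shows "nat \<lfloor>x / d\<rfloor> < nat \<lfloor>a / d\<rfloor> + 1" "0 \<le> x - real (nat \<lfloor>x / d\<rfloor>) * d" "x - real (nat \<lfloor>x / d\<rfloor>) * d < d"
proof -
  have "\<lfloor>x / d\<rfloor> \<le> \<lfloor>a / d\<rfloor>" using assms by (intro floor_mono divide_right_mono) auto
  then show "nat \<lfloor>x / d\<rfloor> < nat \<lfloor>a / d\<rfloor> + 1" by (simp add: nat_mono less_Suc_eq_le)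
  have "real (nat \<lfloor>x / d\<rfloor>) = of_int \<lfloor>x / d\<rfloor>" using assms by simp
  moreover have "of_int \<lfloor>x / d\<rfloor> \<le> x / d" "x / d < of_int \<lfloor>x / d\<rfloor> + 1" by auto
  ultimately have "real (nat \<lfloor>x / d\<rfloor>) \<le> x / d" "x / d < real (nat \<lfloor>x / d\<rfloor>) + 1" by simp_all
  then show "0 \<le> x - real (nat \<lfloor>x / d\<rfloor>) * d" "x - real (nat \<lfloor>x / d\<rfloor>) * d < d"
    using assms(1) by (simp_all add: pos_le_divide_eq pos_divide_less_eq distrib_right)
qed

lemma L1_null_of_le:
  assumes le: "\<forall>\<^sub>F l in sequentially. slab_norm X T (e l) \<le> ennreal (c l)" and "c \<longlonglongrightarrow> 0"
  shows "L1_null X T e"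
  unfolding L1_null_def
proof (rule tendsto_sandwich[OF _ le tendsto_const])
  show "(\<lambda>l. ennreal (c l)) \<longlonglongrightarrow> 0" using tendsto_ennrealI[OF assms(2)] by simp
qed simp

text \<open>Along a vertical chain with step \<open>et l\<close> the increments add up to at most
  the time variation, and the chains start in a strip of height \<open>\<Delta>t l\<close>. The mean
  is therefore of order \<open>\<Delta>t l\<close>.\<close>

lemma L1_null_time_step:
  assumes "0 < X" "0 < T"
  shows "L1_null X T (\<lambda>l z. U l (z + et l) - U l z)"
proof -
  obtain B where B: "0 \<le> B" "\<And>l x. - X \<le> x \<Longrightarrow> x \<le> X \<Longrightarrow> total_variation (\<lambda>t. U l (x, t)) 0 (T + 3) \<le> ennreal B"
    using TTV_bound[of "- X" "X" "T + 3"] assms by auto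
  show ?thesis
  proof (rule L1_null_of_le)
    show "(\<lambda>l. B * (2 * X * \<Delta>t l)) \<longlonglongrightarrow> 0"
      by (intro tendsto_mult_right_zero dt_tendsto)
    show "\<forall>\<^sub>F l in sequentially. slab_norm X T (\<lambda>z. U l (z + et l) - U l z) \<le> ennreal (B * (2 * X * \<Delta>t l))"
      using eventually_dt_less[OF zero_less_one]
    proof eventually_elim
      case (elim l)
      let ?d = "\<Delta>t l"
      define N where "N = nat \<lfloor>T / ?d\<rfloor> + 1"
      have Nd: "real N * ?d \<le> T + ?d"
        using nat_floor_divide_less(2)[OF dt_pos, of T T l] assms by (simp add: N_def algebra_simps)
      have "slab_norm X T (\<lambda>z. U l (z + et l) - U l z) \<le> ennreal B * emeasure lborel ({-X..X} \<times> {0..?d})"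
      proof (rule nn_integral_chain_le[where N = N and e = "et l"])
        fix z assume z: "z \<in> slab X T"
        show "\<exists>k<N. z - real k *\<^sub>R et l \<in> {-X..X} \<times> {0..?d}"
        proof (intro exI conjI)
          have t: "0 \<le> snd z" "snd z \<le> T" using z by (auto simp: mem_slab)
          define k where "k = nat \<lfloor>snd z / ?d\<rfloor>"
          note fl = nat_floor_divide_less[OF dt_pos t, of l, folded k_def]
          show "k < N" using fl(1) by (simp only: N_def)
          have "z - real k *\<^sub>R et l = (fst z, snd z - real k * ?d)"
            by (cases z) (simp add: et_def)
          then show "z - real k *\<^sub>R et l \<in> {-X..X} \<times> {0..?d}"
            using fl(2,3) z by (auto simp: mem_slab abs_le_iff)
        qed
      next
        fix z :: "real \<times> real" assume z: "z \<in> {-X..X} \<times> {0..?d}"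
        obtain x t where xt: "z = (x, t)" by (cases z)
        \<comment> \<open>The sample points must lie strictly inside the time interval. A start in
          the first time step is moved to its midpoint, which does not change the values; the closed
          strip also contains \<open>t = \<Delta>t l\<close>, which stays in place.\<close>
        define y where "y k = (if t < ?d then ?d / 2 else ?d) + real k * ?d" for k
        have Uy: "U l (z + real k *\<^sub>R et l) = U l (x, y k)" for k
        proof (cases "t < ?d")
          case True
          have "\<lfloor>(t + real k * ?d) / ?d\<rfloor> = int k" "\<lfloor>y k / ?d\<rfloor> = int k"
            using True z dt_pos[of l] by (auto simp: xt y_def floor_eq_iff field_simps)
          then show ?thesis by (simp add: U_eq xt et_def)
        next
          case False
          then show ?thesis using z by (simp add: y_def xt et_def)
        qed
        have "(\<Sum>k<N. \<bar>U l (x, y (Suc k)) - U l (x, y k)\<bar>) \<le> B"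
        proof (rule tv_sum_le[OF B(2) B(1)])
          show "strict_mono_on {..N} y" using dt_pos[of l] by (auto simp: y_def strict_mono_on_def)
          have "0 < y 0 \<and> y N \<le> ?d + real N * ?d" using dt_pos[of l] by (auto simp: y_def)
          then show "0 < y 0" "y N < T + 3" using Nd elim by linarith+
        qed (use z xt in auto)
        moreover have "U l (z + real k *\<^sub>R et l + et l) = U l (x, y (Suc k))" for k
          unfolding Uy[symmetric] by (simp add: algebra_simps)
        ultimately show "(\<Sum>k<N. ennreal \<bar>U l (z + real k *\<^sub>R et l + et l) - U l (z + real k *\<^sub>R et l)\<bar>) \<le> ennreal B"
          by (simp add: Uy ennreal_leI del: of_nat_Suc)
      qed (auto simp: borel_Times)
      also have "emeasure lborel ({-X..X} \<times> {0..?d}) = ennreal (2 * X * ?d)"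
        using assms dt_pos[of l]
        by (simp add: lborel_prod[symmetric] lborel.emeasure_pair_measure_Times ennreal_mult'')
      also have "ennreal B * \<dots> = ennreal (B * (2 * X * ?d))"
        using B by (simp add: ennreal_mult')
      finally show ?case .
    qed
  qed
qed

text \<open>Horizontal chains, starting in a column of width \<open>\<Delta>x l\<close> at the left
  edge of the slab.\<close>

lemma L1_null_space_step:
  assumes "0 < X" "0 < T"
  shows "L1_null X T (\<lambda>l z. U l (z + ex l) - U l z)"
proof -
  obtain B where B: "0 \<le> B" "\<And>l t. 0 \<le> t \<Longrightarrow> t \<le> T \<Longrightarrow> total_variation (\<lambda>x. U l (x, t)) (- X - 1) (X + 3) \<le> ennreal B"
    using TV_bound[of "- X - 1" "X + 3" T] assms by auto
  show ?thesis
  proof (rule L1_null_of_le)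
    show "(\<lambda>l. B * (T * \<Delta>x l)) \<longlonglongrightarrow> 0"
      by (intro tendsto_mult_right_zero steps(2))
    show "\<forall>\<^sub>F l in sequentially. slab_norm X T (\<lambda>z. U l (z + ex l) - U l z) \<le> ennreal (B * (T * \<Delta>x l))"
      using eventually_dx_less[OF zero_less_one]
    proof eventually_elim
      case (elim l)
      let ?d = "\<Delta>x l"
      define N where "N = nat \<lfloor>2 * X / ?d\<rfloor> + 1"
      have Nd: "real N * ?d \<le> 2 * X + ?d"
        using nat_floor_divide_less(2)[OF steps(1), of "2 * X" "2 * X" l] assms by (simp add: N_def algebra_simps)
      have "slab_norm X T (\<lambda>z. U l (z + ex l) - U l z) \<le> ennreal B * emeasure lborel ({-X..-X+?d} \<times> {0..T})"
      proof (rule nn_integral_chain_le[where N = N and e = "ex l"])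
        fix z assume z: "z \<in> slab X T"
        show "\<exists>k<N. z - real k *\<^sub>R ex l \<in> {-X..-X+?d} \<times> {0..T}"
        proof (intro exI conjI)
          have t: "0 \<le> fst z + X" "fst z + X \<le> 2 * X" using z by (auto simp: mem_slab)
          define k where "k = nat \<lfloor>(fst z + X) / ?d\<rfloor>"
          note fl = nat_floor_divide_less[OF steps(1) t, of l, folded k_def]
          show "k < N" using fl(1) by (simp only: N_def)
          have "z - real k *\<^sub>R ex l = (fst z - real k * ?d, snd z)"
            by (cases z) (simp add: ex_def)
          then show "z - real k *\<^sub>R ex l \<in> {-X..-X+?d} \<times> {0..T}"
            using fl(2,3) z by (auto simp: mem_slab)
        qed
      next
        fix z :: "real \<times> real" assume z: "z \<in> {-X..-X+?d} \<times> {0..T}"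
        obtain x t where xt: "z = (x, t)" by (cases z)
        define y where "y k = x + real k * ?d" for k
        have Uy: "U l (z + real k *\<^sub>R ex l) = U l (y k, t)" for k
          by (simp add: y_def xt ex_def)
        have "(\<Sum>k<N. \<bar>U l (y (Suc k), t) - U l (y k, t)\<bar>) \<le> B"
        proof (rule tv_sum_le[OF B(2) B(1)])
          show "strict_mono_on {..N} y" using steps(1)[of l] by (auto simp: y_def strict_mono_on_def)
          have "y 0 = x" "y N = x + real N * ?d" by (auto simp: y_def)
          then show "- X - 1 < y 0" "y N < X + 3" using Nd elim z xt by auto
        qed (use z xt in auto)
        moreover have "U l (z + real k *\<^sub>R ex l + ex l) = U l (y (Suc k), t)" for k
          unfolding Uy[symmetric] by (simp add: algebra_simps)
        ultimately show "(\<Sum>k<N. ennreal \<bar>U l (z + real k *\<^sub>R ex l + ex l) - U l (z + real k *\<^sub>R ex l)\<bar>) \<le> ennreal B"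
          by (simp add: Uy ennreal_leI del: of_nat_Suc)
      qed (auto simp: borel_Times)
      also have "emeasure lborel ({-X..-X+?d} \<times> {0..T}) = ennreal (T * ?d)"
        using assms steps(1)[of l]
        by (simp add: lborel_prod[symmetric] lborel.emeasure_pair_measure_Times ennreal_mult'' mult.commute)
      also have "ennreal B * \<dots> = ennreal (B * (T * ?d))"
        using B by (simp add: ennreal_mult')
      finally show ?case .
    qed
  qed
qed

lemma slab_plus_ex: "\<forall>\<^sub>F l in sequentially. \<forall>z\<in>slab X T. z + ex l \<in> slab (X + 1) T"
  using eventually_dx_less[OF zero_less_one]
proof eventually_elim
  case (elim l)
  then show ?case using steps(1)[of l] by (auto simp: mem_slab ex_def abs_le_iff)
qed

lemma slab_minus_ex: "\<forall>\<^sub>F l in sequentially. \<forall>z\<in>slab X T. z + - ex l \<in> slab (X + 1) T"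
  using eventually_dx_less[OF zero_less_one]
proof eventually_elim
  case (elim l)
  then show ?case using steps(1)[of l] by (auto simp: mem_slab ex_def abs_le_iff)
qed

text \<open>Telescoping over single cells. For large \<open>l\<close> one cell leaves the slab by
  less than 1, which is why the induction runs over all \<open>X\<close> at once.\<close>

lemma L1_null_space_shift:
  assumes "0 < X" "0 < T"
  shows "L1_null X T (\<lambda>l z. U l (z + (of_int j * \<Delta>x l, 0)) - U l z)"
  using assms(1)
proof (induction j arbitrary: X rule: int_induct[where k = 0])
  case base
  have "(\<lambda>l z. U l (z + (of_int 0 * \<Delta>x l, 0)) - U l z) = (\<lambda>l z. 0)"
    by (simp flip: zero_prod_def)
  then show ?case by (simp add: L1_null_def)
next
  case (step1 j)
  have "L1_null X T (\<lambda>l z. U l (z + ex l + (of_int j * \<Delta>x l, 0)) - U l (z + ex l))"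
    by (rule L1_null_shift[OF step1(2)[of "X + 1"], where a = ex])
       (use step1(3) slab_plus_ex in auto)
  from L1_null_add[OF this L1_null_space_step[OF step1(3) assms(2)]]
  have *: "L1_null X T (\<lambda>l z. \<bar>U l (z + ex l + (of_int j * \<Delta>x l, 0)) - U l (z + ex l)\<bar> + \<bar>U l (z + ex l) - U l z\<bar>)"
    by simp
  have eq: "z + (of_int (j + 1) * \<Delta>x l, 0) = z + ex l + (of_int j * \<Delta>x l, 0)" for z l
    by (cases z) (simp add: ex_def algebra_simps)
  show ?case
    unfolding eq by (rule L1_null_mono[OF *]) (intro always_eventually allI AE_I2 impI, linarith)
next
  case (step2 j)
  have X: "0 < X + 1" using step2 by simp
  have "L1_null X T (\<lambda>l z. U l (z + - ex l + (of_int j * \<Delta>x l, 0)) - U l (z + - ex l))"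
    by (rule L1_null_shift[OF step2(2)[of "X + 1"], where a = "\<lambda>l. - ex l"])
       (use step2(3) slab_minus_ex in \<open>simp_all del: add_uminus_conv_diff\<close>)
  moreover have "L1_null X T (\<lambda>l z. U l (z + - ex l + ex l) - U l (z + - ex l))"
    by (rule L1_null_shift[OF L1_null_space_step[OF X assms(2)], where a = "\<lambda>l. - ex l"])
       (use slab_minus_ex in \<open>simp_all del: add_uminus_conv_diff\<close>)
  ultimately have *: "L1_null X T (\<lambda>l z. \<bar>U l (z + - ex l + (of_int j * \<Delta>x l, 0)) - U l (z + - ex l)\<bar>
      + \<bar>U l (z + - ex l + ex l) - U l (z + - ex l)\<bar>)"
    by (rule L1_null_add) measurable
  have eq: "z + (of_int (j - 1) * \<Delta>x l, 0) = z + - ex l + (of_int j * \<Delta>x l, 0)" for z l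
    by (cases z) (simp add: ex_def algebra_simps)
  show ?case
    unfolding eq by (rule L1_null_mono[OF *]) (intro always_eventually allI AE_I2 impI, simp)
qed

lemma eventually_stencil_slab:
  "\<forall>\<^sub>F l in sequentially. \<forall>z\<in>slab X T. \<forall>j\<in>{- int p..int q}. z + (of_int j * \<Delta>x l, 0) \<in> slab (X + 1) T"
proof -
  have pos: "0 < 1 / (real p + real q + 1)" by simp
  show ?thesis
    using eventually_dx_less[OF pos]
  proof eventually_elim
    case (elim l)
    have "\<bar>of_int j * \<Delta>x l\<bar> \<le> 1" if "j \<in> {- int p..int q}" for j
    proof -
      have "\<bar>real_of_int j\<bar> \<le> real p + real q + 1" using that by (auto simp: abs_le_iff)
      then have "\<bar>of_int j * \<Delta>x l\<bar> \<le> (real p + real q + 1) * \<Delta>x l"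
        using steps(1)[of l] by (simp add: abs_mult mult_right_mono)
      also have "\<dots> \<le> 1" using elim by (simp add: field_simps)
      finally show ?thesis .
    qed
    note small = this
    show ?case
    proof (intro ballI)
      fix z and j assume z: "z \<in> slab X T" and j: "j \<in> {- int p..int q}"
      from z small[OF j] show "z + (of_int j * \<Delta>x l, 0) \<in> slab (X + 1) T"
        by (auto simp: mem_slab)
    qed
  qed
qed

lemma eventually_stencil_le:
  assumes M: "\<forall>l. \<forall>z\<in>slab (X + 1) T. U l z \<le> M"
  shows "\<forall>\<^sub>F l in sequentially. \<forall>z\<in>slab X T. \<forall>j\<in>{- int p..int q}. U l (z + (of_int j * \<Delta>x l, 0)) \<in> {0..M}"
  using eventually_stencil_slab[of X T]
proof eventually_elim
  case (elim l)
  show ?case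
  proof (intro ballI)
    fix z and j assume "z \<in> slab X T" "j \<in> {- int p..int q}"
    then have "z + (of_int j * \<Delta>x l, 0) \<in> slab (X + 1) T" by (rule elim[THEN bspec, THEN bspec])
    then show "U l (z + (of_int j * \<Delta>x l, 0)) \<in> {0..M}"
      using M[THEN spec, of l, THEN bspec, of "z + (of_int j * \<Delta>x l, 0)"] U_pos[of l "z + (of_int j * \<Delta>x l, 0)"] by simp
  qed
qed

section \<open>Limits of the numerical flux and of the Patankar weights\<close>

lemma flx_bounded:
  assumes "0 < X" "0 < T"
  shows "\<exists>G>0. \<forall>\<^sub>F l in sequentially. \<forall>z\<in>slab X T. \<bar>flx l z\<bar> \<le> G"
proof -
  have X1: "0 < X + 1" using assms by simp
  obtain M where M: "0 < M" "\<forall>l. \<forall>z\<in>slab (X + 1) T. U l z \<le> M"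
    using U_bounded[OF X1 assms(2)] by blast
  from numerical_flux_bounded[OF flux(1) less_imp_le[OF M(1)]]
  obtain G where G: "\<forall>v. (\<forall>j\<in>{- int p..int q}. v j \<in> {0..M}) \<longrightarrow> \<bar>g v\<bar> \<le> G" ..
  have "\<forall>\<^sub>F l in sequentially. \<forall>z\<in>slab X T. \<bar>flx l z\<bar> \<le> max G 1"
    using eventually_stencil_le[of X T, OF M(2)]
  proof eventually_elim
    case (elim l)
    show ?case
    proof
      fix z assume "z \<in> slab X T"
      then have "\<bar>flx l z\<bar> \<le> G"
        unfolding flx_eq by (intro G[THEN spec, THEN mp] elim[THEN bspec])
      then show "\<bar>flx l z\<bar> \<le> max G 1" by simp
    qed
  qed
  then show ?thesis by (intro exI[of _ "max G 1"] conjI) auto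
qed

lemma f_continuous: "continuous_on UNIV f"
  by (rule consistent_flux_continuous[OF flux])

lemma f_measurable [measurable]: "f \<in> borel_measurable borel"
  by (rule borel_measurable_continuous_onI[OF f_continuous])

text \<open>By \<open>numerical_flux_modulus\<close> the flux differs from its value at the constant
  state by a small constant plus increments over the stencil, which vanish in the mean.\<close>

lemma L1_null_flx:
  assumes "0 < X" "0 < T"
  shows "L1_null X T (\<lambda>l z. flx l z - f (U l z))"
proof (rule L1_null_approx)
  fix \<epsilon> :: real assume "0 < \<epsilon>"
  then obtain c where c: "0 < c" "slab_norm X T (\<lambda>z. c) \<le> ennreal \<epsilon>"
    using nn_integral_slab_const_le by blast
  have X1: "0 < X + 1" using assms by simp
  obtain M where M: "0 < M" "\<forall>l. \<forall>z\<in>slab (X + 1) T. U l z \<le> M"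
    using U_bounded[OF X1 assms(2)] by blast
  from numerical_flux_modulus[OF flux(1) less_imp_le[OF M(1)] c(1)]
  obtain C where C: "0 \<le> C \<and> (\<forall>v. (\<forall>j\<in>{- int p..int q}. v j \<in> {0..M}) \<longrightarrow>
      \<bar>g v - g (\<lambda>_. v 0)\<bar> \<le> c + C * (\<Sum>j\<in>{- int p..int q}. \<bar>v j - v 0\<bar>))" ..
  let ?e' = "\<lambda>l z. C * (\<Sum>j\<in>{- int p..int q}. \<bar>U l (z + (of_int j * \<Delta>x l, 0)) - U l z\<bar>)"
  have null: "L1_null X T ?e'"
    by (intro L1_null_cmult L1_null_sum L1_null_space_shift assms) measurable
  have "\<forall>\<^sub>F l in sequentially. AE z in lborel. z \<in> slab X T \<longrightarrow> \<bar>flx l z - f (U l z)\<bar> \<le> \<bar>c\<bar> + \<bar>?e' l z\<bar>"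
    using eventually_stencil_le[of X T, OF M(2)]
  proof eventually_elim
    case (elim l)
    have "\<bar>flx l z - f (U l z)\<bar> \<le> \<bar>c\<bar> + \<bar>?e' l z\<bar>" if "z \<in> slab X T" for z
    proof -
      let ?v = "\<lambda>j::int. U l (z + (of_int j * \<Delta>x l, 0))"
      have "?v 0 = U l z" by (simp flip: zero_prod_def)
      moreover have "g (\<lambda>_. c) = f c" for c using flux(2) by (simp add: consistent_flux_def)
      moreover have "\<bar>g ?v - g (\<lambda>_. ?v 0)\<bar> \<le> c + C * (\<Sum>j\<in>{- int p..int q}. \<bar>?v j - ?v 0\<bar>)"
        by (intro C[THEN conjunct2, THEN spec, THEN mp] elim[THEN bspec] that)
      ultimately have "\<bar>flx l z - f (U l z)\<bar> \<le> c + ?e' l z" unfolding flx_eq by simp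
      then show ?thesis by linarith
    qed
    then show ?case by auto
  qed
  with null c show "\<exists>h e'. h \<in> borel_measurable borel \<and> (\<forall>l. e' l \<in> borel_measurable borel) \<and>
      slab_norm X T h \<le> ennreal \<epsilon> \<and> L1_null X T e' \<and>
      (\<forall>\<^sub>F l in sequentially. AE z in lborel. z \<in> slab X T \<longrightarrow> \<bar>flx l z - f (U l z)\<bar> \<le> \<bar>h z\<bar> + \<bar>e' l z\<bar>)"
    by (intro exI[of _ "\<lambda>_. c"] exI[of _ ?e']) auto
qed

text \<open>\<open>ennreal (w z - M)\<close> is the positive part of the excess over
  \<open>M\<close>, and it is dominated by the distance of \<open>w\<close> to values that are at
  most \<open>M\<close>.\<close>

lemma w_bounded:
  assumes M: "\<forall>l. \<forall>z\<in>slab X T. U l z \<le> M"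
  shows "AE z in lborel. z \<in> slab X T \<longrightarrow> w z \<in> {0<..M}"
proof -
  have "(\<integral>\<^sup>+z. ennreal (w z - M) * indicator (slab X T) z \<partial>lborel) \<le> slab_norm X T (\<lambda>z. U l z - w z)" for l
  proof (rule nn_integral_mono)
    show "ennreal (w z - M) * indicator (slab X T) z \<le> ennreal \<bar>U l z - w z\<bar> * indicator (slab X T) z" for z
    proof (cases "z \<in> slab X T")
      case True
      then have "U l z \<le> M" using M by blast
      then show ?thesis by (auto split: split_indicator intro!: ennreal_leI)
    qed simp
  qed
  then have "(\<integral>\<^sup>+z. ennreal (w z - M) * indicator (slab X T) z \<partial>lborel) \<le> 0"
    by (intro LIMSEQ_le_const[OF conv[of X T, unfolded L1_null_def]]) auto
  then have "(\<integral>\<^sup>+z. ennreal (w z - M) * indicator (slab X T) z \<partial>lborel) = 0"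
    by simp
  then have "AE z in lborel. ennreal (w z - M) * indicator (slab X T) z = 0"
    by (subst (asm) nn_integral_0_iff_AE) auto
  with w_pos show ?thesis
    by eventually_elim (auto simp: mem_slab ennreal_eq_0_iff)
qed

lemma L1_null_f:
  assumes "0 < X" "0 < T"
  shows "L1_null X T (\<lambda>l z. f (U l z) - f (w z))"
proof (rule L1_null_approx)
  fix \<epsilon> :: real assume "0 < \<epsilon>"
  then obtain c where c: "0 < c" "slab_norm X T (\<lambda>z. c) \<le> ennreal \<epsilon>"
    using nn_integral_slab_const_le by blast
  obtain M where M: "0 < M" "\<forall>l. \<forall>z\<in>slab X T. U l z \<le> M"
    using U_bounded[OF assms] by blast
  obtain C where C: "0 \<le> C" "\<And>a b. a \<in> {0..M} \<Longrightarrow> b \<in> {0..M} \<Longrightarrow> \<bar>f a - f b\<bar> \<le> c + C * \<bar>a - b\<bar>"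
    using continuous_modulus[OF f_continuous, of c M] c by blast
  let ?e' = "\<lambda>l z. C * (U l z - w z)"
  have null: "L1_null X T ?e'"
    by (intro L1_null_cmult conv) measurable
  have "AE z in lborel. z \<in> slab X T \<longrightarrow> \<bar>f (U l z) - f (w z)\<bar> \<le> \<bar>c\<bar> + \<bar>?e' l z\<bar>" for l
    using w_bounded[OF M(2)]
  proof eventually_elim
    case (elim z)
    show ?case
    proof
      assume z: "z \<in> slab X T"
      have "\<bar>f (U l z) - f (w z)\<bar> \<le> c + C * \<bar>U l z - w z\<bar>"
        using elim z M(2)[THEN spec, of l, THEN bspec, OF z] U_pos[of l z] by (intro C(2)) auto
      then show "\<bar>f (U l z) - f (w z)\<bar> \<le> \<bar>c\<bar> + \<bar>?e' l z\<bar>" using C c by (simp add: abs_mult)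
    qed
  qed
  with null c show "\<exists>h e'. h \<in> borel_measurable borel \<and> (\<forall>l. e' l \<in> borel_measurable borel) \<and>
      slab_norm X T h \<le> ennreal \<epsilon> \<and> L1_null X T e' \<and>
      (\<forall>\<^sub>F l in sequentially. AE z in lborel. z \<in> slab X T \<longrightarrow> \<bar>f (U l z) - f (w z)\<bar> \<le> \<bar>h z\<bar> + \<bar>e' l z\<bar>)"
    by (intro exI[of _ "\<lambda>_. c"] exI[of _ ?e']) auto
qed

text \<open>The sets where \<open>w < 1 / real (Suc n)\<close> decrease to a null set, because
  \<open>w\<close> is positive almost everywhere on the half plane; their measures are finite and
  hence tend to 0.\<close>

lemma w_small_set:
  assumes "0 < \<epsilon>"
  shows "\<exists>\<eta>>0. emeasure lborel {z \<in> slab X T. w z < 2 * \<eta>} \<le> ennreal \<epsilon>"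
proof -
  define A where "A n = {z \<in> slab X T. w z < 1 / real (Suc n)}" for n
  have [measurable, simp]: "A n \<in> sets borel" for n unfolding A_def by measurable
  have "decseq A"
    unfolding A_def decseq_def by (force intro: less_le_trans simp: frac_le)
  moreover have "emeasure lborel (A n) \<noteq> \<infinity>" for n
  proof -
    have "emeasure lborel (A n) \<le> emeasure lborel (slab X T)"
      by (intro emeasure_mono) (auto simp: A_def)
    then show ?thesis using emeasure_slab[of X T] by (auto simp: top_unique)
  qed
  ultimately have lim: "(\<lambda>n. emeasure lborel (A n)) \<longlonglongrightarrow> emeasure lborel (\<Inter>n. A n)"
    by (intro Lim_emeasure_decseq) auto
  have "AE z in lborel. z \<notin> (\<Inter>n. A n)"
    using w_pos
  proof eventually_elim
    case (elim z)
    show ?case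
    proof
      assume z: "z \<in> (\<Inter>n. A n)"
      then have "0 < w z" using elim by (auto simp: A_def mem_slab)
      then obtain n where "1 / real (Suc n) < w z" using nat_approx_posE by blast
      then show False using z by (auto simp: A_def dest!: spec[of _ n])
    qed
  qed
  moreover have "(\<Inter>n. A n) \<in> sets lborel" by auto
  ultimately have "emeasure lborel (\<Inter>n. A n) = 0"
    using AE_iff_null_sets[of "\<Inter>n. A n" lborel] by (simp add: null_setsD1)
  then have "\<forall>\<^sub>F n in sequentially. emeasure lborel (A n) \<le> ennreal \<epsilon>"
    using lim assms ennreal_tendsto_0_iff by auto
  then obtain n where n: "emeasure lborel (A n) \<le> ennreal \<epsilon>" by (auto simp: eventually_sequentially)
  show ?thesis
  proof (intro exI conjI)
    have "2 * (1 / (2 * real (Suc n))) = 1 / real (Suc n)" by (simp add: field_simps)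
    then show "emeasure lborel {z \<in> slab X T. w z < 2 * (1 / (2 * real (Suc n)))} \<le> ennreal \<epsilon>"
      using n by (simp only: A_def)
  qed simp
qed

text \<open>Truncated at 1 because the weights have no bound. Off a set of small measure
  \<open>w\<close> is at least \<open>2 * \<eta>\<close>. There, either \<open>U\<close> is below
  \<eta>, at the price of a distance of at least \<eta> to \<open>w\<close>, or the weight differs
  from 1 by at most the time increment divided by \<eta>.\<close>

lemma L1_null_weight:
  assumes "0 < X" "0 < T"
  shows "L1_null X T (\<lambda>l z. min 1 \<bar>U l (z + et l) / U l z - 1\<bar>)"
proof (rule L1_null_approx)
  fix \<epsilon> :: real assume "0 < \<epsilon>"
  then obtain \<eta> where \<eta>: "0 < \<eta>" "emeasure lborel {z \<in> slab X T. w z < 2 * \<eta>} \<le> ennreal \<epsilon>"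
    using w_small_set by blast
  let ?A = "{z \<in> slab X T. w z < 2 * \<eta>}"
  let ?e' = "\<lambda>l z. \<bar>(1 / \<eta>) * (U l z - w z)\<bar> + \<bar>(1 / \<eta>) * (U l (z + et l) - U l z)\<bar>"
  have null: "L1_null X T ?e'"
    by (intro L1_null_add L1_null_cmult conv L1_null_time_step assms) measurable
  have h: "slab_norm X T (\<lambda>z. indicator ?A z) \<le> ennreal \<epsilon>"
  proof -
    have "slab_norm X T (\<lambda>z. indicator ?A z) = (\<integral>\<^sup>+z. indicator ?A z \<partial>lborel)"
      by (intro nn_integral_cong) (auto split: split_indicator)
    also have "\<dots> = emeasure lborel ?A" by (intro nn_integral_indicator) measurable
    finally show ?thesis using \<eta> by simp
  qed
  have le: "\<bar>min 1 \<bar>U l (z + et l) / U l z - 1\<bar>\<bar> \<le> \<bar>indicator ?A z\<bar> + \<bar>?e' l z\<bar>" if z: "z \<in> slab X T" for l z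
  proof -
    consider "w z < 2 * \<eta>" | "2 * \<eta> \<le> w z" "U l z < \<eta>" | "\<eta> \<le> U l z" by linarith
    then have "min 1 \<bar>U l (z + et l) / U l z - 1\<bar> \<le> indicator ?A z + ?e' l z"
    proof cases
      case 1
      then show ?thesis using z by (simp add: min.coboundedI1)
    next
      case 2
      then have "1 \<le> \<bar>(1 / \<eta>) * (U l z - w z)\<bar>" using \<eta> by (simp add: abs_mult field_simps)
      then show ?thesis by (intro min.coboundedI1) (simp add: add_increasing add_increasing2)
    next
      case 3
      have "U l (z + et l) / U l z - 1 = (U l (z + et l) - U l z) / U l z"
        using U_pos[of l z] by (simp add: field_simps)
      then have "\<bar>U l (z + et l) / U l z - 1\<bar> = \<bar>U l (z + et l) - U l z\<bar> / U l z"
        using U_pos[of l z] by simp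
      also have "\<dots> \<le> \<bar>U l (z + et l) - U l z\<bar> / \<eta>" using 3 \<eta> by (intro divide_left_mono) auto
      also have "\<dots> = \<bar>(1 / \<eta>) * (U l (z + et l) - U l z)\<bar>" using \<eta> by (simp add: abs_mult)
      finally show ?thesis by (intro min.coboundedI2) (simp add: add_increasing)
    qed
    then show ?thesis by simp
  qed
  have "h \<in> borel_measurable borel" if "h = indicator ?A" for h :: "real \<times> real \<Rightarrow> real"
    unfolding that by measurable
  with null h le show "\<exists>h e'. h \<in> borel_measurable borel \<and> (\<forall>l. e' l \<in> borel_measurable borel) \<and>
      slab_norm X T h \<le> ennreal \<epsilon> \<and> L1_null X T e' \<and>
      (\<forall>\<^sub>F l in sequentially. AE z in lborel. z \<in> slab X T \<longrightarrow> \<bar>min 1 \<bar>U l (z + et l) / U l z - 1\<bar>\<bar> \<le> \<bar>h z\<bar> + \<bar>e' l z\<bar>)"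
    by (intro exI[of _ "indicator ?A"] exI[of _ ?e'] conjI always_eventually allI AE_I2 impI) auto
qed

section \<open>The cut-off of the Patankar flux and its limit\<close>

lemma clamp_to_bounded: "0 \<le> C \<Longrightarrow> \<bar>clamp_to C a\<bar> \<le> C"
  by (auto simp: clamp_to_def)

lemma clamp_to_id: "\<bar>a\<bar> \<le> C \<Longrightarrow> clamp_to C a = a"
  by (auto simp: clamp_to_def)

lemma clamp_to_nonexpansive: "\<bar>clamp_to C a - clamp_to C b\<bar> \<le> \<bar>a - b\<bar>"
  by (auto simp: clamp_to_def max_def min_def)

lemma clamp_to_measurable [measurable]: "clamp_to C \<in> borel_measurable borel"
  unfolding clamp_to_def by measurable

text \<open>The cut-off is nonexpansive and fixes the numerical flux, so a weight \<open>a\<close>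
  costs at most \<open>C * |a - 1|\<close>, and it never costs more than \<open>2 * C\<close>. Two
  weights appear because the donor cell depends on the sign of the flux.\<close>

lemma clamp_F_flx:
  assumes z: "0 \<le> snd z" and C: "\<bar>flx l z\<bar> \<le> C"
  shows "\<bar>clamp_to C (F l z) - flx l z\<bar>
    \<le> 2 * C * min 1 \<bar>U l (z + et l) / U l z - 1\<bar> + 2 * C * min 1 \<bar>U l (z + ex l + et l) / U l (z + ex l) - 1\<bar>"
proof -
  have C0: "0 \<le> C" using C by linarith
  have key: "\<bar>clamp_to C (F l z) - flx l z\<bar> \<le> 2 * C * min 1 \<bar>a - 1\<bar>" if "F l z = flx l z * a" for a
  proof (cases "\<bar>a - 1\<bar> \<le> 1")
    case True
    have "\<bar>clamp_to C (F l z) - flx l z\<bar> \<le> \<bar>F l z - flx l z\<bar>"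
      using clamp_to_nonexpansive[of C "F l z" "flx l z"] clamp_to_id[OF C] by simp
    also have "F l z - flx l z = flx l z * (a - 1)" unfolding that by (simp add: right_diff_distrib)
    also have "\<bar>\<dots>\<bar> \<le> C * \<bar>a - 1\<bar>" using C by (simp add: abs_mult mult_right_mono)
    also have "\<dots> \<le> 2 * C * \<bar>a - 1\<bar>" using C0 by (simp add: mult_right_mono)
    finally show ?thesis using True by simp
  next
    case False
    then show ?thesis using clamp_to_bounded[OF C0, of "F l z"] C by simp
  qed
  have nonneg: "0 \<le> 2 * C * min 1 \<bar>a - 1\<bar>" for a using C0 by simp
  show ?thesis
  proof (cases "0 \<le> flx l z")
    case True
    then have "F l z = flx l z * (U l (z + et l) / U l z)" using F_eq[OF z, of l] by simp
    from key[OF this] nonneg show ?thesis by (meson add_increasing2)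
  next
    case False
    then have "F l z = flx l z * (U l (z + ex l + et l) / U l (z + ex l))" using F_eq[OF z, of l] by simp
    from key[OF this] nonneg show ?thesis by (meson add_increasing)
  qed
qed

text \<open>Every cut-off above a bound of the numerical flux has the same limit. The mass estimate
  takes that bound itself; the final limit takes a cut-off that also lies above the bound of the
  Patankar flux.\<close>

lemma L1_null_clamp_F:
  assumes XT: "0 < X" "0 < T" and C: "\<forall>\<^sub>F l in sequentially. \<forall>z\<in>slab X T. \<bar>flx l z\<bar> \<le> C"
  shows "L1_null X T (\<lambda>l z. clamp_to C (F l z) - f (w z))"
proof -
  let ?m = "\<lambda>l z. min 1 \<bar>U l (z + et l) / U l z - 1\<bar>"
  have XT': "0 < X + 1" using XT by simp
  have m: "L1_null X T (\<lambda>l z. 2 * C * ?m l z)" "L1_null (X + 1) T (\<lambda>l z. 2 * C * ?m l z)"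
    by (intro L1_null_cmult L1_null_weight XT XT'; measurable)+
  have m': "L1_null X T (\<lambda>l z. 2 * C * ?m l (z + ex l))"
    by (rule L1_null_shift[OF m(2)]) (use slab_plus_ex in auto)
  have null: "L1_null X T (\<lambda>l z. \<bar>\<bar>2 * C * ?m l z\<bar> + \<bar>2 * C * ?m l (z + ex l)\<bar>\<bar> + \<bar>\<bar>flx l z - f (U l z)\<bar> + \<bar>f (U l z) - f (w z)\<bar>\<bar>)"
    by (intro L1_null_add m(1) m' L1_null_flx L1_null_f XT) measurable
  show ?thesis
  proof (rule L1_null_mono[OF null])
    show "\<forall>\<^sub>F l in sequentially. AE z in lborel. z \<in> slab X T \<longrightarrow> \<bar>clamp_to C (F l z) - f (w z)\<bar>
      \<le> \<bar>\<bar>\<bar>2 * C * ?m l z\<bar> + \<bar>2 * C * ?m l (z + ex l)\<bar>\<bar> + \<bar>\<bar>flx l z - f (U l z)\<bar> + \<bar>f (U l z) - f (w z)\<bar>\<bar>\<bar>"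
      using C
    proof eventually_elim
      case (elim l)
      show ?case
      proof (intro AE_I2 impI)
        fix z assume z: "z \<in> slab X T"
        have "\<bar>clamp_to C (F l z) - flx l z\<bar> \<le> 2 * C * ?m l z + 2 * C * ?m l (z + ex l)"
          using clamp_F_flx[of z l C] z elim by (simp add: mem_slab ac_simps)
        moreover have "\<bar>a - d\<bar> \<le> \<bar>\<bar>\<bar>b1\<bar> + \<bar>b2\<bar>\<bar> + \<bar>\<bar>b - c\<bar> + \<bar>c - d\<bar>\<bar>\<bar>" if "\<bar>a - b\<bar> \<le> b1 + b2"
          for a b c d b1 b2 :: real
          using that by linarith
        ultimately show "\<bar>clamp_to C (F l z) - f (w z)\<bar>
          \<le> \<bar>\<bar>\<bar>2 * C * ?m l z\<bar> + \<bar>2 * C * ?m l (z + ex l)\<bar>\<bar> + \<bar>\<bar>flx l z - f (U l z)\<bar> + \<bar>f (U l z) - f (w z)\<bar>\<bar>\<bar>"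
          by blast
      qed
    qed
  qed
qed

end

section \<open>Initial data as averages over the first time step\<close>

lemma integral_strip:
  fixes a :: "real \<Rightarrow> real"
  assumes [measurable]: "a \<in> borel_measurable borel" and B: "\<And>x. \<bar>a x\<bar> \<le> B" and supp: "\<And>x. a x \<noteq> 0 \<Longrightarrow> \<bar>x\<bar> \<le> X"
    and "0 \<le> d"
  shows "(LINT z:UNIV \<times> {0..<d}|lborel. a (fst z)) = d * (\<integral>x. a x \<partial>lborel)"
proof -
  let ?h = "\<lambda>x t. indicator {0..<d} t * a x :: real"
  have "integrable lborel (\<lambda>z. ?h (fst z) (snd z))"
  proof (rule integrable_bounded_support[where B = B and a = "(- X, 0)" and b = "(X, d)"])
    show "(\<lambda>z. ?h (fst z) (snd z)) \<in> borel_measurable borel"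
      unfolding borel_prod[symmetric] by measurable
    show "\<bar>?h (fst z) (snd z)\<bar> \<le> B" for z
      using B[of "fst z"] abs_ge_zero[of "a (fst z)"] by (auto split: split_indicator)
    show "z \<in> cbox (- X, 0) (X, d)" if "?h (fst z) (snd z) \<noteq> 0" for z
      using that supp[of "fst z"] by (cases z) (auto simp: cbox_Pair_eq indicator_def split: if_splits)
  qed
  then have "integrable (lborel \<Otimes>\<^sub>M lborel) (\<lambda>(x, t). ?h x t)"
    by (simp add: lborel_prod case_prod_unfold)
  from lborel_pair.integral_fst[OF this]
  have "(\<integral>x. (\<integral>t. ?h x t \<partial>lborel) \<partial>lborel) = (\<integral>z. ?h (fst z) (snd z) \<partial>lborel)"
    by (simp add: lborel_prod case_prod_unfold)
  moreover have c: "measure lborel {0..<d} = d"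
    using assms(4) by simp
  ultimately show ?thesis
    using c by (simp add: set_lebesgue_integral_def indicator_times)
qed

context mpe_limit
begin

text \<open>\<open>\<psi>\<close> need not be Borel measurable; this version agrees with it almost everywhere.\<close>

definition \<psi>\<^sub>0 :: "real \<Rightarrow> real" where "\<psi>\<^sub>0 x = lim (\<lambda>l. U l (x, 0))"

lemma U0_measurable [measurable]: "(\<lambda>x. U l (x, 0)) \<in> borel_measurable borel"
  by (rule measurable_compose[OF _ U_measurable]) (auto intro!: borel_measurable_continuous_onI continuous_intros)

lemma \<psi>\<^sub>0_measurable [measurable]: "\<psi>\<^sub>0 \<in> borel_measurable borel"
  unfolding \<psi>\<^sub>0_def by (rule borel_measurable_lim_metric) measurable

lemma \<psi>\<^sub>0_eq: "AE x in lborel. \<psi>\<^sub>0 x = \<psi> x \<and> (\<lambda>l. U l (x, 0)) \<longlonglongrightarrow> \<psi>\<^sub>0 x"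
  using \<psi>_cont
proof eventually_elim
  case (elim x)
  then show ?case using initial_tendsto[OF elim] by (simp add: \<psi>\<^sub>0_def limI)
qed

text \<open>On the first time step \<open>U l\<close> is constant in time and \<phi> changes by at
  most \<open>K * \<Delta>t l\<close>, so the average over the strip is within order
  \<open>\<Delta>t l\<close> of the integral at time 0, which converges by domination. The cut-off
  at \<open>M\<close> bounds the integrand on the whole strip and is inactive where \<phi> is
  nonzero.\<close>

lemma initial_integral_tendsto:
  fixes \<phi> :: "real \<times> real \<Rightarrow> real"
  assumes [measurable]: "\<phi> \<in> borel_measurable borel"
    and lip: "\<And>x t. 0 \<le> t \<Longrightarrow> \<bar>\<phi> (x, t) - \<phi> (x, 0)\<bar> \<le> K * t"
    and B: "\<And>z. \<bar>\<phi> z\<bar> \<le> B" and supp: "\<And>z. \<phi> z \<noteq> 0 \<Longrightarrow> \<bar>fst z\<bar> \<le> X"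
    and X: "0 < X" and M: "0 < M" "\<forall>l. \<forall>z\<in>slab X 1. U l z \<le> M"
  shows "(\<lambda>l. (LINT z:UNIV \<times> {0..<\<Delta>t l}|lborel. \<phi> z * clamp_to M (U l z)) / \<Delta>t l)
      \<longlonglongrightarrow> (\<integral>x. \<phi> (x, 0) * \<psi>\<^sub>0 x \<partial>lborel)"
    and "integrable lborel (\<lambda>x. \<phi> (x, 0) * \<psi>\<^sub>0 x)"
proof -
  have [measurable]: "(\<lambda>x. \<phi> (x, 0)) \<in> borel_measurable borel"
    by (rule measurable_compose[OF _ assms(1)]) (auto intro!: borel_measurable_continuous_onI continuous_intros)
  have B0: "0 \<le> B" using B[of 0] by linarith
  have K: "0 \<le> K" using lip[of 1 0] by linarith
  let ?a = "\<lambda>l x. \<phi> (x, 0) * clamp_to M (U l (x, 0))"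
  let ?D = "\<lambda>x. B * M * indicator {-X..X} x :: real"
  have dom: "integrable lborel ?D"
    by (intro integrable_mult_right integrable_real_indicator) (simp_all add: emeasure_lborel_Icc_eq)
  have a_le: "\<bar>?a l x\<bar> \<le> ?D x" for l x
    using supp[of "(x, 0)"] B[of "(x, 0)"] B0 M clamp_to_bounded[of M "U l (x, 0)"]
    by (cases "\<phi> (x, 0) = 0") (auto simp: abs_mult abs_le_iff split: split_indicator intro!: mult_mono)
  have lim: "AE x in lborel. (\<lambda>l. ?a l x) \<longlonglongrightarrow> \<phi> (x, 0) * \<psi>\<^sub>0 x"
    using \<psi>\<^sub>0_eq
  proof eventually_elim
    case (elim x)
    have eq: "?a l x = \<phi> (x, 0) * U l (x, 0)" for l
    proof (cases "\<phi> (x, 0) = 0")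
      case False
      then have "U l (x, 0) \<le> M" using supp[of "(x, 0)"] M by (auto simp: mem_slab)
      then show ?thesis using U_pos[of l "(x, 0)"] by (simp add: clamp_to_id)
    qed simp
    show ?case unfolding eq by (intro tendsto_mult tendsto_const conjunct2[OF elim])
  qed
  have 1: "(\<lambda>l. \<integral>x. ?a l x \<partial>lborel) \<longlonglongrightarrow> (\<integral>x. \<phi> (x, 0) * \<psi>\<^sub>0 x \<partial>lborel)"
    by (rule integral_dominated_convergence[OF _ _ dom lim]) (use a_le in auto)
  show "integrable lborel (\<lambda>x. \<phi> (x, 0) * \<psi>\<^sub>0 x)"
    by (rule integrable_dominated_convergence[OF _ _ dom lim]) (use a_le in auto)
  have 2: "\<bar>(LINT z:UNIV \<times> {0..<\<Delta>t l}|lborel. \<phi> z * clamp_to M (U l z)) / \<Delta>t l - (\<integral>x. ?a l x \<partial>lborel)\<bar>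
      \<le> 2 * X * K * M * \<Delta>t l" for l
  proof -
    let ?S = "UNIV \<times> {0..<\<Delta>t l} :: (real \<times> real) set"
    have int1: "set_integrable lborel ?S (\<lambda>z. \<phi> z * clamp_to M (U l z))"
      unfolding set_integrable_def
    proof (rule integrable_bounded_support[where B = "B * M" and a = "(- X, 0)" and b = "(X, \<Delta>t l)"])
      show "\<bar>indicator ?S z *\<^sub>R (\<phi> z * clamp_to M (U l z))\<bar> \<le> B * M" for z
        using B[of z] B0 M clamp_to_bounded[of M "U l z"]
        by (auto simp: abs_mult split: split_indicator intro!: mult_mono)
      show "z \<in> cbox (- X, 0) (X, \<Delta>t l)" if "indicator ?S z *\<^sub>R (\<phi> z * clamp_to M (U l z)) \<noteq> 0" for z
        using that supp[of z] by (cases z) (auto simp: cbox_Pair_eq indicator_def split: if_splits)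
    qed measurable
    have a_meas: "?a l \<in> borel_measurable borel" by measurable
    have [measurable]: "(\<lambda>z::real \<times> real. ?a l (fst z)) \<in> borel_measurable borel"
      by (rule measurable_compose[OF fst_borel_measurable a_meas])
    have int2: "set_integrable lborel ?S (\<lambda>z. ?a l (fst z))"
      unfolding set_integrable_def
    proof (rule integrable_bounded_support[where B = "B * M" and a = "(- X, 0)" and b = "(X, \<Delta>t l)"])
      show "\<bar>indicator ?S z *\<^sub>R (?a l (fst z))\<bar> \<le> B * M" for z
        using B[of "(fst z, 0)"] B0 M clamp_to_bounded[of M "U l (fst z, 0)"]
        by (auto simp: abs_mult split: split_indicator intro!: mult_mono)
      show "z \<in> cbox (- X, 0) (X, \<Delta>t l)" if "indicator ?S z *\<^sub>R (?a l (fst z)) \<noteq> 0" for z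
        using that supp[of "(fst z, 0)"] by (cases z) (auto simp: cbox_Pair_eq indicator_def split: if_splits)
    qed measurable
    have strip: "(LINT z:?S|lborel. ?a l (fst z)) = \<Delta>t l * (\<integral>x. ?a l x \<partial>lborel)"
    proof (rule integral_strip[where B = "B * M" and X = X])
      show "\<bar>?a l x\<bar> \<le> B * M" for x
        using a_le[of x l] B0 M by (auto split: split_indicator_asm intro: order_trans)
      show "\<bar>x\<bar> \<le> X" if "?a l x \<noteq> 0" for x using that supp[of "(x, 0)"] by auto
    qed (use dt_pos[of l] in auto)
    let ?I = "cbox (- X, 0) (X, \<Delta>t l)"
    have ptw: "\<bar>indicator ?S z * (\<phi> z * clamp_to M (U l z) - ?a l (fst z))\<bar> \<le> K * \<Delta>t l * M * indicator ?I z" for z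
    proof (cases "z \<in> ?S \<and> \<bar>fst z\<bar> \<le> X")
      case True
      obtain x t where z: "z = (x, t)" by (cases z)
      have "U l z = U l (x, 0)" using True U_initial_step[of t l x] by (simp add: z)
      then have "\<phi> z * clamp_to M (U l z) - ?a l (fst z) = (\<phi> (x, t) - \<phi> (x, 0)) * clamp_to M (U l (x, 0))"
        by (simp add: z algebra_simps)
      also have "\<bar>\<dots>\<bar> \<le> (K * t) * M"
        unfolding abs_mult using True z K M lip[of t x] clamp_to_bounded[of M "U l (x, 0)"]
        by (intro mult_mono) auto
      also have "\<dots> \<le> K * \<Delta>t l * M" using True z K M by (intro mult_right_mono mult_left_mono) auto
      finally show ?thesis using True z by (simp add: cbox_Pair_eq abs_le_iff)
    next
      case False
      have "indicator ?S z * (\<phi> z * clamp_to M (U l z) - ?a l (fst z)) = 0"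
      proof (cases "z \<in> ?S")
        case True
        then have "\<phi> z = 0" "\<phi> (fst z, 0) = 0" using False supp[of z] supp[of "(fst z, 0)"] by auto
        then show ?thesis by simp
      qed simp
      moreover have "0 \<le> K * \<Delta>t l * M * indicator ?I z" using K M dt_pos[of l] by simp
      ultimately show ?thesis by (simp only: abs_zero)
    qed
    have diff: "(LINT z:?S|lborel. \<phi> z * clamp_to M (U l z)) - (LINT z:?S|lborel. ?a l (fst z))
        = (\<integral>z. indicator ?S z * (\<phi> z * clamp_to M (U l z) - ?a l (fst z)) \<partial>lborel)"
      by (subst set_integral_diff(2)[OF int1 int2, symmetric]) (simp add: set_lebesgue_integral_def)
    have "\<bar>\<integral>z. indicator ?S z * (\<phi> z * clamp_to M (U l z) - ?a l (fst z)) \<partial>lborel\<bar>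
        \<le> (\<integral>z. \<bar>indicator ?S z * (\<phi> z * clamp_to M (U l z) - ?a l (fst z))\<bar> \<partial>lborel)"
      by (rule integral_abs_bound)
    also have "\<dots> \<le> (\<integral>z. K * \<Delta>t l * M * indicator ?I z \<partial>lborel)"
    proof (rule integral_mono)
      have "integrable lborel (\<lambda>z. indicator ?S z *\<^sub>R (\<phi> z * clamp_to M (U l z) - ?a l (fst z)))"
        using set_integral_diff(1)[OF int1 int2] by (simp add: set_integrable_def)
      then show "integrable lborel (\<lambda>z. \<bar>indicator ?S z * (\<phi> z * clamp_to M (U l z) - ?a l (fst z))\<bar>)"
        by (intro integrable_abs) simp
    qed (use ptw in \<open>auto simp: emeasure_lborel_cbox_eq\<close>)
    also have "\<dots> = K * \<Delta>t l * M * (2 * X * \<Delta>t l)"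
      using X dt_pos[of l] by (simp add: measure_lborel_cbox_eq Basis_prod_def inner_prod_def prod.union_disjoint)
    finally have "\<bar>(LINT z:?S|lborel. \<phi> z * clamp_to M (U l z)) - \<Delta>t l * (\<integral>x. ?a l x \<partial>lborel)\<bar>
        \<le> \<Delta>t l * (2 * X * K * M * \<Delta>t l)"
      unfolding diff[symmetric] strip by (simp add: ac_simps)
    moreover have "(LINT z:?S|lborel. \<phi> z * clamp_to M (U l z)) / \<Delta>t l - (\<integral>x. ?a l x \<partial>lborel)
       = ((LINT z:?S|lborel. \<phi> z * clamp_to M (U l z)) - \<Delta>t l * (\<integral>x. ?a l x \<partial>lborel)) / \<Delta>t l"
      using dt_pos[of l] by (simp add: field_simps)
    ultimately show ?thesis
      using dt_pos[of l] by (simp add: abs_divide pos_divide_le_eq mult.commute)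
  qed
  have "\<forall>\<^sub>F l in sequentially. norm ((LINT z:UNIV \<times> {0..<\<Delta>t l}|lborel. \<phi> z * clamp_to M (U l z)) / \<Delta>t l
      - (\<integral>x. ?a l x \<partial>lborel)) \<le> 2 * X * K * M * \<Delta>t l"
    unfolding real_norm_def by (intro always_eventually allI 2)
  from tendsto_add[OF Lim_null_comparison[OF this tendsto_mult_right_zero[OF dt_tendsto]] 1]
  show "(\<lambda>l. (LINT z:UNIV \<times> {0..<\<Delta>t l}|lborel. \<phi> z * clamp_to M (U l z)) / \<Delta>t l)
      \<longlonglongrightarrow> (\<integral>x. \<phi> (x, 0) * \<psi>\<^sub>0 x \<partial>lborel)"
    by (simp only: diff_add_cancel add_0_left)
qed

end

section \<open>Absence of vacuum\<close>

text \<open>The tent is frozen after time \<open>\<sigma>\<close> only to keep it bounded.\<close>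

definition tent :: "real \<Rightarrow> real \<Rightarrow> real \<Rightarrow> real \<Rightarrow> real \<times> real \<Rightarrow> real" where
  "tent c L \<tau> \<sigma> z = max 0 (1 / 2 - \<bar>fst z - c\<bar> + L * (min (snd z) \<sigma> - \<tau>))"

lemma tent_nonneg: "0 \<le> tent c L \<tau> \<sigma> z"
  by (simp add: tent_def)

lemma tent_le:
  assumes "0 \<le> L" "L * (\<sigma> - \<tau>) \<le> 1 / 4"
  shows "tent c L \<tau> \<sigma> z \<le> 3 / 4" "tent c L \<tau> \<sigma> z \<noteq> 0 \<Longrightarrow> \<bar>fst z - c\<bar> \<le> 3 / 4"
proof -
  have "L * (min (snd z) \<sigma> - \<tau>) \<le> L * (\<sigma> - \<tau>)" using assms by (intro mult_left_mono) auto
  then have *: "L * (min (snd z) \<sigma> - \<tau>) \<le> 1 / 4" using assms by linarith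
  show "tent c L \<tau> \<sigma> z \<le> 3 / 4"
    unfolding tent_def using * abs_ge_zero[of "fst z - c"] by (intro max.boundedI) linarith+
  show "\<bar>fst z - c\<bar> \<le> 3 / 4" if "tent c L \<tau> \<sigma> z \<noteq> 0"
    using * that by (simp add: tent_def max_def split: if_splits)
qed

lemma tent_measurable [measurable]: "tent c L \<tau> \<sigma> \<in> borel_measurable borel"
  unfolding tent_def[abs_def] by (intro borel_measurable_continuous_onI continuous_intros)

lemma tent_space_diff: "\<bar>tent c L \<tau> \<sigma> (z + (d, 0)) - tent c L \<tau> \<sigma> z\<bar> \<le> \<bar>d\<bar>"
proof -
  have max_diff: "\<bar>max 0 a - max 0 b\<bar> \<le> \<bar>a - b\<bar>" for a b :: real by linarith
  show ?thesis
    unfolding tent_def by (rule order_trans[OF max_diff]) simp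
qed

text \<open>The summand \<open>dx\<close> in \<open>L * dt\<close> absorbs the cell at the edge of the support.\<close>

lemma tent_time_diff:
  assumes "0 < dx" "0 < dt" "0 \<le> L\<^sub>0" "L * dt = L\<^sub>0 * dt + dx" and "snd z + dt \<le> \<sigma>"
  shows "L\<^sub>0 * dt / dx * \<bar>tent c L \<tau> \<sigma> (z + (dx, 0)) - tent c L \<tau> \<sigma> z\<bar>
    \<le> tent c L \<tau> \<sigma> (z + (0, dt)) - tent c L \<tau> \<sigma> z"
proof -
  define a where "a = 1 / 2 - \<bar>fst z - c\<bar> + L * (snd z - \<tau>)"
  define a' where "a' = 1 / 2 - \<bar>fst z + dx - c\<bar> + L * (snd z - \<tau>)"
  have t: "tent c L \<tau> \<sigma> z = max 0 a" "tent c L \<tau> \<sigma> (z + (dx, 0)) = max 0 a'"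
    "tent c L \<tau> \<sigma> (z + (0, dt)) = max 0 (a + (L\<^sub>0 * dt + dx))"
    using assms by (simp_all add: tent_def a_def a'_def assms(4)[symmetric] algebra_simps)
  have aa: "\<bar>a' - a\<bar> \<le> dx" using assms(1) unfolding a_def a'_def by linarith
  have Ldt: "0 \<le> L\<^sub>0 * dt" using assms by simp
  have "L\<^sub>0 * dt / dx * \<bar>max 0 a' - max 0 a\<bar> \<le> L\<^sub>0 * dt / dx * dx"
    using assms aa Ldt by (intro mult_left_mono) auto
  also have "\<dots> = L\<^sub>0 * dt" using assms by simp
  finally have 1: "L\<^sub>0 * dt / dx * \<bar>max 0 a' - max 0 a\<bar> \<le> L\<^sub>0 * dt" .
  show ?thesis
  proof (cases "a \<le> - dx")
    case True
    then have "max 0 a' = 0" "max 0 a = 0" using aa assms(1) by auto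
    then show ?thesis unfolding t by simp
  next
    case False
    then have "L\<^sub>0 * dt \<le> max 0 (a + (L\<^sub>0 * dt + dx)) - max 0 a" using Ldt assms(1) by auto
    then show ?thesis unfolding t using 1 by linarith
  qed
qed

context mpe_limit
begin

section \<open>Mass balance in a widening tent\<close>

lemma U_shift_le:
  assumes "\<forall>l. \<forall>z\<in>slab X (T + 1). U l z \<le> M" "\<Delta>t l \<le> 1" "z \<in> slab X T"
  shows "U l (z + et l) \<le> M" "U l z \<le> M"
proof -
  have "z + et l \<in> slab X (T + 1)" "z \<in> slab X (T + 1)"
    using assms dt_pos[of l] by (auto simp: mem_slab et_def)
  then show "U l (z + et l) \<le> M" "U l z \<le> M" using assms by blast+
qed

lemma U_et_integrable:
  assumes "\<forall>l. \<forall>z\<in>slab X (T + 1). U l z \<le> M" "\<Delta>t l \<le> 1"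
  shows "set_integrable lborel (slab X T) (\<lambda>z. U l (z + et l))"
  by (rule set_integrable_slab[where B = M])
     (use U_shift_le[OF assms] U_pos in \<open>auto simp: abs_of_pos\<close>)

lemma f_w_integrable:
  assumes L\<^sub>0: "\<And>a. a \<in> {0..M} \<Longrightarrow> \<bar>f a - f 0\<bar> \<le> L\<^sub>0 * a" and M: "\<forall>l. \<forall>z\<in>slab X T. U l z \<le> M"
  shows "set_integrable lborel (slab X T) (\<lambda>z. f (w z))"
proof -
  have "AE z in lborel. z \<in> slab X T \<longrightarrow> norm (f (w z)) \<le> \<bar>f 0\<bar> + \<bar>L\<^sub>0\<bar> * M"
    using w_bounded[OF M]
  proof eventually_elim
    case (elim z)
    show ?case
    proof
      assume "z \<in> slab X T"
      with elim have "0 < w z" "w z \<le> M" by auto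
      then have "\<bar>f (w z) - f 0\<bar> \<le> L\<^sub>0 * w z" "L\<^sub>0 * w z \<le> \<bar>L\<^sub>0\<bar> * M"
        using L\<^sub>0 by (auto intro: mult_mono)
      then show "norm (f (w z)) \<le> \<bar>f 0\<bar> + \<bar>L\<^sub>0\<bar> * M" by simp
    qed
  qed
  then show ?thesis
    unfolding set_integrable_def using emeasure_slab[of X T] by (intro integrableI_bounded_set_indicator) auto
qed

text \<open>The one-sided balance is tested with \<rho> times the tent and summed by parts. Through
  the sloping sides the flux carries at most \<open>L\<^sub>0\<close> times the density, up to
  errors, and by \<open>tent_time_diff\<close> the growth of the tent pays for this. The increase of
  \<rho> remains as a gain, and the loss is the time step times an error in the mean.\<close>

lemma mass_inequality:
  fixes X T c L\<^sub>0 M G h \<tau> N :: real and \<rho> :: "real \<Rightarrow> real" and l :: nat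
  defines "L \<equiv> L\<^sub>0 + 1 / r" and "X \<equiv> \<bar>c\<bar> + 3" and "Um \<equiv> \<lambda>z. clamp_to M (U l z)"
  defines "\<psi>t \<equiv> tent c L \<tau> (\<tau> + 2 * h)"
  assumes \<rho>: "mono \<rho>" "\<And>t. 0 \<le> \<rho> t" "\<And>t. \<rho> t \<le> 1"
    and L\<^sub>0: "0 \<le> L\<^sub>0" "\<And>a. a \<in> {0..M} \<Longrightarrow> \<bar>f a - f 0\<bar> \<le> L\<^sub>0 * a"
    and M: "0 < M" "\<forall>l. \<forall>z\<in>slab X (T + 1). U l z \<le> M"
    and G: "0 < G" "\<forall>z\<in>slab X T. \<bar>flx l z\<bar> \<le> G"
    and h: "0 < h" "L * h = 1 / 8" and dx: "\<Delta>x l \<le> 1" and dt: "\<Delta>t l \<le> 1" "\<Delta>t l \<le> h"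
    and N: "0 \<le> N" "N \<le> \<tau> + h" "N \<le> T"
  shows "(LINT z:UNIV \<times> {0..<\<Delta>t l}|lborel. \<rho> (snd z) * \<psi>t z * Um z)
      + (LINT z:UNIV \<times> {0..<N}|lborel. Um (z + et l) * \<psi>t z * (\<rho> (snd z + \<Delta>t l) - \<rho> (snd z)))
      - \<Delta>t l * (LINT z:slab X T|lborel. \<bar>\<bar>clamp_to G (F l z) - f (w z)\<bar> + \<bar>L\<^sub>0 * (w z - U l (z + et l))\<bar>\<bar>)
      \<le> (LINT z:UNIV \<times> {N..<N + \<Delta>t l}|lborel. \<rho> (snd z) * \<psi>t z * Um z)"
proof -
  let ?d = "\<Delta>t l"
  let ?S = "UNIV \<times> {0..<N} :: (real \<times> real) set"
  define \<Phi> where "\<Phi> z = \<rho> (snd z) * \<psi>t z" for z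
  \<comment> \<open>Only differences of \<open>H\<close> enter, so a constant may be subtracted;
    after subtracting \<open>f 0\<close> the limit flux is at most \<open>L\<^sub>0 * w\<close> in
    modulus.\<close>
  define H where "H z = clamp_to G (F l z) - f 0" for z
  define err where "err z = \<bar>clamp_to G (F l z) - f (w z)\<bar> + \<bar>L\<^sub>0 * (w z - U l (z + et l))\<bar>" for z
  note d_pos = dt_pos[of l] and x_pos = steps(1)[of l]
  have L: "0 < L" using L\<^sub>0 steps(3) by (simp add: L_def add_nonneg_pos)
  have Lh: "0 \<le> L" "L * (\<tau> + 2 * h - \<tau>) \<le> 1 / 4" using L h by (auto simp: algebra_simps)
  \<comment> \<open>The summand \<open>1 / r\<close> of \<open>L\<close> amounts to exactly one cell
    width per time step.\<close>
  have Ld: "L * ?d = L\<^sub>0 * ?d + \<Delta>x l"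
    using steps(3) steps(4)[of l] by (simp add: L_def algebra_simps)
  have rd: "?d / \<Delta>x l = r" using x_pos steps(4)[of l] by simp
  have \<psi>t_bnd: "0 \<le> \<psi>t z" "\<psi>t z \<le> 3 / 4" "\<psi>t z \<noteq> 0 \<Longrightarrow> \<bar>fst z - c\<bar> \<le> 3 / 4" for z
    unfolding \<psi>t_def using tent_nonneg tent_le[OF Lh] by auto
  have [measurable]: "\<rho> \<in> borel_measurable borel" by (rule borel_measurable_mono[OF \<rho>(1)])
  have [measurable]: "\<psi>t \<in> borel_measurable borel" unfolding \<psi>t_def by measurable
  have \<Phi>_meas [measurable]: "\<Phi> \<in> borel_measurable borel" unfolding \<Phi>_def by measurable
  have Um_meas [measurable]: "Um \<in> borel_measurable borel" unfolding Um_def by measurable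
  have H_meas [measurable]: "H \<in> borel_measurable borel" unfolding H_def by measurable
  have err_meas [measurable]: "err \<in> borel_measurable borel" unfolding err_def by measurable
  have \<Phi>_bnd: "\<bar>\<Phi> z\<bar> \<le> 3 / 4" for z
    using mult_mono[OF \<rho>(3)[of "snd z"] \<psi>t_bnd(2)[of z]] \<psi>t_bnd(1)[of z] \<rho>(2)[of "snd z"]
    by (simp add: \<Phi>_def abs_mult)
  have Um_bnd: "\<bar>Um z\<bar> \<le> M" for z unfolding Um_def using M by (intro clamp_to_bounded) auto
  have Um_nonneg: "0 \<le> Um z" for z using U_pos[of l z] M by (simp add: Um_def clamp_to_def)
  have H_bnd: "\<bar>H z\<bar> \<le> G + \<bar>f 0\<bar>" for z
    using clamp_to_bounded[of G "F l z"] G unfolding H_def by linarith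
  have \<Phi>_supp: "\<bar>fst z\<bar> \<le> \<bar>c\<bar> + 1" if "\<Phi> z \<noteq> 0" for z
  proof -
    have "\<bar>fst z - c\<bar> \<le> 3 / 4" using \<psi>t_bnd(3)[of z] that by (auto simp: \<Phi>_def)
    then show ?thesis by linarith
  qed
  have Um_eq: "Um z = U l z" "Um (z + et l) = U l (z + et l)" if "z \<in> slab X T" for z
    using U_shift_le[OF M(2) dt(1) that] U_pos[of l z] U_pos[of l "z + et l"]
    by (simp_all add: Um_def clamp_to_id)
  have \<Phi>_supp': "\<forall>z. \<Phi> z \<noteq> 0 \<longrightarrow> \<bar>fst z\<bar> \<le> \<bar>c\<bar> + 1" using \<Phi>_supp by blast
  note parts = integral_by_parts_shift[OF \<Phi>_meas Um_meas H_meas \<Phi>_bnd Um_bnd H_bnd \<Phi>_supp' less_imp_le[OF d_pos] N(1),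
      of r "\<Delta>x l", folded ex_def et_def]
  \<comment> \<open>Here the scheme enters: with the flux cut off, \<open>U_et_clamp\<close> leaves
    a nonnegative residual.\<close>
  have "0 \<le> (LINT z:?S|lborel. \<Phi> z * (Um (z + et l) - Um z + r * (H z - H (z - ex l))))"
    unfolding set_lebesgue_integral_def
  proof (rule Bochner_Integration.integral_nonneg)
    fix z :: "real \<times> real"
    show "0 \<le> indicator ?S z *\<^sub>R (\<Phi> z * (Um (z + et l) - Um z + r * (H z - H (z - ex l))))"
    proof (cases "z \<in> ?S \<and> \<Phi> z \<noteq> 0")
      case True
      then have z: "z \<in> slab X T" "z - ex l \<in> slab X T"
        using \<Phi>_supp[of z] N dx x_pos by (auto simp: mem_slab X_def ex_def abs_le_iff)
      have "0 \<le> U l (z + et l) - U l z + r * (clamp_to G (F l z) - clamp_to G (F l (z - ex l)))"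
        by (rule U_et_clamp) (use z G in \<open>auto simp: mem_slab\<close>)
      then have "0 \<le> Um (z + et l) - Um z + r * (H z - H (z - ex l))"
        unfolding Um_eq[OF z(1)] H_def by simp
      then show ?thesis using \<rho>(2) \<psi>t_bnd(1)[of z] by (simp add: \<Phi>_def indicator_def)
    qed (auto split: split_indicator)
  qed
  then have 1: "(LINT z:UNIV \<times> {0..<?d}|lborel. \<Phi> z * Um z)
      + (LINT z:?S|lborel. Um (z + et l) * (\<Phi> (z + et l) - \<Phi> z) + r * (H z * (\<Phi> (z + ex l) - \<Phi> z)))
      \<le> (LINT z:UNIV \<times> {N..<N + ?d}|lborel. \<Phi> z * Um z)"
    using parts(1) by linarith
  let ?gain = "\<lambda>z. Um (z + et l) * \<psi>t z * (\<rho> (snd z + ?d) - \<rho> (snd z))"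
  have int_gain: "set_integrable lborel ?S ?gain"
    unfolding set_integrable_def
  proof (rule integrable_bounded_support[where B = "M * 1 * 1" and a = "(- X, 0)" and b = "(X, N)"])
    show "\<bar>indicator ?S z *\<^sub>R ?gain z\<bar> \<le> M * 1 * 1" for z
    proof -
      have "\<bar>\<rho> (snd z + ?d) - \<rho> (snd z)\<bar> \<le> 1"
        using \<rho>(2)[of "snd z"] \<rho>(3)[of "snd z"] \<rho>(2)[of "snd z + ?d"] \<rho>(3)[of "snd z + ?d"] by linarith
      moreover have "\<bar>\<psi>t z\<bar> \<le> 1" using \<psi>t_bnd[of z] by linarith
      ultimately have "\<bar>?gain z\<bar> \<le> M * 1 * 1"
        unfolding abs_mult using M Um_bnd by (intro mult_mono) auto
      then show ?thesis using M by (auto split: split_indicator)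
    qed
    show "z \<in> cbox (- X, 0) (X, N)" if "indicator ?S z *\<^sub>R ?gain z \<noteq> 0" for z
    proof -
      have "z \<in> ?S" "\<psi>t z \<noteq> 0" using that by (auto simp: indicator_def split: if_splits)
      moreover from this have "\<bar>fst z\<bar> \<le> X" using \<psi>t_bnd(3)[of z] unfolding X_def by linarith
      ultimately show ?thesis by (cases z) (auto simp: cbox_Pair_eq)
    qed
  qed measurable
  have int_err: "set_integrable lborel (slab X T) err"
  proof -
    have "set_integrable lborel (slab X T) (\<lambda>z. clamp_to G (F l z))"
      by (rule set_integrable_slab[where B = G]) (use G clamp_to_bounded in auto)
    moreover have "set_integrable lborel (slab X T) (\<lambda>z. f (w z))"
      by (rule f_w_integrable[OF L\<^sub>0(2)]) (use M(2) in \<open>auto simp: mem_slab\<close>)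
    moreover have "set_integrable lborel (slab X T) (\<lambda>z. U l (z + et l))"
      by (rule U_et_integrable[OF M(2) dt(1)])
    ultimately show ?thesis
      unfolding err_def
      by (intro set_integral_add set_integrable_abs set_integral_diff set_integrable_mult_right w_integrable)
  qed
  have int_err': "integrable lborel (\<lambda>z. indicator (slab X T) z * err z)"
    using int_err by (simp add: set_integrable_def)
  have "(\<integral>z. indicator ?S z * ?gain z - ?d * (indicator (slab X T) z * err z) \<partial>lborel)
      \<le> (\<integral>z. indicator ?S z *\<^sub>R (Um (z + et l) * (\<Phi> (z + et l) - \<Phi> z) + r * (H z * (\<Phi> (z + ex l) - \<Phi> z))) \<partial>lborel)"
  proof (rule integral_mono_AE)
    show "integrable lborel (\<lambda>z. indicator ?S z * ?gain z - ?d * (indicator (slab X T) z * err z))"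
      using int_gain int_err' by (intro Bochner_Integration.integrable_diff integrable_mult_right) (auto simp: set_integrable_def)
    show "integrable lborel (\<lambda>z. indicator ?S z *\<^sub>R (Um (z + et l) * (\<Phi> (z + et l) - \<Phi> z) + r * (H z * (\<Phi> (z + ex l) - \<Phi> z))))"
      using parts(2) by (simp add: set_integrable_def)
    have "AE z in lborel. z \<in> slab X T \<longrightarrow> w z \<in> {0<..M}"
      by (rule w_bounded) (use M(2) in \<open>auto simp: mem_slab\<close>)
    then show "AE z in lborel. indicator ?S z * ?gain z - ?d * (indicator (slab X T) z * err z) \<le>
      indicator ?S z *\<^sub>R (Um (z + et l) * (\<Phi> (z + et l) - \<Phi> z) + r * (H z * (\<Phi> (z + ex l) - \<Phi> z)))"
    proof eventually_elim
      case (elim z)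
      have err_nonneg: "0 \<le> err z" by (simp add: err_def)
      show ?case
      proof (cases "z \<in> ?S")
        case True
        define u where "u = Um (z + et l)"
        define s0 where "s0 = \<psi>t z"
        define s1 where "s1 = \<psi>t (z + ex l)"
        define s2 where "s2 = \<psi>t (z + et l)"
        define \<rho>0 where "\<rho>0 = \<rho> (snd z)"
        define \<rho>1 where "\<rho>1 = \<rho> (snd z + ?d)"
        have \<Phi>s: "\<Phi> z = \<rho>0 * s0" "\<Phi> (z + ex l) = \<rho>0 * s1" "\<Phi> (z + et l) = \<rho>1 * s2"
          by (simp_all add: \<Phi>_def s0_def s1_def s2_def \<rho>0_def \<rho>1_def ex_def et_def)
        have \<rho>01: "0 \<le> \<rho>0" "\<rho>0 \<le> \<rho>1" "\<rho>0 \<le> 1"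
          using \<rho> d_pos by (auto simp: \<rho>0_def \<rho>1_def mono_def)
        have u0: "0 \<le> u" by (simp add: u_def Um_nonneg)
        have snd_le: "snd z + ?d \<le> \<tau> + 2 * h" using True N dt by (cases z) simp
        have grow: "r * L\<^sub>0 * \<bar>s1 - s0\<bar> \<le> s2 - s0"
          using tent_time_diff[OF x_pos d_pos L\<^sub>0(1) Ld snd_le, of c \<tau>]
          by (simp add: s0_def s1_def s2_def \<psi>t_def ex_def et_def rd[symmetric] mult.commute)
        have lip: "\<bar>s1 - s0\<bar> \<le> \<Delta>x l"
          using tent_space_diff[of c L \<tau> "\<tau> + 2 * h" z "\<Delta>x l"] x_pos
          by (simp add: s0_def s1_def \<psi>t_def ex_def)
        have main: "- ?d * (indicator (slab X T) z * err z) - \<rho>1 * u * (s2 - s0) \<le> r * (H z * (\<rho>0 * (s1 - s0)))"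
        \<comment> \<open>Without an increment of the tent the flux term vanishes. Otherwise
          \<open>z\<close> is close to the support of the tent, hence in the slab, where the bound
          on \<open>w\<close> and the error term are available.\<close>
        proof (cases "s1 = s0")
          case True
          have "0 \<le> \<rho>1 * u * (s2 - s0)" using grow True \<rho>01 u0 by simp
          moreover have "0 \<le> ?d * (indicator (slab X T) z * err z)" using d_pos err_nonneg by simp
          ultimately show ?thesis using True by simp
        next
          case False
          then have "\<psi>t z \<noteq> 0 \<or> \<psi>t (z + ex l) \<noteq> 0" unfolding s0_def s1_def by metis
          then have "\<bar>fst z - c\<bar> \<le> 3 / 4 \<or> \<bar>fst z + \<Delta>x l - c\<bar> \<le> 3 / 4"
            using \<psi>t_bnd(3)[of z] \<psi>t_bnd(3)[of "z + ex l"] by (auto simp only: ex_def fst_add fst_conv)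
          then have near: "\<bar>fst z - c\<bar> \<le> 2" using x_pos dx by linarith
          have "\<bar>fst z\<bar> \<le> X" using near unfolding X_def by linarith
          then have zs: "z \<in> slab X T" using True N \<open>z \<in> ?S\<close> by (cases z) (auto simp: mem_slab)
          then have wz: "w z \<in> {0<..M}" using elim by simp
          have "\<bar>f (w z) - f 0\<bar> \<le> L\<^sub>0 * w z" using wz by (intro L\<^sub>0) auto
          moreover have "L\<^sub>0 * w z \<le> \<bar>L\<^sub>0 * (w z - U l (z + et l))\<bar> + L\<^sub>0 * u"
            using Um_eq(2)[OF zs] by (simp add: u_def right_diff_distrib)
          ultimately have Hle: "\<bar>H z\<bar> \<le> err z + L\<^sub>0 * u" unfolding err_def H_def by linarith
          have "\<bar>r * (H z * (\<rho>0 * (s1 - s0)))\<bar> = r * \<bar>H z\<bar> * \<rho>0 * \<bar>s1 - s0\<bar>"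
            using steps(3) \<rho>01 by (simp add: abs_mult)
          also have "\<dots> \<le> r * (err z + L\<^sub>0 * u) * \<rho>0 * \<bar>s1 - s0\<bar>"
            using steps(3) \<rho>01 Hle by (intro mult_right_mono mult_left_mono) auto
          also have "\<dots> = \<rho>0 * (r * err z * \<bar>s1 - s0\<bar>) + \<rho>0 * (u * (r * L\<^sub>0 * \<bar>s1 - s0\<bar>))"
            by (simp add: algebra_simps)
          finally have "\<bar>r * (H z * (\<rho>0 * (s1 - s0)))\<bar>
            \<le> \<rho>0 * (r * err z * \<bar>s1 - s0\<bar>) + \<rho>0 * (u * (r * L\<^sub>0 * \<bar>s1 - s0\<bar>))" .
          moreover have "\<rho>0 * (r * err z * \<bar>s1 - s0\<bar>) \<le> 1 * (r * err z * \<Delta>x l)"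
            using steps(3) \<rho>01 err_nonneg lip by (intro mult_mono mult_left_mono mult_nonneg_nonneg) auto
          moreover have "1 * (r * err z * \<Delta>x l) = ?d * err z" using steps(4)[of l] by simp
          moreover have "\<rho>0 * (u * (r * L\<^sub>0 * \<bar>s1 - s0\<bar>)) \<le> \<rho>1 * (u * (s2 - s0))"
            using \<rho>01 u0 grow steps(3) L\<^sub>0 by (intro mult_mono mult_left_mono mult_nonneg_nonneg) auto
          moreover have "\<rho>1 * (u * (s2 - s0)) = \<rho>1 * u * (s2 - s0)" by simp
          ultimately have "\<bar>r * (H z * (\<rho>0 * (s1 - s0)))\<bar> \<le> ?d * err z + \<rho>1 * u * (s2 - s0)"
            by linarith
          then show ?thesis using zs by (simp add: abs_le_iff)
        qed
        have "u * (\<rho>1 * s2 - \<rho>0 * s0) = \<rho>1 * u * (s2 - s0) + u * s0 * (\<rho>1 - \<rho>0)"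
          by (simp add: algebra_simps)
        moreover have "\<rho>0 * s1 - \<rho>0 * s0 = \<rho>0 * (s1 - s0)" by (simp add: algebra_simps)
        moreover have "indicator ?S z = (1::real)" using True by simp
        ultimately show ?thesis
          using main unfolding \<Phi>s u_def[symmetric] s0_def[symmetric] \<rho>0_def[symmetric] \<rho>1_def[symmetric]
          by simp
      next
        case False
        have "0 \<le> ?d * (indicator (slab X T) z * err z)" using d_pos err_nonneg by simp
        then show ?thesis using False by simp
      qed
    qed
  qed
  also have "(\<integral>z. indicator ?S z * ?gain z - ?d * (indicator (slab X T) z * err z) \<partial>lborel)
     = (LINT z:?S|lborel. ?gain z) - ?d * (LINT z:slab X T|lborel. err z)"
    using int_gain int_err' by (subst Bochner_Integration.integral_diff) (auto simp: set_integrable_def set_lebesgue_integral_def)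
  finally have "(LINT z:?S|lborel. ?gain z) - ?d * (LINT z:slab X T|lborel. err z)
     \<le> (LINT z:?S|lborel. Um (z + et l) * (\<Phi> (z + et l) - \<Phi> z) + r * (H z * (\<Phi> (z + ex l) - \<Phi> z)))"
    by (simp add: set_lebesgue_integral_def)
  moreover have "\<bar>err z\<bar> = err z" for z by (simp add: err_def)
  ultimately show ?thesis
    using 1 unfolding \<Phi>_def[symmetric] err_def[symmetric] by simp
qed

end

lemma integral_pos:
  fixes f :: "'a::euclidean_space \<Rightarrow> real"
  assumes "integrable lborel f" "AE z in lborel. 0 \<le> f z" "AE z in lborel. z \<in> Q \<longrightarrow> 0 < f z"
    and Q: "Q \<in> sets lborel" "emeasure lborel Q \<noteq> 0"
  shows "0 < (\<integral>z. f z \<partial>lborel)"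
proof -
  have "(\<integral>z. f z \<partial>lborel) \<noteq> 0"
  proof
    assume "(\<integral>z. f z \<partial>lborel) = 0"
    then have "AE z in lborel. f z = 0"
      using integral_nonneg_eq_0_iff_AE[OF assms(1,2)] by simp
    with assms(3) have "AE z in lborel. z \<notin> Q" by eventually_elim auto
    then show False using Q AE_iff_null_sets[of Q lborel] by (auto dest: null_setsD1)
  qed
  moreover have "0 \<le> (\<integral>z. f z \<partial>lborel)" using assms(2) by (rule integral_nonneg_AE)
  ultimately show ?thesis by simp
qed

lemma emeasure_rectangle:
  assumes "a \<le> b" "c \<le> d"
  shows "emeasure lborel ({a..b} \<times> {c..d} :: (real \<times> real) set) = ennreal ((b - a) * (d - c))"
  using assms by (simp add: lborel_prod[symmetric] lborel.emeasure_pair_measure_Times ennreal_mult)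

text \<open>If \<open>v\<close> stayed below \<open>\<gamma> / 2\<close> on the relevant rectangle
  of area \<open>2 * d\<close>, the integral would be at most
  \<open>3 / 4 * (\<gamma> / 2) * (2 * d)\<close>, which is less than
  \<open>\<gamma> * d\<close>.\<close>

lemma ex_point_of_integral_ge:
  fixes a v :: "real \<times> real \<Rightarrow> real"
  assumes [measurable]: "a \<in> borel_measurable borel" "v \<in> borel_measurable borel"
    and a: "\<And>z. 0 \<le> a z" "\<And>z. a z \<le> 3 / 4" "\<And>z. a z \<noteq> 0 \<Longrightarrow> \<bar>fst z - c\<bar> \<le> 1"
    and v: "\<And>z. 0 \<le> v z" "\<And>z. v z \<le> M"
    and pos: "0 < \<gamma>" "0 < d" and ge: "\<gamma> * d \<le> (LINT z:UNIV \<times> {N..<N + d}|lborel. a z * v z)"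
  shows "\<exists>z. \<bar>fst z - c\<bar> \<le> 1 \<and> N \<le> snd z \<and> snd z < N + d \<and> \<gamma> / 2 \<le> v z"
proof (rule ccontr)
  assume no: "\<not> ?thesis"
  let ?S = "UNIV \<times> {N..<N + d} :: (real \<times> real) set"
  let ?Q = "{c - 1..c + 1} \<times> {N..N + d}"
  have [measurable]: "?S \<in> sets borel" "?Q \<in> sets borel" by (auto simp: borel_Times)
  have Q: "emeasure lborel ?Q = ennreal (2 * d)" using emeasure_rectangle[of "c - 1" "c + 1" N "N + d"] pos by simp
  have le: "indicator ?S z *\<^sub>R (a z * v z) \<le> 3 / 4 * (\<gamma> / 2) * indicator ?Q z" for z
  proof (cases "z \<in> ?S \<and> a z \<noteq> 0")
    case True
    then have zc: "\<bar>fst z - c\<bar> \<le> 1" "N \<le> snd z" "snd z < N + d" using a(3)[of z] by auto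
    then have "v z \<le> \<gamma> / 2" using no by force
    then have "a z * v z \<le> 3 / 4 * (\<gamma> / 2)" using a v pos by (intro mult_mono) auto
    moreover have "z \<in> ?Q" using zc by (cases z) (auto simp: abs_le_iff)
    ultimately show ?thesis using True by simp
  next
    case False
    then have "indicator ?S z *\<^sub>R (a z * v z) = 0" by (auto simp: indicator_def)
    moreover have "0 \<le> 3 / 4 * (\<gamma> / 2) * indicator ?Q z" using pos by simp
    ultimately show ?thesis by linarith
  qed
  have "(LINT z:?S|lborel. a z * v z) \<le> (\<integral>z. 3 / 4 * (\<gamma> / 2) * indicator ?Q z \<partial>lborel)"
    unfolding set_lebesgue_integral_def
  proof (rule integral_mono)
    show "integrable lborel (\<lambda>z. indicator ?S z *\<^sub>R (a z * v z))"
    proof (rule Bochner_Integration.integrable_bound)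
      show "integrable lborel (\<lambda>z. 3 / 4 * (\<gamma> / 2) * indicator ?Q z)"
        using Q by (intro integrable_mult_right integrable_real_indicator) auto
      show "AE z in lborel. norm (indicator ?S z *\<^sub>R (a z * v z)) \<le> norm (3 / 4 * (\<gamma> / 2) * indicator ?Q z)"
      proof (rule AE_I2)
        fix z
        have "0 \<le> indicator ?S z *\<^sub>R (a z * v z)" using a(1) v(1) by simp
        then show "norm (indicator ?S z *\<^sub>R (a z * v z)) \<le> norm (3 / 4 * (\<gamma> / 2) * indicator ?Q z)"
          using le[of z] unfolding real_norm_def by linarith
      qed
    qed measurable
    show "integrable lborel (\<lambda>z. 3 / 4 * (\<gamma> / 2) * indicator ?Q z)"
      using Q by (intro integrable_mult_right integrable_real_indicator) auto
  qed (rule le)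
  also have "\<dots> = 3 / 4 * (\<gamma> / 2) * (2 * d)"
    using Q pos by (simp add: measure_def)
  also have "\<dots> < \<gamma> * d" using pos by simp
  finally show False using ge by simp
qed

context mpe_limit
begin

section \<open>Positive values near every point at every time\<close>

lemma L1_null_U_et:
  assumes "0 < X" "0 < T"
  shows "L1_null X T (\<lambda>l z. U l (z + et l) - w z)"
proof (rule L1_null_mono)
  show "L1_null X T (\<lambda>l z. \<bar>U l (z + et l) - U l z\<bar> + \<bar>U l z - w z\<bar>)"
    by (intro L1_null_add L1_null_time_step conv assms) measurable
qed (intro always_eventually allI AE_I2 impI, linarith)

lemma eventually_flx: 
  assumes "\<forall>\<^sub>F l in sequentially. \<forall>z\<in>slab X T. \<bar>flx l z\<bar> \<le> G" "G \<le> C"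
  shows "\<forall>\<^sub>F l in sequentially. \<forall>z\<in>slab X T. \<bar>flx l z\<bar> \<le> C"
  using assms(1) by eventually_elim (use assms(2) in force)

text \<open>The balance delivers its mass on a strip of height one time step; if \<open>N\<close> is
  a time level, \<open>U l\<close> does not vary in time across that strip.\<close>

abbreviation hits :: "real \<Rightarrow> nat \<Rightarrow> real \<Rightarrow> real \<Rightarrow> bool" where
  "hits c l N \<gamma> \<equiv> \<exists>z. \<bar>fst z - c\<bar> \<le> 1 \<and> N \<le> snd z \<and> snd z < N + \<Delta>t l \<and> \<gamma> \<le> U l z"

text \<open>
  The mass in a widening tent can only decrease by the vanishing error of the flux, because the excess
  of the Patankar flux over the numerical flux only adds mass. So the positive mass that the limit, or
  \<open>\<psi>\<close>, has at an earlier time prevents a vacuum.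
\<close>

lemma no_vacuum:
  assumes T: "0 < T"
  shows "\<exists>\<kappa>>0. \<forall>\<^sub>F l in sequentially. \<forall>t\<in>{0..T}. \<exists>y\<in>{c-1..c+1}. \<kappa> \<le> U l (y, t)"
proof -
  define X where "X = \<bar>c\<bar> + 3"
  have X: "0 < X" by (simp add: X_def)
  have "0 < T + 1" using T by simp
  with U_bounded[OF X] obtain M where M: "0 < M" "\<forall>l. \<forall>z\<in>slab X (T + 1). U l z \<le> M" by blast
  from flx_bounded[OF X T] obtain G where G: "0 < G" "\<forall>\<^sub>F l in sequentially. \<forall>z\<in>slab X T. \<bar>flx l z\<bar> \<le> G" by blast
  from consistent_flux_lipschitz_at_0[OF flux, of M]
  obtain L\<^sub>0 where L0: "0 \<le> L\<^sub>0" "\<And>a. a \<in> {0..M} \<Longrightarrow> \<bar>f a - f 0\<bar> \<le> L\<^sub>0 * a" by blast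
  define L where "L = L\<^sub>0 + 1 / r"
  have L: "0 < L" using L0(1) steps(3) by (simp add: L_def add_nonneg_pos)
  \<comment> \<open>During \<open>2 * h\<close> the half-width of the tent grows by 1/4, from 1/2 at
    time \<tau> to 3/4.\<close>
  define h where "h = 1 / (8 * L)"
  have h: "0 < h" "L * h = 1 / 8" using L by (simp_all add: h_def)
  define E where "E l = (LINT z:slab X T|lborel. \<bar>\<bar>clamp_to G (F l z) - f (w z)\<bar> + \<bar>L\<^sub>0 * (w z - U l (z + et l))\<bar>\<bar>)" for l
  have E: "E \<longlonglongrightarrow> 0"
  proof -
    have "L1_null X T (\<lambda>l z. L\<^sub>0 * (w z - U l (z + et l)))"
    proof (rule L1_null_mono)
      show "L1_null X T (\<lambda>l z. L\<^sub>0 * (U l (z + et l) - w z))"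
        by (intro L1_null_cmult L1_null_U_et X T) measurable
    qed (simp add: abs_mult abs_minus_commute)
    then have "L1_null X T (\<lambda>l z. \<bar>clamp_to G (F l z) - f (w z)\<bar> + \<bar>L\<^sub>0 * (w z - U l (z + et l))\<bar>)"
      by (intro L1_null_add L1_null_clamp_F X T G) measurable
    from L1_null_integral_tendsto[OF this] show ?thesis
      unfolding E_def[abs_def] by measurable
  qed
  define tn where "tn \<tau> = tent c L \<tau> (\<tau> + 2 * h)" for \<tau>
  have tn: "0 \<le> tn \<tau> z" "tn \<tau> z \<le> 3 / 4" "tn \<tau> z \<noteq> 0 \<Longrightarrow> \<bar>fst z - c\<bar> \<le> 3 / 4" for \<tau> z
  proof -
    have "0 \<le> L" "L * (\<tau> + 2 * h - \<tau>) \<le> 1 / 4" using L h by (auto simp: algebra_simps)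
    note tent_le[OF this]
    then show "0 \<le> tn \<tau> z" "tn \<tau> z \<le> 3 / 4" "tn \<tau> z \<noteq> 0 \<Longrightarrow> \<bar>fst z - c\<bar> \<le> 3 / 4"
      unfolding tn_def using tent_nonneg by blast+
  qed
  have tn_meas [measurable]: "tn \<tau> \<in> borel_measurable borel" for \<tau> unfolding tn_def by measurable
  have Um: "0 \<le> clamp_to M (U l z)" "clamp_to M (U l z) \<le> M" "clamp_to M (U l z) \<le> U l z" for l z
    using U_pos[of l z] M(1) by (auto simp: clamp_to_def)
  have ev: "\<forall>\<^sub>F l in sequentially. \<Delta>x l \<le> 1 \<and> \<Delta>t l \<le> 1 \<and> \<Delta>t l \<le> h / 2 \<and> (\<forall>z\<in>slab X T. \<bar>flx l z\<bar> \<le> G)"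
  proof -
    have "0 < h / 2" using h by simp
    from eventually_dx_less[OF zero_less_one] eventually_dt_less[OF zero_less_one] eventually_dt_less[OF this] G(2)
    show ?thesis by eventually_elim (simp add: less_imp_le)
  qed
  define A where "A \<rho> \<tau> l a = (LINT z:UNIV \<times> {a..<a + \<Delta>t l}|lborel. \<rho> (snd z) * tn \<tau> z * clamp_to M (U l z))"
    for \<rho> :: "real \<Rightarrow> real" and \<tau> l a
  define gain where "gain \<rho> \<tau> l N = (LINT z:UNIV \<times> {0..<N}|lborel.
      clamp_to M (U l (z + et l)) * tn \<tau> z * (\<rho> (snd z + \<Delta>t l) - \<rho> (snd z)))"
    for \<rho> :: "real \<Rightarrow> real" and \<tau> l N
  have mass: "A \<rho> \<tau> l 0 + gain \<rho> \<tau> l N - \<Delta>t l * E l \<le> A \<rho> \<tau> l N"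
    if "mono \<rho>" "\<And>t. 0 \<le> \<rho> t" "\<And>t. \<rho> t \<le> 1" "0 \<le> N" "N \<le> \<tau> + h" "N \<le> T"
      "\<Delta>x l \<le> 1 \<and> \<Delta>t l \<le> 1 \<and> \<Delta>t l \<le> h / 2 \<and> (\<forall>z\<in>slab X T. \<bar>flx l z\<bar> \<le> G)" for \<rho> \<tau> l N
    using mass_inequality[of \<rho> L\<^sub>0 M c T G l h N \<tau>] that L0 M G(1) h
    unfolding A_def gain_def tn_def E_def L_def X_def by simp
  have point: "hits c l N (\<gamma> / 2)"
    if "mono \<rho>" "\<And>t. 0 \<le> \<rho> t" "\<And>t. \<rho> t \<le> 1" "0 < \<gamma>" "\<gamma> * \<Delta>t l \<le> A \<rho> \<tau> l N" for \<rho> \<tau> l N \<gamma>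
  proof -
    have [measurable]: "\<rho> \<in> borel_measurable borel" by (rule borel_measurable_mono[OF that(1)])
    have "\<exists>z. \<bar>fst z - c\<bar> \<le> 1 \<and> N \<le> snd z \<and> snd z < N + \<Delta>t l \<and> \<gamma> / 2 \<le> clamp_to M (U l z)"
    proof (rule ex_point_of_integral_ge[where a = "\<lambda>z. \<rho> (snd z) * tn \<tau> z"])
      show "\<rho> (snd z) * tn \<tau> z \<le> 3 / 4" for z
        using mult_mono[OF that(3)[of "snd z"] tn(2)[of \<tau> z]] tn(1)[of \<tau> z] that(2)[of "snd z"] by simp
      show "\<bar>fst z - c\<bar> \<le> 1" if "\<rho> (snd z) * tn \<tau> z \<noteq> 0" for z
        using tn(3)[of \<tau> z] that by fastforce
    qed (use that Um tn dt_pos in \<open>auto simp: A_def\<close>)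
    then show ?thesis using Um(3) by (meson order_trans)
  qed
  \<comment> \<open>Time is cut into windows of length \<open>h\<close>, each with its own tent, so
    that no tent has to widen for long; finitely many windows reach \<open>T\<close>.\<close>
  have claim: "\<exists>\<gamma>>0. \<forall>\<^sub>F l in sequentially. \<forall>N. real i * h \<le> N \<longrightarrow> N \<le> real (Suc i) * h \<longrightarrow> N \<le> T \<longrightarrow>
      (hits c l N \<gamma>)" for i :: nat
  proof (cases i)
    \<comment> \<open>In the first window the mass comes from the initial values; with constant
      \<rho> the gain term is 0.\<close>
    case 0
    let ?\<rho> = "\<lambda>_::real. 1 :: real"
    have M1: "\<forall>l. \<forall>z\<in>slab X 1. U l z \<le> M" using M(2) T by (auto simp: mem_slab)
    have lip: "\<bar>tn 0 (x, t) - tn 0 (x, 0)\<bar> \<le> L * t" if "0 \<le> t" for x t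
    proof -
      have max_diff: "\<bar>max 0 a - max 0 b\<bar> \<le> \<bar>a - b\<bar>" for a b :: real by linarith
      have "\<bar>L * min t (2 * h) - L * min 0 (2 * h)\<bar> = L * min t (2 * h)" using that h L by simp
      also have "\<dots> \<le> L * t" using L by (intro mult_left_mono) auto
      finally show ?thesis unfolding tn_def tent_def by (intro order_trans[OF max_diff]) simp
    qed
    have supp: "\<bar>fst z\<bar> \<le> X" if "tn 0 z \<noteq> 0" for z
      using tn(3)[OF that] unfolding X_def by linarith
    have bnd: "\<bar>tn 0 z\<bar> \<le> 3 / 4" for z using tn[of 0 z] by simp
    note init = initial_integral_tendsto[OF tn_meas lip bnd supp X M(1) M1]
    let ?\<gamma> = "\<integral>x. tn 0 (x, 0) * \<psi>\<^sub>0 x \<partial>lborel"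
    have \<gamma>: "0 < ?\<gamma>"
    proof (rule integral_pos[where Q = "{c - 1 / 4 .. c + 1 / 4}"])
      show "AE x in lborel. 0 \<le> tn 0 (x, 0) * \<psi>\<^sub>0 x"
        using \<psi>\<^sub>0_eq by eventually_elim (use \<psi>_pos[THEN less_imp_le] tn(1) in simp)
      show "AE x in lborel. x \<in> {c - 1 / 4 .. c + 1 / 4} \<longrightarrow> 0 < tn 0 (x, 0) * \<psi>\<^sub>0 x"
        using \<psi>\<^sub>0_eq
      proof eventually_elim
        case (elim x)
        have "0 < tn 0 (x, 0)" if "\<bar>x - c\<bar> \<le> 1 / 4" using that h(1) by (simp add: tn_def tent_def)
        moreover have "\<bar>x - c\<bar> \<le> 1 / 4" if "x \<in> {c - 1 / 4 .. c + 1 / 4}"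
          using that unfolding atLeastAtMost_iff by linarith
        ultimately show ?case using elim \<psi>_pos[of x] by simp
      qed
    qed (use init(2) in auto)
    have "\<forall>\<^sub>F l in sequentially. ?\<gamma> / 2 < A ?\<rho> 0 l 0 / \<Delta>t l"
      using order_tendstoD(1)[OF init(1), of "?\<gamma> / 2"] \<gamma> by (simp add: A_def)
    moreover have "\<forall>\<^sub>F l in sequentially. E l < ?\<gamma> / 4" using order_tendstoD(2)[OF E, of "?\<gamma> / 4"] \<gamma> by simp
    ultimately have "\<forall>\<^sub>F l in sequentially. \<forall>N. real i * h \<le> N \<longrightarrow> N \<le> real (Suc i) * h \<longrightarrow> N \<le> T \<longrightarrow>
      (hits c l N (?\<gamma> / 4 / 2))"
      using ev
    proof eventually_elim
      case (elim l)
      show ?case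
      proof (intro allI impI)
        fix N assume N: "real i * h \<le> N" "N \<le> real (Suc i) * h" "N \<le> T"
        have "gain ?\<rho> 0 l N = 0" by (simp add: gain_def)
        then have "A ?\<rho> 0 l 0 - \<Delta>t l * E l \<le> A ?\<rho> 0 l N"
          using mass[of ?\<rho> N 0 l] elim(3) N 0 by (simp add: mono_def)
        moreover have "?\<gamma> / 2 * \<Delta>t l \<le> A ?\<rho> 0 l 0" using elim(1) dt_pos[of l] by (simp add: field_simps)
        moreover have "\<Delta>t l * E l \<le> \<Delta>t l * (?\<gamma> / 4)" using elim(2) dt_pos[of l] by (intro mult_left_mono) auto
        ultimately have "?\<gamma> / 4 * \<Delta>t l \<le> A ?\<rho> 0 l N" by (simp add: field_simps)
        then show "hits c l N (?\<gamma> / 4 / 2)"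
          using \<gamma> by (intro point) (auto simp: mono_def)
      qed
    qed
    then show ?thesis using \<gamma> by (intro exI[of _ "?\<gamma> / 4 / 2"]) simp
  next
    case (Suc k)
    show ?thesis
    proof (cases "real i * h \<le> T")
      case False
      then show ?thesis by (intro exI[of _ 1]) auto
    next
      case True
      define b where "b = real k * h"
      have bh: "real i * h = b + h" "0 \<le> b" using h(1) by (simp_all add: b_def Suc algebra_simps)
      \<comment> \<open>A ramp from 0 at time \<open>b\<close> to 1 at time \<open>b + h\<close>,
        the start of the window. It feeds in mass over a time interval, since convergence in the
        mean gives none at a single time.\<close>
      define \<rho> where "\<rho> t = max 0 (min 1 ((t - b) / h))" for t
      have \<rho>: "mono \<rho>" "0 \<le> \<rho> t" "\<rho> t \<le> 1" for t
        using h(1) by (auto simp: \<rho>_def mono_def divide_right_mono min.coboundedI2 max.coboundedI2 intro!: max.mono min.mono)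
      \<comment> \<open>On \<open>?Q\<close> the ramp has slope \<open>1 / h\<close> during the
        whole next time step, because \<open>\<Delta>t l \<le> h / 2\<close>, and the tent with
        \<tau> at \<open>b + h\<close> is at least 1/2 - 1/8 - 1/8 = 1/4.\<close>
      let ?Q = "{c - 1 / 8..c + 1 / 8} \<times> {b..b + h / 2}"
      have Q_meas [measurable]: "?Q \<in> sets borel" by (simp add: borel_Times)
      have Q_sub: "z \<in> slab X T" if "z \<in> ?Q" for z
        using that bh True h(1) by (cases z) (auto simp: mem_slab X_def)
      have X0T: "L1_null X T (\<lambda>l z. U l (z + et l) - w z)" by (rule L1_null_U_et[OF X T])
      have ind_meas: "(\<lambda>z. indicator ?Q z :: real) \<in> borel_measurable borel" by measurable
      have U_meas: "(\<lambda>z. U l (z + et l)) \<in> borel_measurable borel" for l by measurable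
      have lim: "(\<lambda>l. LINT z:slab X T|lborel. U l (z + et l) * indicator ?Q z) \<longlonglongrightarrow> (LINT z:slab X T|lborel. w z * indicator ?Q z)"
      proof (rule integral_mult_tendsto(1)[OF X0T ind_meas U_meas w_measurable w_integrable])
        show "\<forall>\<^sub>F l in sequentially. set_integrable lborel (slab X T) (\<lambda>z. U l (z + et l))"
          using ev by eventually_elim (use U_et_integrable[OF M(2)] in blast)
        show "\<bar>indicator ?Q z\<bar> \<le> (1::real)" for z by (simp add: indicator_def)
      qed (rule tendsto_const)
      let ?\<gamma> = "LINT z:slab X T|lborel. w z * indicator ?Q z"
      have "0 < (\<integral>z. indicator (slab X T) z *\<^sub>R (w z * indicator ?Q z) \<partial>lborel)"
      proof (rule integral_pos[where Q = ?Q])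
        have "integrable lborel (\<lambda>z. (indicator (slab X T) z *\<^sub>R w z) * indicator ?Q z)"
          using w_integrable[of X T] unfolding set_integrable_def
          by (intro integrable_real_mult_indicator) auto
        then show "integrable lborel (\<lambda>z. indicator (slab X T) z *\<^sub>R (w z * indicator ?Q z))"
          by (simp add: mult.assoc)
        show "AE z in lborel. 0 \<le> indicator (slab X T) z *\<^sub>R (w z * indicator ?Q z)"
          using w_pos by eventually_elim (auto simp: indicator_def mem_slab)
        show "AE z in lborel. z \<in> ?Q \<longrightarrow> 0 < indicator (slab X T) z *\<^sub>R (w z * indicator ?Q z)"
          using w_pos by eventually_elim (use Q_sub in \<open>auto simp: indicator_def mem_slab\<close>)
        show "emeasure lborel ?Q \<noteq> 0"
          using h(1) by (subst emeasure_rectangle) auto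
      qed auto
      then have \<gamma>: "0 < ?\<gamma>" by (simp add: set_lebesgue_integral_def)
      have "\<forall>\<^sub>F l in sequentially. ?\<gamma> / 2 < (LINT z:slab X T|lborel. U l (z + et l) * indicator ?Q z)"
        using order_tendstoD(1)[OF lim, of "?\<gamma> / 2"] \<gamma> by simp
      moreover have "\<forall>\<^sub>F l in sequentially. E l < ?\<gamma> / (16 * h)"
        using order_tendstoD(2)[OF E, of "?\<gamma> / (16 * h)"] \<gamma> h(1) by simp
      ultimately have "\<forall>\<^sub>F l in sequentially. \<forall>N. real i * h \<le> N \<longrightarrow> N \<le> real (Suc i) * h \<longrightarrow> N \<le> T \<longrightarrow>
        (hits c l N (?\<gamma> / (16 * h) / 2))"
        using ev
      proof eventually_elim
        case (elim l)
        show ?case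
        proof (intro allI impI)
          fix N assume N: "real i * h \<le> N" "N \<le> real (Suc i) * h" "N \<le> T"
          let ?\<tau> = "b + h"
          have N': "0 \<le> N" "N \<le> ?\<tau> + h" using N bh h(1) by (auto simp: algebra_simps)
          have A0: "0 \<le> A \<rho> ?\<tau> l 0"
            unfolding A_def set_lebesgue_integral_def
            by (rule Bochner_Integration.integral_nonneg) (use \<rho>(2) tn(1) Um(1) in simp)
          \<comment> \<open>The factor is the lower bound 1/4 of the tent times the increment
            \<open>\<Delta>t l / h\<close> of the ramp.\<close>
          have "\<Delta>t l / (4 * h) * (LINT z:slab X T|lborel. U l (z + et l) * indicator ?Q z) \<le> gain \<rho> ?\<tau> l N"
          proof -
            have [measurable]: "\<rho> \<in> borel_measurable borel" by (rule borel_measurable_mono[OF \<rho>(1)])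
            have Ule: "U l (z + et l) \<le> M" if "z \<in> slab X T" for z
              using U_shift_le[OF M(2) _ that] elim(3) by blast
            let ?gain = "\<lambda>z. indicator (UNIV \<times> {0..<N}) z *\<^sub>R (clamp_to M (U l (z + et l)) * tn ?\<tau> z * (\<rho> (snd z + \<Delta>t l) - \<rho> (snd z)))"
            have "(\<integral>z. \<Delta>t l / (4 * h) * (indicator (slab X T) z *\<^sub>R (U l (z + et l) * indicator ?Q z)) \<partial>lborel)
              \<le> (\<integral>z. ?gain z \<partial>lborel)"
            proof (rule integral_mono)
              show "integrable lborel (\<lambda>z. \<Delta>t l / (4 * h) * (indicator (slab X T) z *\<^sub>R (U l (z + et l) * indicator ?Q z)))"
              proof (rule integrable_mult_right, rule integrable_bounded_support[where B = M and a = "(- X, 0)" and b = "(X, T)"])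
                show "\<bar>indicator (slab X T) z *\<^sub>R (U l (z + et l) * indicator ?Q z)\<bar> \<le> M" for z
                  using Ule[of z] U_pos[of l "z + et l"] M(1) by (auto simp: indicator_def)
                show "z \<in> cbox (- X, 0) (X, T)" if "indicator (slab X T) z *\<^sub>R (U l (z + et l) * indicator ?Q z) \<noteq> 0" for z
                  using that by (auto simp: indicator_def slab_eq_cbox split: if_splits)
              qed measurable
              show "integrable lborel ?gain"
              proof (rule integrable_bounded_support[where B = "M * 1 * 1" and a = "(- X, 0)" and b = "(X, N)"])
                fix z :: "real \<times> real"
                have "\<bar>\<rho> (snd z + \<Delta>t l) - \<rho> (snd z)\<bar> \<le> 1"
                  using \<rho>(2,3)[of "snd z"] \<rho>(2,3)[of "snd z + \<Delta>t l"] by linarith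
                moreover have "\<bar>tn ?\<tau> z\<bar> \<le> 1" using tn(1,2)[of ?\<tau> z] by linarith
                moreover have "\<bar>clamp_to M (U l (z + et l))\<bar> \<le> M" using Um(1,2)[of l "z + et l"] by linarith
                ultimately have "\<bar>clamp_to M (U l (z + et l)) * tn ?\<tau> z * (\<rho> (snd z + \<Delta>t l) - \<rho> (snd z))\<bar> \<le> M * 1 * 1"
                  unfolding abs_mult using M(1) by (intro mult_mono) auto
                then show "\<bar>?gain z\<bar> \<le> M * 1 * 1"
                  using M(1) by (auto split: split_indicator)
                show "z \<in> cbox (- X, 0) (X, N)"
                  if "?gain z \<noteq> 0"
                proof -
                  have "snd z \<in> {0..<N}" "tn ?\<tau> z \<noteq> 0" using that by (auto simp: indicator_def split: if_splits)
                  moreover from this have "\<bar>fst z\<bar> \<le> X" using tn(3)[of ?\<tau> z] unfolding X_def by linarith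
                  ultimately show ?thesis by (cases z) (auto simp: cbox_Pair_eq)
                qed
              qed measurable
              fix z :: "real \<times> real"
              have rhs: "0 \<le> ?gain z"
                using Um(1) tn(1) monoD[OF \<rho>(1), of "snd z" "snd z + \<Delta>t l"] dt_pos[of l] by simp
              show "\<Delta>t l / (4 * h) * (indicator (slab X T) z *\<^sub>R (U l (z + et l) * indicator ?Q z))
                \<le> ?gain z"
              proof (cases "z \<in> ?Q")
                case False
                then show ?thesis using rhs by simp
              next
                case True
                obtain x t where z: "z = (x, t)" by (cases z)
                have "c - 1 / 8 \<le> x" "x \<le> c + 1 / 8" using True by (auto simp: z)
                then have "\<bar>x - c\<bar> \<le> 1 / 8" by linarith
                with True have t: "b \<le> t" "t \<le> b + h / 2" "\<bar>x - c\<bar> \<le> 1 / 8" by (auto simp: z)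
                have d: "\<Delta>t l \<le> h / 2" "0 < \<Delta>t l" using elim(3) dt_pos by auto
                have "(t - b) / h \<le> 1" "0 \<le> (t - b) / h" "(t + \<Delta>t l - b) / h \<le> 1" "0 \<le> (t + \<Delta>t l - b) / h"
                  using t d h(1) by (auto simp: divide_le_eq)
                then have "\<rho> (t + \<Delta>t l) - \<rho> t = (t + \<Delta>t l - b) / h - (t - b) / h" by (simp add: \<rho>_def)
                also have "\<dots> = \<Delta>t l / h" by (simp flip: diff_divide_distrib)
                finally have \<rho>d: "\<rho> (t + \<Delta>t l) - \<rho> t = \<Delta>t l / h" .
                have "L * (min t (?\<tau> + 2 * h) - ?\<tau>) \<ge> L * (- h)"
                  using L t h(1) by (intro mult_left_mono) auto
                then have tnz: "1 / 4 \<le> tn ?\<tau> z" using t h(2) by (simp add: tn_def tent_def z)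
                have cl: "clamp_to M (U l (z + et l)) = U l (z + et l)"
                  using Ule[OF Q_sub[OF True]] U_pos[of l "z + et l"] by (simp add: clamp_to_id)
                have "t < N" using t N(1) bh h(1) by linarith
                then have i: "indicator (UNIV \<times> {0..<N}) z = (1::real)" using t bh by (simp add: z)
                have "\<Delta>t l / (4 * h) * U l (z + et l) = U l (z + et l) * (1 / 4) * (\<Delta>t l / h)" by simp
                also have "\<dots> \<le> U l (z + et l) * tn ?\<tau> z * (\<Delta>t l / h)"
                  using tnz U_pos[of l "z + et l"] d h(1) by (intro mult_right_mono mult_left_mono) auto
                finally show ?thesis
                  using True Q_sub[OF True] \<rho>d cl i by (simp add: z)
              qed
            qed
            then show ?thesis by (simp add: gain_def set_lebesgue_integral_def)
          qed
          moreover have "\<Delta>t l / (4 * h) * (?\<gamma> / 2) \<le> \<Delta>t l / (4 * h) * (LINT z:slab X T|lborel. U l (z + et l) * indicator ?Q z)"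
            using elim(1) dt_pos[of l] h(1) by (intro mult_left_mono) auto
          moreover have "A \<rho> ?\<tau> l 0 + gain \<rho> ?\<tau> l N - \<Delta>t l * E l \<le> A \<rho> ?\<tau> l N"
            by (rule mass[OF \<rho> N' N(3) elim(3)])
          moreover have "\<Delta>t l * E l \<le> \<Delta>t l * (?\<gamma> / (16 * h))" using elim(2) dt_pos[of l] by (intro mult_left_mono) auto
          \<comment> \<open>The gain is at least \<open>?\<gamma> * \<Delta>t l / (8 * h)\<close>,
            and the flux error takes at most half of it.\<close>
          moreover have "\<Delta>t l / (4 * h) * (?\<gamma> / 2) - \<Delta>t l * (?\<gamma> / (16 * h)) = ?\<gamma> / (16 * h) * \<Delta>t l"
            using h(1) by (simp add: field_simps)
          ultimately have "?\<gamma> / (16 * h) * \<Delta>t l \<le> A \<rho> ?\<tau> l N" using A0 by linarith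
          then show "hits c l N (?\<gamma> / (16 * h) / 2)"
            using \<gamma> h(1) by (intro point[OF \<rho>]) auto
        qed
      qed
      then show ?thesis using \<gamma> h(1) by (intro exI[of _ "?\<gamma> / (16 * h) / 2"]) simp
    qed
  qed
  then have "\<forall>i. \<exists>\<gamma>. 0 < \<gamma> \<and> (\<forall>\<^sub>F l in sequentially. \<forall>N. real i * h \<le> N \<longrightarrow> N \<le> real (Suc i) * h \<longrightarrow> N \<le> T \<longrightarrow>
      (hits c l N \<gamma>))" ..
  from choice[OF this] obtain \<gamma> where \<gamma>: "\<And>i. 0 < \<gamma> i" "\<And>i. \<forall>\<^sub>F l in sequentially. \<forall>N. real i * h \<le> N \<longrightarrow> N \<le> real (Suc i) * h \<longrightarrow> N \<le> T \<longrightarrow>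
      (hits c l N (\<gamma> i))"
    by blast
  define I where "I = nat \<lfloor>T / h\<rfloor>"
  define \<kappa> where "\<kappa> = Min (\<gamma> ` {..I})"
  have \<kappa>: "0 < \<kappa>" "\<kappa> \<le> \<gamma> i" if "i \<le> I" for i
    using \<gamma>(1) that by (auto simp: \<kappa>_def)
  have "\<forall>\<^sub>F l in sequentially. \<forall>i\<in>{..I}. \<forall>N. real i * h \<le> N \<longrightarrow> N \<le> real (Suc i) * h \<longrightarrow> N \<le> T \<longrightarrow>
      (hits c l N (\<gamma> i))"
    using \<gamma>(2) by (intro eventually_ball_finite) auto
  then have "\<forall>\<^sub>F l in sequentially. \<forall>t\<in>{0..T}. \<exists>y\<in>{c-1..c+1}. \<kappa> \<le> U l (y, t)"
  proof eventually_elim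
    case (elim l)
    show ?case
    proof
      fix t assume t: "t \<in> {0..T}"
      \<comment> \<open>Rounding \<open>t\<close> down to its time level \<open>N\<close> leaves
        \<open>U l\<close> unchanged, and the strip of one time step above \<open>N\<close> belongs
        to the same level.\<close>
      define k where "k = nat \<lfloor>t / \<Delta>t l\<rfloor>"
      define N where "N = real k * \<Delta>t l"
      have fl: "0 \<le> t - N" "t - N < \<Delta>t l" "0 \<le> N"
        using nat_floor_divide_less(2,3)[OF dt_pos, of t t l] t dt_pos[of l] unfolding N_def k_def by auto
      define i where "i = nat \<lfloor>N / h\<rfloor>"
      have Nt: "N \<le> T" using fl t by auto
      have i: "i < I + 1" "0 \<le> N - real i * h" "N - real i * h < h"
        using nat_floor_divide_less[OF h(1) fl(3) Nt] unfolding i_def I_def by auto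
      then obtain z where z: "\<bar>fst z - c\<bar> \<le> 1" "N \<le> snd z" "snd z < N + \<Delta>t l" "\<gamma> i \<le> U l z"
        using elim[THEN bspec, of i, THEN spec, of N] Nt by (auto simp: algebra_simps)
      have "\<lfloor>snd z / \<Delta>t l\<rfloor> = int k" "\<lfloor>t / \<Delta>t l\<rfloor> = int k"
        using z fl dt_pos[of l] by (auto simp: floor_eq_iff N_def field_simps)
      then have "U l z = U l (fst z, t)" by (simp add: U_eq)
      then have "\<kappa> \<le> U l (fst z, t)" using z(4) \<kappa>(2)[of i] i(1) by simp
      moreover have "fst z \<in> {c-1..c+1}" using z(1) by (auto simp: abs_le_iff)
      ultimately show "\<exists>y\<in>{c-1..c+1}. \<kappa> \<le> U l (y, t)" by blast
    qed
  qed
  then show ?thesis using \<kappa>(1)[of 0] by auto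
qed

text \<open>By \<open>no_vacuum\<close> there are, at every time, points on both sides of the slab
  where \<open>U l\<close> is at least some \<kappa>. A flux beyond \<open>R\<close> would push the
  value at the upwind one of them below \<kappa>.\<close>

lemma F_bounded:
  assumes X: "0 < X" and T: "0 < T"
  shows "\<exists>C>0. \<forall>\<^sub>F l in sequentially. \<forall>z\<in>slab X T. \<bar>F l z\<bar> \<le> C"
proof -
  have X4: "0 < X + 4" and T1: "0 < T + 1" using X T by simp_all
  from U_bounded[OF X4 T1] obtain M where M: "0 < M" "\<forall>l. \<forall>z\<in>slab (X + 4) (T + 1). U l z \<le> M" by blast
  from flx_bounded[OF X4 T] obtain G where G: "0 < G" "\<forall>\<^sub>F l in sequentially. \<forall>z\<in>slab (X + 4) T. \<bar>flx l z\<bar> \<le> G" by blast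
  from no_vacuum[OF T, of "- X - 2"] obtain \<kappa>\<^sub>1 where k1: "0 < \<kappa>\<^sub>1"
    "\<forall>\<^sub>F l in sequentially. \<forall>t\<in>{0..T}. \<exists>y\<in>{- X - 2 - 1.. - X - 2 + 1}. \<kappa>\<^sub>1 \<le> U l (y, t)" by blast
  from no_vacuum[OF T, of "X + 2"] obtain \<kappa>\<^sub>2 where k2: "0 < \<kappa>\<^sub>2"
    "\<forall>\<^sub>F l in sequentially. \<forall>t\<in>{0..T}. \<exists>y\<in>{X + 2 - 1.. X + 2 + 1}. \<kappa>\<^sub>2 \<le> U l (y, t)" by blast
  define \<kappa> where "\<kappa> = min \<kappa>\<^sub>1 \<kappa>\<^sub>2"
  have \<kappa>: "0 < \<kappa>" "\<kappa> \<le> \<kappa>\<^sub>1" "\<kappa> \<le> \<kappa>\<^sub>2" using k1 k2 by (auto simp: \<kappa>_def)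
  \<comment> \<open>Large enough for \<open>G * M / R < \<kappa>\<close>, and at least
    \<open>G\<close>, the threshold beyond which the flux is monotone.\<close>
  define R where "R = G * (M / \<kappa> + 1)"
  have R: "0 < R" "G \<le> R" "G * M < R * \<kappa>"
    using G(1) M(1) \<kappa>(1) by (simp_all add: R_def field_simps add_pos_pos)
  have "\<forall>\<^sub>F l in sequentially. \<forall>z\<in>slab X T. \<bar>F l z\<bar> \<le> R"
    using G(2) k1(2) k2(2) eventually_dx_less[OF zero_less_one] eventually_dt_less[OF zero_less_one]
  proof eventually_elim
    case (elim l)
    show ?case
    proof
      fix z assume z: "z \<in> slab X T"
      define x t where "x = fst z" and "t = snd z"
      have xt: "z = (x, t)" "- X \<le> x" "x \<le> X" "0 \<le> t" "t \<le> T"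
        using z by (auto simp: x_def t_def mem_slab)
      have tT: "t \<in> {0..T}" using xt by simp
      define n where "n = nat \<lfloor>t / \<Delta>t l\<rfloor>"
      define ci where "ci = cell_index (x\<^sub>0 l) (\<Delta>x l)"
      have Ui: "U l (y, t) = V l n (ci y)" and Fi: "F l (y, t) = mpe_flux g (V l) n (ci y)"
        and fi: "flx l (y, t) = flux_at g (V l) n (ci y)" for y
        by (simp_all add: U_eq step_eq n_def ci_def)
      have USuc: "U l ((y, t) + et l) = V l (Suc n) (ci y)" for y
        unfolding U_eq idx_et using lev_et[of "(y, t)" l] xt(4) by (simp add: n_def ci_def)
      have flux_le: "\<bar>flux_at g (V l) n k\<bar> \<le> G"
        if k: "a \<le> b" "ci a \<le> k" "k \<le> ci b" "- X - 3 \<le> a" "b \<le> X + 3" for a b k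
      proof -
        obtain y where "y \<in> {a..b}" "ci y = k"
          using cell_index_between[OF steps(1) k(1), of "x\<^sub>0 l" l k] k(2,3) by (auto simp: ci_def)
        then show ?thesis using elim(1)[THEN bspec, of "(y, t)"] k(4,5) xt by (auto simp: fi mem_slab abs_le_iff)
      qed
      have absurd: False
        if "\<bar>y\<bar> \<le> X + 3" "\<kappa> \<le> U l (y, t)" "R * V l n (ci y) \<le> G * V l (Suc n) (ci y)" for y
      proof -
        have "(y, t) + et l \<in> slab (X + 4) (T + 1)"
          using that(1) xt elim(5) dt_pos[of l] by (auto simp: mem_slab et_def)
        then have "V l (Suc n) (ci y) \<le> M" using M(2) USuc[of y] by metis
        then have "G * V l (Suc n) (ci y) \<le> G * M" using G(1) by simp
        moreover have "R * \<kappa> \<le> R * V l n (ci y)" using that(2) R(1) Ui by simp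
        ultimately show False using that(3) R(3) by linarith
      qed
      show "\<bar>F l z\<bar> \<le> R"
      proof (rule ccontr)
        assume "\<not> ?thesis"
        then consider "R < F l z" | "F l z < - R" by linarith
        then show False
        proof cases
          case 1
          from elim(2)[THEN bspec, OF tT]
          obtain y where y: "y \<in> {- X - 2 - 1.. - X - 2 + 1}" "\<kappa>\<^sub>1 \<le> U l (y, t)" ..
          have yx: "y \<le> x" using y xt by simp
          have "R * V l n (ci y) \<le> G * V l (Suc n) (ci y)"
          proof (rule mpe_flux_gt_imp_small[OF scheme steps(1) dt_pos])
            show "R < mpe_flux g (V l) n (ci x)" using 1 by (simp add: xt(1) Fi)
            show "ci y \<le> ci x" using cell_index_mono[OF steps(1) yx] by (simp add: ci_def)
            show "\<bar>flux_at g (V l) n k\<bar> \<le> G" if "ci y \<le> k" "k \<le> ci x" for k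
              by (rule flux_le[OF yx that]) (use y xt in auto)
          qed (rule R)
          with y \<kappa> X show False by (intro absurd[of y]) auto
        next
          case 2
          from elim(3)[THEN bspec, OF tT]
          obtain y where y: "y \<in> {X + 2 - 1.. X + 2 + 1}" "\<kappa>\<^sub>2 \<le> U l (y, t)" ..
          \<comment> \<open>For a flux to the left the donor must be a cell strictly to the right of
            \<open>x\<close>; \<open>y\<close> is at distance at least 1, more than one
            cell.\<close>
          have "x + of_int 1 * \<Delta>x l \<le> y" using y xt elim(4) by simp
          from cell_index_mono[OF steps(1) this, of "x\<^sub>0 l" l] have less: "ci x < ci y"
            unfolding cell_index_shift[OF steps(1)] ci_def by simp
          have xy: "x \<le> y" using y xt by simp
          have "R * V l n (ci y) \<le> G * V l (Suc n) (ci y)"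
          proof (rule mpe_flux_less_imp_small[OF scheme steps(1) dt_pos])
            show "mpe_flux g (V l) n (ci x) < - R" using 2 by (simp add: xt(1) Fi)
            show "\<bar>flux_at g (V l) n k\<bar> \<le> G" if "ci x \<le> k" "k < ci y" for k
              by (rule flux_le[OF xy that(1) less_imp_le[OF that(2)]]) (use y xt in auto)
          qed (rule R less)+
          with y \<kappa> X show False by (intro absurd[of y]) auto
        qed
      qed
    qed
  qed
  then show ?thesis using R by blast
qed

text \<open>The Lax-Wendroff argument. Summation by parts leaves difference quotients of \<phi>,
  bounded by the Lipschitz constant and convergent to the derivatives, against step functions that
  converge in the mean. \<phi> is a Lipschitz function on the plane, because a test function
  extended to negative times need not be differentiable across \<open>t = 0\<close>.\<close>

lemma weak_identity:
  fixes \<phi> \<phi>x \<phi>t :: "real \<times> real \<Rightarrow> real"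
  assumes [measurable]: "\<phi> \<in> borel_measurable borel"
    and lip: "\<And>z a b. \<bar>\<phi> (z + (a, b)) - \<phi> z\<bar> \<le> K * (\<bar>a\<bar> + \<bar>b\<bar>)"
    and bnd: "\<And>z. \<bar>\<phi> z\<bar> \<le> B" and supp: "\<And>z. \<phi> z \<noteq> 0 \<Longrightarrow> \<bar>fst z\<bar> \<le> X \<and> snd z < T"
    and X: "0 < X" and T: "0 < T"
    and \<phi>x: "\<And>z. z \<in> slab (X + 1) T \<Longrightarrow> (\<lambda>l. (\<phi> (z + ex l) - \<phi> z) / \<Delta>x l) \<longlonglongrightarrow> \<phi>x z"
    and \<phi>t: "\<And>z. z \<in> slab (X + 1) T \<Longrightarrow> (\<lambda>l. (\<phi> (z + et l) - \<phi> z) / \<Delta>t l) \<longlonglongrightarrow> \<phi>t z"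
  shows "set_integrable lborel (slab (X + 1) T) (\<lambda>z. w z * \<phi>t z)"
    and "set_integrable lborel (slab (X + 1) T) (\<lambda>z. f (w z) * \<phi>x z)"
    and "integrable lborel (\<lambda>x. \<phi> (x, 0) * \<psi>\<^sub>0 x)"
    and "(LINT z:slab (X + 1) T|lborel. w z * \<phi>t z) + (LINT z:slab (X + 1) T|lborel. f (w z) * \<phi>x z)
      = - (\<integral>x. \<phi> (x, 0) * \<psi>\<^sub>0 x \<partial>lborel)"
proof -
  let ?X = "X + 1"
  have X1: "0 < ?X" and X2: "0 < X + 2" and T1: "0 < T + 1" using X T by simp_all
  from U_bounded[OF X2 T1] obtain M where M: "0 < M" "\<forall>l. \<forall>z\<in>slab (X + 2) (T + 1). U l z \<le> M" by blast
  have M1: "\<forall>l. \<forall>z\<in>slab ?X (T + 1). U l z \<le> M" "\<forall>l. \<forall>z\<in>slab X 1. U l z \<le> M" "\<forall>l. \<forall>z\<in>slab ?X T. U l z \<le> M"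
    using M(2) T by (auto simp: mem_slab)
  from flx_bounded[OF X1 T] obtain G where G: "0 < G" "\<forall>\<^sub>F l in sequentially. \<forall>z\<in>slab ?X T. \<bar>flx l z\<bar> \<le> G" by blast
  from F_bounded[OF X1 T] obtain C where C: "0 < C" "\<forall>\<^sub>F l in sequentially. \<forall>z\<in>slab ?X T. \<bar>F l z\<bar> \<le> C" by blast
  \<comment> \<open>Above \<open>C\<close> the cut-off is inactive, and above \<open>G\<close> the
    cut-off flux has the limit \<open>f (w z)\<close>.\<close>
  define D where "D = max C G"
  have D: "0 < D" "C \<le> D" "G \<le> D" using C by (auto simp: D_def)
  from consistent_flux_lipschitz_at_0[OF flux, of M]
  obtain L\<^sub>0 where L0: "\<And>a. a \<in> {0..M} \<Longrightarrow> \<bar>f a - f 0\<bar> \<le> L\<^sub>0 * a" by blast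
  define q1 where "q1 l z = (\<phi> (z + ex l) - \<phi> z) / \<Delta>x l" for l z
  define q2 where "q2 l z = (\<phi> (z + et l) - \<phi> z) / \<Delta>t l" for l z
  have [measurable]: "q1 l \<in> borel_measurable borel" "q2 l \<in> borel_measurable borel" for l
    unfolding q1_def q2_def by measurable
  have q_bnd: "\<bar>q1 l z\<bar> \<le> K" "\<bar>q2 l z\<bar> \<le> K" for l z
    using lip[of z "\<Delta>x l" 0] lip[of z 0 "\<Delta>t l"] steps(1)[of l] dt_pos[of l]
    by (simp_all add: q1_def q2_def ex_def et_def pos_divide_le_eq)
  have U_int: "\<forall>\<^sub>F l in sequentially. set_integrable lborel (slab ?X T) (\<lambda>z. U l (z + et l))"
    using eventually_dt_less[OF zero_less_one]
    by eventually_elim (rule U_et_integrable[OF M1(1)], simp)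
  have meas: "(\<lambda>z. U l (z + et l)) \<in> borel_measurable borel" "(\<lambda>z. clamp_to D (F l z)) \<in> borel_measurable borel"
    "(\<lambda>z. f (w z)) \<in> borel_measurable borel" for l
    by measurable
  have F_int: "set_integrable lborel (slab ?X T) (\<lambda>z. clamp_to D (F l z))" for l
    by (rule set_integrable_slab[OF meas(2), where B = D]) (use D clamp_to_bounded in auto)
  note fw_int = f_w_integrable[OF L0 M1(3)]
  have lim2: "(\<lambda>l. LINT z:slab ?X T|lborel. U l (z + et l) * q2 l z) \<longlonglongrightarrow> (LINT z:slab ?X T|lborel. w z * \<phi>t z)"
    and "set_integrable lborel (slab ?X T) (\<lambda>z. w z * \<phi>t z)"
    using integral_mult_tendsto[OF L1_null_U_et[OF X1 T] _ meas(1) w_measurable w_integrable U_int, of q2 K \<phi>t]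
      q_bnd \<phi>t by (auto simp: q2_def)
  then show "set_integrable lborel (slab ?X T) (\<lambda>z. w z * \<phi>t z)" by simp
  have lim1: "(\<lambda>l. LINT z:slab ?X T|lborel. clamp_to D (F l z) * q1 l z) \<longlonglongrightarrow> (LINT z:slab ?X T|lborel. f (w z) * \<phi>x z)"
    and "set_integrable lborel (slab ?X T) (\<lambda>z. f (w z) * \<phi>x z)"
    using integral_mult_tendsto[OF L1_null_clamp_F[OF X1 T eventually_flx[OF G(2) D(3)]] _ meas(2,3) fw_int, of q1 K \<phi>x]
      F_int q_bnd \<phi>x by (auto simp: q1_def)
  then show "set_integrable lborel (slab ?X T) (\<lambda>z. f (w z) * \<phi>x z)" by simp
  have lipt: "\<bar>\<phi> (x, t) - \<phi> (x, 0)\<bar> \<le> K * t" if "0 \<le> t" for x t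
    using lip[of "(x, 0)" 0 t] that by simp
  have suppx: "\<bar>fst z\<bar> \<le> X" if "\<phi> z \<noteq> 0" for z using supp that by blast
  note init = initial_integral_tendsto[OF assms(1) lipt bnd suppx X M(1) M1(2)]
  show "integrable lborel (\<lambda>x. \<phi> (x, 0) * \<psi>\<^sub>0 x)" by (rule init(2))
  have "\<forall>\<^sub>F l in sequentially. (LINT z:slab ?X T|lborel. U l (z + et l) * q2 l z) + (LINT z:slab ?X T|lborel. clamp_to D (F l z) * q1 l z)
     = - ((LINT z:UNIV \<times> {0..<\<Delta>t l}|lborel. \<phi> z * clamp_to M (U l z)) / \<Delta>t l)"
    using C(2) U_int eventually_dx_less[OF zero_less_one] eventually_dt_less[OF zero_less_one]
  proof eventually_elim
    case (elim l)
    let ?S = "UNIV \<times> {0..<T} :: (real \<times> real) set"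
    define Um where "Um z = clamp_to M (U l z)" for z
    define H where "H z = clamp_to D (F l z)" for z
    have Um_meas: "Um \<in> borel_measurable borel" unfolding Um_def by measurable
    have H_meas: "H \<in> borel_measurable borel" unfolding H_def by measurable
    have Um_bnd: "\<bar>Um z\<bar> \<le> M" for z unfolding Um_def using M by (intro clamp_to_bounded) auto
    have H_bnd: "\<bar>H z\<bar> \<le> D" for z unfolding H_def using D by (intro clamp_to_bounded) auto
    have Um_eq: "Um z = U l z" "Um (z + et l) = U l (z + et l)" if "z \<in> slab ?X T" for z
      using U_shift_le[OF M1(1) _ that, of l] elim(4) U_pos[of l z] U_pos[of l "z + et l"]
      by (simp_all add: Um_def clamp_to_id)
    have H_eq: "H z = F l z" if "z \<in> slab ?X T" for z
    proof -
      have "\<bar>F l z\<bar> \<le> D" using elim(1) that D(2) by force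
      then show ?thesis by (simp add: H_def clamp_to_id)
    qed
    have supp': "\<forall>z. \<phi> z \<noteq> 0 \<longrightarrow> \<bar>fst z\<bar> \<le> X" using supp by blast
    note parts = integral_by_parts_shift[OF assms(1) Um_meas H_meas bnd Um_bnd H_bnd supp' less_imp_le[OF dt_pos] less_imp_le[OF T],
      of l r "\<Delta>x l", folded ex_def et_def]
    have "indicator ?S z *\<^sub>R (\<phi> z * (Um (z + et l) - Um z + r * (H z - H (z - ex l)))) = 0" for z
    proof (cases "z \<in> ?S \<and> \<phi> z \<noteq> 0")
      case True
      then have z: "z \<in> slab ?X T" "z - ex l \<in> slab ?X T"
        using supp[of z] elim(3) steps(1)[of l] by (auto simp: mem_slab ex_def abs_le_iff)
      then show ?thesis
        unfolding Um_eq[OF z(1)] H_eq[OF z(1)] H_eq[OF z(2)]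
        using U_et[of z l] by (simp add: mem_slab)
    qed (auto split: split_indicator)
    then have "(LINT z:?S|lborel. \<phi> z * (Um (z + et l) - Um z + r * (H z - H (z - ex l)))) = 0"
      by (simp only: set_lebesgue_integral_def Bochner_Integration.integral_zero)
    \<comment> \<open>No boundary term at the top: \<phi> vanishes from time \<open>T\<close>
      on.\<close>
    moreover have "(LINT z:UNIV \<times> {T..<T + \<Delta>t l}|lborel. \<phi> z * Um z) = 0"
    proof -
      have "indicator (UNIV \<times> {T..<T + \<Delta>t l}) z *\<^sub>R (\<phi> z * Um z) = 0" for z
        using supp[of z] by (cases "\<phi> z = 0") (auto simp: indicator_def)
      then show ?thesis by (simp only: set_lebesgue_integral_def Bochner_Integration.integral_zero)
    qed
    ultimately have R: "(LINT z:?S|lborel. Um (z + et l) * (\<phi> (z + et l) - \<phi> z) + r * (H z * (\<phi> (z + ex l) - \<phi> z)))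
       = - (LINT z:UNIV \<times> {0..<\<Delta>t l}|lborel. \<phi> z * Um z)"
      using parts(1) by linarith
    \<comment> \<open>Where the strip and the wider slab differ, both differences of \<phi> vanish.
      The common factor is the time step, because \<open>r\<close> is the quotient of the two step
      sizes.\<close>
    have ptw: "indicator ?S z *\<^sub>R (Um (z + et l) * (\<phi> (z + et l) - \<phi> z) + r * (H z * (\<phi> (z + ex l) - \<phi> z)))
        = \<Delta>t l * (indicator (slab ?X T) z *\<^sub>R (U l (z + et l) * q2 l z + clamp_to D (F l z) * q1 l z))" for z
    proof (cases "\<phi> (z + et l) - \<phi> z = 0 \<and> \<phi> (z + ex l) - \<phi> z = 0")
      case True
      then show ?thesis by (simp add: q1_def q2_def)
    next
      case False
      then have "\<phi> z \<noteq> 0 \<or> \<phi> (z + et l) \<noteq> 0 \<or> \<phi> (z + ex l) \<noteq> 0" by auto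
      then have z: "\<bar>fst z\<bar> \<le> ?X" "snd z < T"
        using supp[of z] supp[of "z + ex l"] supp[of "z + et l"] elim(3) steps(1)[of l] dt_pos[of l]
        by (auto simp: ex_def et_def abs_le_iff)
      have d: "\<phi> (z + et l) - \<phi> z = \<Delta>t l * q2 l z" "r * (\<phi> (z + ex l) - \<phi> z) = \<Delta>t l * q1 l z"
        using dt_pos[of l] steps(1)[of l] steps(3) steps(4)[of l] by (simp_all add: q1_def q2_def)
      show ?thesis
      proof (cases "0 \<le> snd z")
        case True
        then have zs: "z \<in> slab ?X T" "z \<in> ?S" using z by (cases z; auto simp: mem_slab)+
        have "Um (z + et l) * (\<phi> (z + et l) - \<phi> z) + r * (H z * (\<phi> (z + ex l) - \<phi> z))
          = Um (z + et l) * (\<phi> (z + et l) - \<phi> z) + H z * (r * (\<phi> (z + ex l) - \<phi> z))" by simp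
        also have "\<dots> = \<Delta>t l * (U l (z + et l) * q2 l z + clamp_to D (F l z) * q1 l z)"
          unfolding d Um_eq(2)[OF zs(1)] H_def by (simp add: algebra_simps)
        finally show ?thesis using zs by simp
      next
        case False
        then show ?thesis by (cases z) (auto simp: mem_slab indicator_def)
      qed
    qed
    have i2: "set_integrable lborel (slab ?X T) (\<lambda>z. U l (z + et l) * q2 l z)"
    proof (rule set_integrable_slab[where B = "M * K"])
      show "\<bar>U l (z + et l) * q2 l z\<bar> \<le> M * K" if "z \<in> slab ?X T" for z
        unfolding abs_mult using U_shift_le(1)[OF M1(1) _ that, of l] elim(4) U_pos[of l "z + et l"] q_bnd(2)[of l z] M(1)
        by (intro mult_mono) auto
    qed measurable
    have i1: "set_integrable lborel (slab ?X T) (\<lambda>z. clamp_to D (F l z) * q1 l z)"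
    proof (rule set_integrable_slab[where B = "D * K"])
      show "\<bar>clamp_to D (F l z) * q1 l z\<bar> \<le> D * K" for z
        unfolding abs_mult using H_bnd[of z] q_bnd(1)[of l z] D(1) by (intro mult_mono) (auto simp: H_def)
    qed measurable
    have "\<Delta>t l * ((LINT z:slab ?X T|lborel. U l (z + et l) * q2 l z) + (LINT z:slab ?X T|lborel. clamp_to D (F l z) * q1 l z))
        = (LINT z:?S|lborel. Um (z + et l) * (\<phi> (z + et l) - \<phi> z) + r * (H z * (\<phi> (z + ex l) - \<phi> z)))"
      unfolding set_integral_add(2)[OF i2 i1, symmetric]
      unfolding set_lebesgue_integral_def ptw by simp
    then show ?case
      unfolding R Um_def[symmetric] using dt_pos[of l] by (simp add: field_simps)
  qed
  then have "(\<lambda>l. - ((LINT z:UNIV \<times> {0..<\<Delta>t l}|lborel. \<phi> z * clamp_to M (U l z)) / \<Delta>t l))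
      \<longlonglongrightarrow> (LINT z:slab ?X T|lborel. w z * \<phi>t z) + (LINT z:slab ?X T|lborel. f (w z) * \<phi>x z)"
    by (rule Lim_transform_eventually[OF tendsto_add[OF lim2 lim1]])
  from LIMSEQ_unique[OF this tendsto_minus[OF init(1)]]
  show "(LINT z:slab ?X T|lborel. w z * \<phi>t z) + (LINT z:slab ?X T|lborel. f (w z) * \<phi>x z)
      = - (\<integral>x. \<phi> (x, 0) * \<psi>\<^sub>0 x \<partial>lborel)" .
qed

end

section \<open>The limit\<close>

text \<open>Outside the indicated part of the half plane \<phi> vanishes near each point, so the
  derivatives vanish as well; on the remaining compact slab they are bounded by continuity.\<close>

lemma test_function_bounds:
  assumes "test_function \<phi> \<phi>x \<phi>t"
  shows "\<exists>X>0. \<exists>K\<ge>0. \<forall>x. \<forall>t\<ge>0. (\<phi> x t \<noteq> 0 \<longrightarrow> \<bar>x\<bar> < X \<and> t < X) \<and>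
    (\<phi>x x t \<noteq> 0 \<or> \<phi>t x t \<noteq> 0 \<longrightarrow> \<bar>x\<bar> \<le> X \<and> t \<le> X) \<and> \<bar>\<phi>x x t\<bar> \<le> K \<and> \<bar>\<phi>t x t\<bar> \<le> K"
proof -
  have dx: "((\<lambda>y. \<phi> y t) has_real_derivative \<phi>x x t) (at x)"
    and dt: "((\<lambda>s. \<phi> x s) has_real_derivative \<phi>t x t) (at t within {0..})" if "0 \<le> t" for x t
    using assms that by (auto simp: test_function_def)
  have cont: "continuous_on (UNIV \<times> {0..}) (\<lambda>(x, t). \<phi>x x t)" "continuous_on (UNIV \<times> {0..}) (\<lambda>(x, t). \<phi>t x t)"
    using assms by (auto simp: test_function_def)
  obtain K where K: "compact K" "\<And>x t. 0 \<le> t \<Longrightarrow> (x, t) \<notin> K \<Longrightarrow> \<phi> x t = 0"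
    using assms by (auto simp: test_function_def)
  obtain b where b: "\<And>z. z \<in> K \<Longrightarrow> norm z \<le> b"
    using compact_imp_bounded[OF K(1)] by (auto simp: bounded_iff)
  define X where "X = \<bar>b\<bar> + 1"
  have X: "0 < X" by (simp add: X_def)
  have supp: "\<bar>x\<bar> < X \<and> t < X" if "0 \<le> t" "\<phi> x t \<noteq> 0" for x t
  proof -
    have "norm (x, t) \<le> b" using K(2) that b by blast
    then have "norm (x, t) < X" by (simp add: X_def)
    moreover have "\<bar>x\<bar> \<le> norm (x, t)" "\<bar>t\<bar> \<le> norm (x, t)"
      using norm_fst_le[of x t] norm_snd_le[of t x] by simp_all
    ultimately show ?thesis by linarith
  qed
  have supp_x: "\<bar>x\<bar> \<le> X \<and> t \<le> X" if t: "0 \<le> t" and nz: "\<phi>x x t \<noteq> 0" for x t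
  proof (rule ccontr)
    assume out: "\<not> ?thesis"
    have "\<forall>\<^sub>F y in at x. \<phi> y t = 0"
    proof (cases "X < t")
      case True
      then show ?thesis using supp t by (intro always_eventually) force
    next
      case False
      then have "x \<in> - {-X..X}" using out by auto
      then have "\<forall>\<^sub>F y in at x. y \<in> - {-X..X}" by (intro eventually_at_in_open') auto
      then show ?thesis by eventually_elim (use supp t in force)
    qed
    moreover have "\<phi> x t = 0" using supp[OF t, of x] out by force
    ultimately have "((\<lambda>y. 0) has_real_derivative \<phi>x x t) (at x)"
      using dx[OF t, of x] by (subst has_field_derivative_cong_eventually[symmetric]) auto
    then show False using nz DERIV_unique[OF _ DERIV_const] by blast
  qed
  have supp_t: "\<bar>x\<bar> \<le> X \<and> t \<le> X" if t: "0 \<le> t" and nz: "\<phi>t x t \<noteq> 0" for x t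
  proof (rule ccontr)
    assume out: "\<not> ?thesis"
    have "\<forall>\<^sub>F s in at t within {0..}. \<phi> x s = 0"
    proof (cases "X < \<bar>x\<bar>")
      case True
      then have "\<phi> x s = 0" if "s \<in> {0..}" for s using supp[of s x] that by force
      moreover have "\<forall>\<^sub>F s in at t within {0..}. s \<in> {0..}" by (simp add: eventually_at_filter)
      ultimately show ?thesis by (rule eventually_mono[rotated])
    next
      case False
      then have "t \<in> {X<..}" using out by auto
      from eventually_at_in_open'[OF open_greaterThan this]
      have "\<forall>\<^sub>F s in at t within {0..}. s \<in> {X<..}"
        by (rule filter_leD[OF at_le[OF subset_UNIV]])
      then show ?thesis
      proof eventually_elim
        case (elim s)
        then have "0 \<le> s" "\<not> s < X" using X by auto
        then show ?case using supp[of s x] by blast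
      qed
    qed
    moreover have "\<phi> x t = 0" using supp[OF t, of x] out by force
    ultimately have "((\<lambda>s. 0) has_real_derivative \<phi>t x t) (at t within {0..})"
      using dt[OF t, of x] by (subst has_field_derivative_cong_eventually[symmetric]) auto
    \<comment> \<open>Uniqueness of a one-sided derivative requires a nontrivial filter; it is
      nontrivial because the half line contains all points to the right of \<open>t\<close>.\<close>
    moreover have "at t within {0..} \<noteq> bot"
    proof -
      have "at t within {t..} \<le> at t within {0..}" using t by (intro at_le) auto
      moreover have "at t within {t..} \<noteq> bot" by (simp add: at_within_Ici_at_right)
      ultimately show ?thesis by (metis bot.extremum_uniqueI)
    qed
    ultimately show False using nz has_field_derivative_unique[OF _ DERIV_const] by blast
  qed
  have bounded: "\<exists>B. \<forall>x t. 0 \<le> t \<longrightarrow> \<bar>h x t\<bar> \<le> B"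
    if c: "continuous_on (UNIV \<times> {0..}) (\<lambda>(x, t). h x t)" and s: "\<And>x t. 0 \<le> t \<Longrightarrow> h x t \<noteq> 0 \<Longrightarrow> \<bar>x\<bar> \<le> X \<and> t \<le> X"
    for h :: "real \<Rightarrow> real \<Rightarrow> real"
  proof -
    have "slab X X \<subseteq> UNIV \<times> {0..}" by (auto simp: slab_def)
    then have "compact ((\<lambda>(x, t). h x t) ` slab X X)"
      using c by (intro compact_continuous_image compact_slab) (rule continuous_on_subset)
    from compact_imp_bounded[OF this] obtain B where B: "\<forall>z\<in>slab X X. \<bar>(\<lambda>(x, t). h x t) z\<bar> \<le> B"
      by (auto simp: bounded_iff)
    have "\<bar>h x t\<bar> \<le> max B 0" if "0 \<le> t" for x t
      using s[OF that, of x] B[THEN bspec, of "(x, t)"] that by (cases "h x t = 0") (auto simp: mem_slab)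
    then show ?thesis by blast
  qed
  obtain B1 where B1: "\<And>x t. 0 \<le> t \<Longrightarrow> \<bar>\<phi>x x t\<bar> \<le> B1" using bounded[OF cont(1) supp_x] by blast
  obtain B2 where B2: "\<And>x t. 0 \<le> t \<Longrightarrow> \<bar>\<phi>t x t\<bar> \<le> B2" using bounded[OF cont(2) supp_t] by blast
  define B where "B = max (max B1 B2) 0"
  have "\<bar>\<phi>x x t\<bar> \<le> B \<and> \<bar>\<phi>t x t\<bar> \<le> B" if "0 \<le> t" for x t
    using B1[OF that, of x] B2[OF that, of x] unfolding B_def by linarith
  then have "\<forall>x. \<forall>t\<ge>0. (\<phi> x t \<noteq> 0 \<longrightarrow> \<bar>x\<bar> < X \<and> t < X) \<and>
    (\<phi>x x t \<noteq> 0 \<or> \<phi>t x t \<noteq> 0 \<longrightarrow> \<bar>x\<bar> \<le> X \<and> t \<le> X) \<and> \<bar>\<phi>x x t\<bar> \<le> B \<and> \<bar>\<phi>t x t\<bar> \<le> B"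
    using supp supp_x supp_t by blast
  moreover have "0 \<le> B" by (simp add: B_def)
  ultimately show ?thesis using X by blast
qed

theorem theorem3:
  fixes f \<psi> :: "real \<Rightarrow> real"
    and u :: "real \<Rightarrow> real \<Rightarrow> real"
    and g :: "(int \<Rightarrow> real) \<Rightarrow> real" and p q :: nat
    and r :: real and \<Delta>x \<Delta>t x\<^sub>0 :: "nat \<Rightarrow> real"
    and V :: "nat \<Rightarrow> nat \<Rightarrow> int \<Rightarrow> real"
    and U :: "nat \<Rightarrow> real \<Rightarrow> real \<Rightarrow> real"
  assumes \<psi>_pos: "\<And>x. \<psi> x > 0"
    and \<psi>_cont: "AE x in lebesgue. isCont \<psi> x"
    and u_pos: "AE z in lebesgue. 0 \<le> snd z \<longrightarrow> 0 < u (fst z) (snd z)"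
    and flux: "numerical_flux p q g" "consistent_flux p q g f"
    and steps: "\<And>l. \<Delta>x l > 0" "\<Delta>x \<longlonglongrightarrow> 0" "r > 0" "\<And>l. \<Delta>t l = r * \<Delta>x l"
    and init: "\<And>l i. V l 0 i = \<psi> (grid_point (x\<^sub>0 l) (\<Delta>x l) i)"
    and scheme: "\<And>l. mpe_scheme g (\<Delta>x l) (\<Delta>t l) (V l)"
    and recon: "\<And>l. U l = piecewise_constant (x\<^sub>0 l) (\<Delta>x l) (\<Delta>t l) (V l)"
    and TV: "\<And>a b T. a < b \<Longrightarrow> 0 < T \<Longrightarrow>
      \<exists>B. \<forall>l. \<forall>t\<in>{0..T}. total_variation (\<lambda>x. U l x t) a b \<le> ennreal B"
    and TTV: "\<And>a b T. a < b \<Longrightarrow> 0 < T \<Longrightarrow>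
      \<exists>B. \<forall>l. \<forall>x\<in>{a..b}. total_variation (\<lambda>t. U l x t) 0 T \<le> ennreal B"
    and conv: "\<And>T. 0 < T \<Longrightarrow> L1_loc_tendsto U u (UNIV \<times> {0..<T})"
  shows "weak_solution f \<psi> u"
proof -
  let ?H = "UNIV \<times> {0..} :: (real \<times> real) set"
  define u' where "u' z = u (fst z) (snd z)" for z
  have H_meas [measurable]: "?H \<in> sets borel" by (simp add: borel_Times)
  have slabH: "slab X T \<subseteq> ?H" for X T by (auto simp: slab_def)
  have K: "set_integrable lebesgue (slab X T) u'"
    "\<And>l. set_integrable lebesgue (slab X T) (\<lambda>z. U l (fst z) (snd z))"
    "(\<lambda>l. LINT z:slab X T|lebesgue. \<bar>U l (fst z) (snd z) - u' z\<bar>) \<longlonglongrightarrow> 0" for X T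
  proof -
    \<comment> \<open>The slab is closed at time \<open>T\<close> while convergence is given on
      strips open at the top, hence a larger height; the absolute value keeps it positive.\<close>
    have "compact (slab X T)" "slab X T \<subseteq> UNIV \<times> {0..<\<bar>T\<bar> + 1}"
      by (rule compact_slab) (auto simp: slab_def)
    then show "set_integrable lebesgue (slab X T) u'"
      "\<And>l. set_integrable lebesgue (slab X T) (\<lambda>z. U l (fst z) (snd z))"
      "(\<lambda>l. LINT z:slab X T|lebesgue. \<bar>U l (fst z) (snd z) - u' z\<bar>) \<longlonglongrightarrow> 0"
      using conv[of "\<bar>T\<bar> + 1"] unfolding L1_loc_tendsto_def u'_def by (auto simp: case_prod_unfold)
  qed
  \<comment> \<open>Integrability of \<open>u\<close> is given on compact sets only. The slabs
    exhaust the half plane, so the restriction of \<open>u\<close> to it is a limit of measurable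
    functions and has a Borel version \<open>w\<close>.\<close>
  have "(\<lambda>z. indicator ?H z * u' z) \<in> borel_measurable lebesgue"
  proof (rule borel_measurable_LIMSEQ_real)
    show "(\<lambda>z. indicator (slab (real n) (real n)) z * u' z) \<in> borel_measurable lebesgue" for n
      using borel_measurable_integrable[OF K(1)[unfolded set_integrable_def]] by simp
    show "(\<lambda>n. indicator (slab (real n) (real n)) z * u' z) \<longlonglongrightarrow> indicator ?H z * u' z" for z
    proof (rule tendsto_eventually)
      obtain N :: nat where N: "max \<bar>fst z\<bar> \<bar>snd z\<bar> \<le> real N" using real_arch_simple by blast
      show "\<forall>\<^sub>F n in sequentially. indicator (slab (real n) (real n)) z * u' z = indicator ?H z * u' z"
        using eventually_ge_at_top[of N]
      proof eventually_elim
        case (elim n)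
        then have "real N \<le> real n" by simp
        then show ?case using N by (cases z) (auto simp: indicator_def mem_slab)
      qed
    qed
  qed
  from completion_ex_borel_measurable_real[OF this]
  obtain w where w_meas [measurable]: "w \<in> borel_measurable borel" and "AE z in lborel. indicator ?H z * u' z = w z" by auto
  then have w_eq: "AE z in lborel. 0 \<le> snd z \<longrightarrow> w z = u' z"
    by (auto elim!: eventually_mono simp: indicator_def mem_Times_iff)
  then have w_eq': "AE z in lebesgue. 0 \<le> snd z \<longrightarrow> w z = u' z" by (rule AE_completion)
  have w_int: "set_integrable lborel (slab X T) w" for X T
  proof -
    have m: "(\<lambda>z. indicator (slab X T) z *\<^sub>R w z) \<in> borel_measurable borel" by measurable
    have "integrable lebesgue (\<lambda>z. indicator (slab X T) z *\<^sub>R w z) \<longleftrightarrow> integrable lebesgue (\<lambda>z. indicator (slab X T) z *\<^sub>R u' z)"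
    proof (rule integrable_cong_AE)
      show "(\<lambda>z. indicator (slab X T) z *\<^sub>R w z) \<in> borel_measurable lebesgue" using m by (simp add: measurable_completion)
      show "(\<lambda>z. indicator (slab X T) z *\<^sub>R u' z) \<in> borel_measurable lebesgue"
        using K(1)[of X T] by (auto simp: set_integrable_def)
      show "AE z in lebesgue. indicator (slab X T) z *\<^sub>R w z = indicator (slab X T) z *\<^sub>R u' z"
        using w_eq' by eventually_elim (auto simp: indicator_def mem_slab)
    qed
    then show ?thesis
      using K(1)[of X T] integrable_completion[of "\<lambda>z. indicator (slab X T) z *\<^sub>R w z" lborel] m by (simp add: set_integrable_def)
  qed
  let ?U = "\<lambda>l z. piecewise_constant (x\<^sub>0 l) (\<Delta>x l) (\<Delta>t l) (V l) (fst z) (snd z)"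
  have w_conv: "L1_null X T (\<lambda>l z. ?U l z - w z)" for X T
  proof -
    have "slab_norm X T (\<lambda>z. ?U l z - w z)
      = ennreal (LINT z:slab X T|lebesgue. \<bar>U l (fst z) (snd z) - u' z\<bar>)" for l
    proof -
      have "slab_norm X T (\<lambda>z. ?U l z - w z)
        = (\<integral>\<^sup>+z\<in>slab X T. ennreal \<bar>?U l z - w z\<bar> \<partial>lebesgue)"
        by (rule nn_integral_completion[symmetric])
      also have "\<dots> = (\<integral>\<^sup>+z. ennreal (indicator (slab X T) z *\<^sub>R \<bar>U l (fst z) (snd z) - u' z\<bar>) \<partial>lebesgue)"
        using w_eq' by (intro nn_integral_cong_AE) (auto elim!: eventually_mono simp: recon indicator_def mem_slab)
      also have "\<dots> = ennreal (LINT z:slab X T|lebesgue. \<bar>U l (fst z) (snd z) - u' z\<bar>)"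
        unfolding set_lebesgue_integral_def
      proof (rule nn_integral_eq_integral)
        show "integrable lebesgue (\<lambda>z. indicator (slab X T) z *\<^sub>R \<bar>U l (fst z) (snd z) - u' z\<bar>)"
          using set_integrable_abs[OF set_integral_diff(1)[OF K(2,1)]] by (simp add: set_integrable_def)
      qed simp
      finally show ?thesis .
    qed
    then show ?thesis
      using tendsto_ennrealI[OF K(3)[of X T]] by (simp add: L1_null_def)
  qed
  have \<psi>_cont': "AE x in lborel. isCont \<psi> x" using \<psi>_cont by (simp add: AE_completion_iff)
  have w_pos: "AE z in lborel. 0 \<le> snd z \<longrightarrow> 0 < w z"
    using w_eq u_pos[unfolded AE_completion_iff] by eventually_elim (auto simp: u'_def)
  have TV': "\<exists>B. \<forall>l. \<forall>t\<in>{0..T}. total_variation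
      (\<lambda>x. piecewise_constant (x\<^sub>0 l) (\<Delta>x l) (\<Delta>t l) (V l) (fst (x, t)) (snd (x, t))) a b \<le> ennreal B"
    if "a < b" "0 < T" for a b T
    using TV[OF that] unfolding recon fst_conv snd_conv .
  have TTV': "\<exists>B. \<forall>l. \<forall>x\<in>{a..b}. total_variation
      (\<lambda>t. piecewise_constant (x\<^sub>0 l) (\<Delta>x l) (\<Delta>t l) (V l) (fst (x, t)) (snd (x, t))) 0 T \<le> ennreal B"
    if "a < b" "0 < T" for a b T
    using TTV[OF that] unfolding recon fst_conv snd_conv .
  interpret mpe_limit f \<psi> w g p q r \<Delta>x \<Delta>t x\<^sub>0 V ?U
    by unfold_locales (fact \<psi>_pos \<psi>_cont' w_meas w_pos flux steps init scheme TV' TTV' w_int w_conv)+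
  show ?thesis
    unfolding weak_solution_def
  proof (intro allI impI)
    fix \<phi> \<phi>x \<phi>t
    assume test: "test_function \<phi> \<phi>x \<phi>t"
    from test_function_bounds[OF test] obtain T B where T: "0 < T" and B: "0 \<le> B"
      and bounds: "\<forall>x. \<forall>t\<ge>0. (\<phi> x t \<noteq> 0 \<longrightarrow> \<bar>x\<bar> < T \<and> t < T) \<and>
        (\<phi>x x t \<noteq> 0 \<or> \<phi>t x t \<noteq> 0 \<longrightarrow> \<bar>x\<bar> \<le> T \<and> t \<le> T) \<and> \<bar>\<phi>x x t\<bar> \<le> B \<and> \<bar>\<phi>t x t\<bar> \<le> B"
      by blast
    have supp: "\<bar>x\<bar> < T \<and> t < T" if "0 \<le> t" "\<phi> x t \<noteq> 0" for x t using bounds that by blast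
    have supp_x: "\<bar>x\<bar> \<le> T \<and> t \<le> T" if "0 \<le> t" "\<phi>x x t \<noteq> 0" for x t using bounds that by blast
    have supp_t: "\<bar>x\<bar> \<le> T \<and> t \<le> T" if "0 \<le> t" "\<phi>t x t \<noteq> 0" for x t using bounds that by blast
    have bx: "\<bar>\<phi>x x t\<bar> \<le> B" and bt: "\<bar>\<phi>t x t\<bar> \<le> B" if "0 \<le> t" for x t using bounds that by blast+
    have dx: "((\<lambda>y. \<phi> y t) has_real_derivative \<phi>x x t) (at x)"
      and dt: "((\<lambda>s. \<phi> x s) has_real_derivative \<phi>t x t) (at t within {0..})" if "0 \<le> t" for x t
      using test that by (auto simp: test_function_def)
    \<comment> \<open>Constant extension to negative times: it stays Lipschitz across
      \<open>t = 0\<close>, and at nonnegative times its forward difference quotients are those of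
      \<phi>.\<close>
    define \<Phi> where "\<Phi> z = \<phi> (fst z) (max 0 (snd z))" for z
    have lip: "\<bar>\<Phi> (z + (a, b)) - \<Phi> z\<bar> \<le> B * (\<bar>a\<bar> + \<bar>b\<bar>)" for z a b
    proof -
      obtain x t where z: "z = (x, t)" by (cases z)
      have tri: "\<bar>c\<^sub>1 - c\<^sub>3\<bar> \<le> d\<^sub>1 + d\<^sub>3" if "\<bar>c\<^sub>1 - c\<^sub>2\<bar> \<le> d\<^sub>1" "\<bar>c\<^sub>2 - c\<^sub>3\<bar> \<le> d\<^sub>2" "d\<^sub>2 \<le> d\<^sub>3"
        for c\<^sub>1 c\<^sub>2 c\<^sub>3 d\<^sub>1 d\<^sub>2 d\<^sub>3 :: real
        using that by linarith
      have "\<bar>\<phi> (x + a) (max 0 (t + b)) - \<phi> x (max 0 (t + b))\<bar> \<le> B * \<bar>a\<bar>"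
      proof -
        have "norm (\<phi> (x + a) (max 0 (t + b)) - \<phi> x (max 0 (t + b))) \<le> B * norm (x + a - x)"
          by (rule field_differentiable_bound[of UNIV _ "\<lambda>y. \<phi>x y (max 0 (t + b))"]) (auto intro!: dx bx)
        then show ?thesis by simp
      qed
      moreover have "\<bar>\<phi> x (max 0 (t + b)) - \<phi> x (max 0 t)\<bar> \<le> B * \<bar>max 0 (t + b) - max 0 t\<bar>"
        unfolding real_norm_def[symmetric]
        by (rule field_differentiable_bound[of "{0..}" _ "\<lambda>s. \<phi>t x s"]) (auto intro!: dt bt)
      moreover have "B * \<bar>max 0 (t + b) - max 0 t\<bar> \<le> B * \<bar>b\<bar>" using B by (intro mult_left_mono) auto
      ultimately have "\<bar>\<phi> (x + a) (max 0 (t + b)) - \<phi> x (max 0 t)\<bar> \<le> B * \<bar>a\<bar> + B * \<bar>b\<bar>"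
        by (rule tri)
      then show ?thesis by (simp add: \<Phi>_def z distrib_left)
    qed
    have "(2 * B)-lipschitz_on UNIV \<Phi>"
    proof (rule lipschitz_onI)
      fix z y :: "real \<times> real"
      have "\<bar>\<Phi> z - \<Phi> y\<bar> \<le> B * (\<bar>fst z - fst y\<bar> + \<bar>snd z - snd y\<bar>)"
        using lip[of y "fst z - fst y" "snd z - snd y"] by (cases z; cases y) simp
      also have "\<dots> \<le> B * (2 * dist z y)"
        using dist_fst_le[of z y] dist_snd_le[of z y] B by (intro mult_left_mono) (auto simp: dist_real_def)
      finally show "dist (\<Phi> z) (\<Phi> y) \<le> 2 * B * dist z y" by (simp add: dist_real_def)
    qed (use B in simp)
    from lipschitz_on_continuous_on[OF this] have \<Phi>_meas: "\<Phi> \<in> borel_measurable borel"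
      by (rule borel_measurable_continuous_onI)
    have \<Phi>_supp: "\<bar>fst z\<bar> \<le> T \<and> snd z < T" if "\<Phi> z \<noteq> 0" for z
      using supp[of "max 0 (snd z)" "fst z"] that by (auto simp: \<Phi>_def)
    \<comment> \<open>A shift by \<open>2 * T\<close> in space leaves the support, so the Lipschitz
      bound also bounds \<Phi> itself.\<close>
    have \<Phi>_bnd: "\<bar>\<Phi> z\<bar> \<le> B * (2 * T)" for z
    proof (cases "\<Phi> z = 0")
      case False
      have "\<Phi> (z + (2 * T, 0)) = 0" using \<Phi>_supp[OF False] \<Phi>_supp[of "z + (2 * T, 0)"] supp[of "max 0 (snd z)" "fst z"] False T
        by (cases "\<Phi> (z + (2 * T, 0)) = 0") (auto simp: \<Phi>_def)
      then show ?thesis using lip[of z "2 * T" 0] T by simp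
    qed (use B T in simp)
    have lim_x: "(\<lambda>l. (\<Phi> (z + ex l) - \<Phi> z) / \<Delta>x l) \<longlonglongrightarrow> \<phi>x (fst z) (snd z)" if "z \<in> slab (T + 1) T" for z
    proof -
      obtain x t where z: "z = (x, t)" by (cases z)
      have t: "0 \<le> t" using that by (simp add: z mem_slab)
      have "((\<lambda>y. (\<phi> y t - \<phi> x t) / (y - x)) \<longlongrightarrow> \<phi>x x t) (at x)"
        using dx[OF t, of x] unfolding has_field_derivative_iff .
      moreover have "filterlim (\<lambda>l. x + \<Delta>x l) (at x) sequentially"
        unfolding filterlim_at using tendsto_add[OF tendsto_const steps(2), of x] steps(1)
        by (auto simp: less_imp_neq[symmetric] intro!: always_eventually)
      ultimately have "(\<lambda>l. (\<phi> (x + \<Delta>x l) t - \<phi> x t) / (x + \<Delta>x l - x)) \<longlonglongrightarrow> \<phi>x x t"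
        by (rule filterlim_compose)
      then show ?thesis using t by (simp add: \<Phi>_def z ex_def)
    qed
    have lim_t: "(\<lambda>l. (\<Phi> (z + et l) - \<Phi> z) / \<Delta>t l) \<longlonglongrightarrow> \<phi>t (fst z) (snd z)" if "z \<in> slab (T + 1) T" for z
    proof -
      obtain x t where z: "z = (x, t)" by (cases z)
      have t: "0 \<le> t" using that by (simp add: z mem_slab)
      have "((\<lambda>s. (\<phi> x s - \<phi> x t) / (s - t)) \<longlongrightarrow> \<phi>t x t) (at t within {0..})"
        using dt[OF t, of x] unfolding has_field_derivative_iff .
      moreover have "filterlim (\<lambda>l. t + \<Delta>t l) (at t within {0..}) sequentially"
        unfolding filterlim_at using tendsto_add[OF tendsto_const dt_tendsto, of t] dt_pos t
        by (auto simp: less_imp_neq[symmetric] less_imp_le add_nonneg_nonneg intro!: always_eventually)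
      ultimately have "(\<lambda>l. (\<phi> x (t + \<Delta>t l) - \<phi> x t) / (t + \<Delta>t l - t)) \<longlonglongrightarrow> \<phi>t x t"
        by (rule filterlim_compose)
      then show ?thesis using t dt_pos by (simp add: \<Phi>_def z et_def add_nonneg_nonneg less_imp_le max_absorb2)
    qed
    note weak = weak_identity[OF \<Phi>_meas lip \<Phi>_bnd \<Phi>_supp T T lim_x lim_t]
    let ?S = "slab (T + 1) T"
    let ?h = "\<lambda>z. indicator ?S z *\<^sub>R (w z * \<phi>t (fst z) (snd z) + f (w z) * \<phi>x (fst z) (snd z))"
    let ?k = "\<lambda>z. indicator ?H z *\<^sub>R (\<phi>t (fst z) (snd z) * u (fst z) (snd z) + \<phi>x (fst z) (snd z) * f (u (fst z) (snd z)))"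
    have h_int: "integrable lborel ?h"
      using set_integral_add(1)[OF weak(1,2)] by (simp add: set_integrable_def)
    have h_eq: "(\<integral>z. ?h z \<partial>lborel) = - (\<integral>x. \<Phi> (x, 0) * \<psi>\<^sub>0 x \<partial>lborel)"
      using set_integral_add(2)[OF weak(1,2)] weak(4) by (simp add: set_lebesgue_integral_def)
    have h_int': "integrable lebesgue ?h" and h_eq': "(\<integral>z. ?h z \<partial>lebesgue) = (\<integral>z. ?h z \<partial>lborel)"
      using h_int integrable_completion[of ?h lborel] integral_completion[of ?h lborel]
        borel_measurable_integrable[OF h_int] by simp_all
    \<comment> \<open>Points of the half plane outside \<open>?S\<close> contribute 0, because both
      derivatives of \<phi> vanish there; inside, \<open>w\<close> agrees with \<open>u\<close>
      almost everywhere.\<close>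
    have hk: "AE z in lebesgue. ?h z = ?k z"
      using w_eq'
    proof eventually_elim
      case (elim z)
      show ?case
      proof (cases "z \<in> ?S")
        case True
        then show ?thesis using elim by (simp add: u'_def indicator_def mem_slab mem_Times_iff mult.commute)
      next
        case False
        show ?thesis
        proof (cases "0 \<le> snd z")
          case True
          then have "\<phi>t (fst z) (snd z) = 0" "\<phi>x (fst z) (snd z) = 0"
            using False supp_x[OF True, of "fst z"] supp_t[OF True, of "fst z"] by (force simp: mem_slab)+
          then show ?thesis by simp
        next
          case neg: False
          then show ?thesis using False by (simp add: indicator_def mem_Times_iff)
        qed
      qed
    qed
    have k_meas: "?k \<in> borel_measurable lebesgue"
      by (rule borel_measurable_AE[OF borel_measurable_integrable[OF h_int'] hk])
    have k_int: "integrable lebesgue ?k"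
      using h_int' by (subst integrable_cong_AE[OF k_meas borel_measurable_integrable[OF h_int']]) (use hk in \<open>auto elim!: eventually_mono\<close>)
    have k_eq: "(\<integral>z. ?k z \<partial>lebesgue) = (\<integral>z. ?h z \<partial>lebesgue)"
      by (rule integral_cong_AE[OF k_meas borel_measurable_integrable[OF h_int']]) (use hk in \<open>auto elim!: eventually_mono\<close>)
    have i_int: "integrable lebesgue (\<lambda>x. \<Phi> (x, 0) * \<psi>\<^sub>0 x)"
      and i_eq: "(\<integral>x. \<Phi> (x, 0) * \<psi>\<^sub>0 x \<partial>lebesgue) = (\<integral>x. \<Phi> (x, 0) * \<psi>\<^sub>0 x \<partial>lborel)"
      using weak(3) integrable_completion[of "\<lambda>x. \<Phi> (x, 0) * \<psi>\<^sub>0 x" lborel] integral_completion[of "\<lambda>x. \<Phi> (x, 0) * \<psi>\<^sub>0 x" lborel]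
        borel_measurable_integrable[OF weak(3)] by simp_all
    have ij: "AE x in lebesgue. \<Phi> (x, 0) * \<psi>\<^sub>0 x = \<phi> x 0 * \<psi> x"
      using AE_completion[OF \<psi>\<^sub>0_eq] by eventually_elim (simp add: \<Phi>_def)
    have j_meas: "(\<lambda>x. \<phi> x 0 * \<psi> x) \<in> borel_measurable lebesgue"
      by (rule borel_measurable_AE[OF borel_measurable_integrable[OF i_int] ij])
    have j_int: "integrable lebesgue (\<lambda>x. \<phi> x 0 * \<psi> x)"
      using i_int by (subst integrable_cong_AE[OF j_meas borel_measurable_integrable[OF i_int]]) (use ij in \<open>auto elim!: eventually_mono\<close>)
    have j_eq: "(\<integral>x. \<phi> x 0 * \<psi> x \<partial>lebesgue) = (\<integral>x. \<Phi> (x, 0) * \<psi>\<^sub>0 x \<partial>lebesgue)"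
      by (rule integral_cong_AE[OF j_meas borel_measurable_integrable[OF i_int]]) (use ij in \<open>auto elim!: eventually_mono\<close>)
    show "set_integrable lebesgue ?H (\<lambda>(x, t). \<phi>t x t * u x t + \<phi>x x t * f (u x t)) \<and>
       integrable lebesgue (\<lambda>x. \<phi> x 0 * \<psi> x) \<and>
       (LINT (x, t):?H|lebesgue. \<phi>t x t * u x t + \<phi>x x t * f (u x t)) = - (\<integral>x. \<phi> x 0 * \<psi> x \<partial>lebesgue)"
      using k_int j_int k_eq h_eq' h_eq i_eq j_eq
      by (simp add: set_integrable_def set_lebesgue_integral_def case_prod_unfold)
  qed
qed

end
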